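(* Let $\Phi$ be a stationary point process on $\mathbb R^d$ with non-zero intensity and having exponentially fast decay of correlations with decay function $\delta$ and constants $C_k$, $k\in\mathbb N$, such that $C_k=O(k^{ak})$ for some $a<1$. Let $Y\colon\mathbf N\to B_1$ be a measurable function such that $Y(\varphi)=Y(\varphi\cap B_1)$ for all $\varphi\in\mathbf N$. Define point processes $\Phi_k$ by $\Phi_0:=\Phi$ and, for $k\ge1$, $$\Phi_k:=\sum_{x\in\Phi_{k-1}}\delta_{x+Y(\Phi_{k-1}-x)} .$$ Then for all $k\ge1$, $$\lim_{r\to\infty}\lambda_d(B_r)^{-1}\operatorname{Var}[\Phi_k(B_r)]=\lim_{r\to\infty}\lambda_d(B_r)^{-1}\operatorname{Var}[\Phi(B_r)].$$
   Context: $\lambda_d$ is Lebesgue measure on $\mathbb R^d$; $B_r$ is the ball of radius $r$ centred at $0$. $\mathbf N$ is the space of locally finite counting measures on $\mathbb R^d$ (multiplicities allowed) with the $\sigma$-field generated by evaluations; $\varphi\cap B$ is the restriction of $\varphi$ to $B$; $\varphi-x$ is the translate $\varphi(\cdot+x)$; sums over $x\in\varphi$ are taken with multiplicity. A point process is a random element of $\mathbf N$; it is stationary if its law is translation invariant; its intensity is $\mathbb E\Phi([0,1]^d)$. $\Phi$ is assumed simple (no multiple points). The $n$-th correlation function $\rho^{(n)}$ of $\Phi$ is the Lebesgue density of the $n$-th factorial moment measure, i.e. of the intensity measure of the process of $n$-tuples of distinct points of $\Phi$. $\Phi$ has exponentially fast decay of correlations with decay function $\delta$ and finite constants $C_n$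 (non-decreasing in $n$) if it has correlation functions of all orders, $\delta\colon[0,\infty)\to[0,\infty)$ satisfies $\limsup_{s\to\infty}s^{-b}\log\delta(s)<0$ for some $b>0$, and for all $p,q\in\mathbb N$, $x_1,\dots,x_{p+q}\in\mathbb R^d$, $$|\rho^{(p+q)}(x_1,\dots,x_{p+q})-\rho^{(p)}(x_1,\dots,x_p)\rho^{(q)}(x_{p+1},\dots,x_{p+q})|\le C_{p+q}\,\delta(s),$$ where $s$ is the distance between $\{x_1,\dots,x_p\}$ and $\{x_{p+1},\dots,x_{p+q}\}$. *)

theory Defs
  imports "HOL-Probability.Probability"
begin

section \<open>Counting measures and point processes\<close>

definition counting_measures :: "'a::euclidean_space measure set" where
  "counting_measures =
     {\<phi>. sets \<phi> = sets borel \<and>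
          (\<forall>B\<in>sets borel. bounded B \<longrightarrow> (\<exists>n::nat. emeasure \<phi> B = of_nat n))}"

text \<open>The set of locally finite counting measures with the sigma-field generated by the
  evaluations, built in the same way as \<^const>\<open>subprob_algebra\<close>. Only the underlying set and the
  sigma-field of this object are meaningful, not its values as a measure.\<close>

definition counting_space :: "'a::euclidean_space measure measure" where
  "counting_space =
     (SUP B \<in> sets borel. vimage_algebra counting_measures (\<lambda>\<phi>. emeasure \<phi> B) borel)"

lemma space_counting_space: "space counting_space = counting_measures"
  by (auto simp: counting_space_def space_Sup_eq_UN)

text \<open>\<open>translate \<phi> x\<close> is \<open>\<phi> - x\<close>, that is \<open>B \<mapsto> \<phi> (B + x)\<close>.\<close>

definition translate :: "'a::euclidean_space measure \<Rightarrow> 'a \<Rightarrow> 'a measure" where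
  "translate \<phi> x = distr \<phi> borel (\<lambda>y. y - x)"

definition restr :: "'a::euclidean_space measure \<Rightarrow> 'a set \<Rightarrow> 'a measure" where
  "restr \<phi> B = density \<phi> (indicator B)"

definition points :: "'a::euclidean_space measure \<Rightarrow> 'a set" where
  "points \<phi> = {x. emeasure \<phi> {x} \<noteq> 0}"

definition simple_config :: "'a::euclidean_space measure \<Rightarrow> bool" where
  "simple_config \<phi> \<longleftrightarrow> (\<forall>x. emeasure \<phi> {x} \<le> 1)"

definition point_process :: "'w measure \<Rightarrow> ('w \<Rightarrow> 'a::euclidean_space measure) \<Rightarrow> bool" where
  "point_process M \<Phi> \<longleftrightarrow> prob_space M \<and> \<Phi> \<in> measurable M counting_space"

definition stationary :: "'w measure \<Rightarrow> ('w \<Rightarrow> 'a::euclidean_space measure) \<Rightarrow> bool" where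
  "stationary M \<Phi> \<longleftrightarrow>
     (\<forall>x. distr M counting_space (\<lambda>\<omega>. translate (\<Phi> \<omega>) x) = distr M counting_space \<Phi>)"

definition intensity :: "'w measure \<Rightarrow> ('w \<Rightarrow> 'a::euclidean_space measure) \<Rightarrow> ennreal" where
  "intensity M \<Phi> = (\<integral>\<^sup>+ \<omega>. emeasure (\<Phi> \<omega>) (cbox 0 One) \<partial>M)"

section \<open>Correlation functions\<close>

text \<open>An \<open>n\<close>-tuple of points is an extensional function on \<open>{..<n}\<close>. The expected number of
  \<open>n\<close>-tuples of pairwise distinct points of the process that lie in \<open>B\<close>:\<close>

definition factorial_moment ::
    "'w measure \<Rightarrow> ('w \<Rightarrow> 'a::euclidean_space measure) \<Rightarrow> nat \<Rightarrow> (nat \<Rightarrow> 'a) set \<Rightarrow> ennreal" where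
  "factorial_moment M \<Phi> n B =
     (\<integral>\<^sup>+ \<omega>. emeasure (count_space UNIV)
        {x \<in> {..<n} \<rightarrow>\<^sub>E points (\<Phi> \<omega>). inj_on x {..<n} \<and> x \<in> B} \<partial>M)"

definition correlation_function ::
    "'w measure \<Rightarrow> ('w \<Rightarrow> 'a::euclidean_space measure) \<Rightarrow> nat \<Rightarrow> ((nat \<Rightarrow> 'a) \<Rightarrow> real) \<Rightarrow> bool" where
  "correlation_function M \<Phi> n \<rho> \<longleftrightarrow>
     \<rho> \<in> borel_measurable (PiM {..<n} (\<lambda>_. lborel)) \<and>
     (\<forall>x \<in> space (PiM {..<n} (\<lambda>_. lborel :: 'a measure)). 0 \<le> \<rho> x) \<and>
     (\<forall>B \<in> sets (PiM {..<n} (\<lambda>_. lborel :: 'a measure)).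
        factorial_moment M \<Phi> n B =
          (\<integral>\<^sup>+ x. ennreal (\<rho> x) * indicator B x \<partial>PiM {..<n} (\<lambda>_. lborel)))"

text \<open>The logarithm on \<open>[0,\<infinity>)\<close> with \<open>log 0 = -\<infinity>\<close> (the library has \<open>ln 0 = 0\<close>), so that decay
  functions may vanish.\<close>

definition elog :: "real \<Rightarrow> ereal" where
  "elog t = (if t = 0 then -\<infinity> else ereal (ln t))"

definition decay_function :: "(real \<Rightarrow> real) \<Rightarrow> bool" where
  "decay_function \<delta> \<longleftrightarrow>
     (\<forall>s\<ge>0. 0 \<le> \<delta> s) \<and>
     (\<exists>b>0. Limsup at_top (\<lambda>s. ereal (s powr (- b)) * elog (\<delta> s)) < 0)"

text \<open>The correlation functions are determined only almost everywhere; the inequality is required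
  at every point for some choice of versions.\<close>

definition exp_decay_of_correlations ::
    "'w measure \<Rightarrow> ('w \<Rightarrow> 'a::euclidean_space measure) \<Rightarrow> (real \<Rightarrow> real) \<Rightarrow> (nat \<Rightarrow> real) \<Rightarrow> bool" where
  "exp_decay_of_correlations M \<Phi> \<delta> C \<longleftrightarrow>
     decay_function \<delta> \<and> mono_on {1..} C \<and>
     (\<exists>\<rho> :: nat \<Rightarrow> (nat \<Rightarrow> 'a) \<Rightarrow> real.
        (\<forall>n\<ge>1. correlation_function M \<Phi> n (\<rho> n)) \<and>
        (\<forall>p\<ge>1. \<forall>q\<ge>1. \<forall>x :: nat \<Rightarrow> 'a.
           \<bar>\<rho> (p + q) (restrict x {..<p + q})
              - \<rho> p (restrict x {..<p}) * \<rho> q (\<lambda>i\<in>{..<q}. x (p + i))\<bar>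
           \<le> C (p + q) * \<delta> (setdist (x ` {..<p}) (x ` {p..<p + q}))))"

section \<open>Displacing the points\<close>

text \<open>\<open>displace Y \<phi>\<close> is the sum over \<open>x \<in> \<phi>\<close>, with multiplicity, of the Dirac measures at
  \<open>x + Y (\<phi> - x)\<close>.\<close>

definition displace ::
    "('a::euclidean_space measure \<Rightarrow> 'a) \<Rightarrow> 'a measure \<Rightarrow> 'a measure" where
  "displace Y \<phi> = measure_of UNIV (sets borel)
     (\<lambda>B. \<integral>\<^sup>+ x. emeasure \<phi> {x} * indicator B (x + Y (translate \<phi> x)) \<partial>count_space UNIV)"

lemma sets_displace [simp, measurable_cong]: "sets (displace Y \<phi>) = sets borel"
  using sets.sigma_sets_eq[of "borel :: 'a measure"] by (simp add: displace_def)

lemma emeasure_displace: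
  assumes B: "B \<in> sets borel"
  shows "emeasure (displace Y \<phi>) B =
    (\<integral>\<^sup>+ x. emeasure \<phi> {x} * indicator B (x + Y (translate \<phi> x)) \<partial>count_space UNIV)"
proof (rule emeasure_measure_of[OF displace_def])
  show "sets borel \<subseteq> Pow UNIV" by simp
  show "B \<in> sets (displace Y \<phi>)" using B by simp
  show "positive (sets (displace Y \<phi>))
    (\<lambda>B. \<integral>\<^sup>+ x. emeasure \<phi> {x} * indicator B (x + Y (translate \<phi> x)) \<partial>count_space UNIV)"
    by (simp add: positive_def)
  show "countably_additive (sets (displace Y \<phi>))
    (\<lambda>B. \<integral>\<^sup>+ x. emeasure \<phi> {x} * indicator B (x + Y (translate \<phi> x)) \<partial>count_space UNIV)"
  proof (rule countably_additiveI)
    fix A :: "nat \<Rightarrow> 'a set"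
    assume d: "disjoint_family A"
    have "(\<Sum>i. \<integral>\<^sup>+ x. emeasure \<phi> {x} * indicator (A i) (x + Y (translate \<phi> x)) \<partial>count_space UNIV)
        = (\<integral>\<^sup>+ x. (\<Sum>i. emeasure \<phi> {x} * indicator (A i) (x + Y (translate \<phi> x))) \<partial>count_space UNIV)"
      by (rule nn_integral_suminf[symmetric]) simp
    also have "\<dots> = (\<integral>\<^sup>+ x. emeasure \<phi> {x} * indicator (\<Union>i. A i) (x + Y (translate \<phi> x)) \<partial>count_space UNIV)"
      by (simp add: suminf_indicator[OF d])
    finally show "(\<Sum>i. \<integral>\<^sup>+ x. emeasure \<phi> {x} * indicator (A i) (x + Y (translate \<phi> x)) \<partial>count_space UNIV)
        = (\<integral>\<^sup>+ x. emeasure \<phi> {x} * indicator (\<Union>i. A i) (x + Y (translate \<phi> x)) \<partial>count_space UNIV)" .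
  qed
qed

end

theory Submission
  imports Defs "HOL-Real_Asymp.Real_Asymp"
begin

text \<open>
  Cut the space into the unit cells of the lattice of integer points. A function \<open>F\<close> of the points
  in a bounded window is the sum of its Moebius transform over the subsets of these points, so by
  Campbell's formula \<open>E F\<close> is a series of integrals against the correlation functions. Expanding
  \<open>E (F G)\<close> in the same way for two distant windows and comparing term by term bounds the covariance
  by the decay function at the distance of the windows, times a series
  \<open>\<Sum> K\<^sup>p\<^sup>+\<^sup>q C\<^sub>p\<^sub>+\<^sub>q / (p! q!)\<close>, which converges because \<open>C\<^sub>k = O(k\<^sup>a\<^sup>k)\<close> with \<open>a < 1\<close>. The exponential
  moments needed to rearrange the sums come from the same growth condition.

  Hence covariances of local functionals attached to cells are summable over the lattice. The variance
  of a sum of such functionals is at most of the order of the number of cells, and the variance of the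
  number of points in the cells with corner in a large ball, divided by the volume of the ball, converges.
  The number of points in the ball after \<open>k\<close> steps differs from this sum only by local contributions
  of cells near the boundary sphere. Their number, hence the variance of their sum, is of smaller order
  than the volume, so for every \<open>k \<ge> 0\<close> the limit is the same.
\<close>

section \<open>Counting measures\<close>

text \<open>Nothing bounds the decay function near 0 and the correlation functions are not assumed
  bounded, so exponential moments cannot be read off from the hypotheses. They come from a
  dichotomy. If every correlation function factorises at every tuple, the factorial moments of a
  window are powers of its mean, which stationarity makes finite. If factorisation fails at some
  tuple u, the failure times the correlation function at a distant tuple x is controlled by the
  decay inequality at large distances and at one fixed distance; so each correlation function is
  bounded far from u, and stationarity carries any window there. Of the decay function only an
  inverse power of the distance is kept: the exponent 2d makes covariances summable over a lattice
  of dimension d. As the limit is not assumed positive, the boundary contribution is compared with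
  the main sum by a weighted inequality for the cross covariance, which involves no division by the
  main variance. For k = 0 the ball is treated by the same comparison.\<close>

lemma sets_counting: "\<phi> \<in> counting_measures \<Longrightarrow> sets \<phi> = sets borel"
  by (simp add: counting_measures_def)

lemma space_counting: "\<phi> \<in> counting_measures \<Longrightarrow> space \<phi> = UNIV"
  using sets_eq_imp_space_eq[OF sets_counting[of \<phi>]] by simp

lemma counting_bounded:
  "\<phi> \<in> counting_measures \<Longrightarrow> B \<in> sets borel \<Longrightarrow> bounded B \<Longrightarrow> \<exists>n::nat. emeasure \<phi> B = of_nat n"
  by (simp add: counting_measures_def)

lemma counting_finite:
  "\<phi> \<in> counting_measures \<Longrightarrow> B \<in> sets borel \<Longrightarrow> bounded B \<Longrightarrow> emeasure \<phi> B < \<infinity>"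
  using counting_bounded[of \<phi> B] by (auto simp: of_nat_less_top)

text \<open>The sigma-field is a supremum of pull-backs along evaluations, so a map can be checked
  one evaluation at a time.\<close>

lemma measurable_counting_spaceI:
  assumes "\<And>a. a \<in> space N \<Longrightarrow> L a \<in> counting_measures"
    and "\<And>B. B \<in> sets borel \<Longrightarrow> (\<lambda>a. emeasure (L a) B) \<in> borel_measurable N"
  shows "L \<in> measurable N counting_space"
  using assms by (auto intro!: measurable_Sup2 measurable_vimage_algebra2 simp: counting_space_def)

lemma measurable_emeasure_counting_space:
  assumes "B \<in> sets borel"
  shows "(\<lambda>\<phi>. emeasure \<phi> B) \<in> borel_measurable counting_space"
  unfolding counting_space_def
  by (rule measurable_Sup1[OF _ measurable_vimage_algebra1]) (use assms in auto)

lemma measurable_emeasure_counting [measurable (raw)]: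
  assumes L: "L \<in> measurable N counting_space" and B: "B \<in> sets borel"
  shows "(\<lambda>a. emeasure (L a) B) \<in> borel_measurable N"
  using measurable_compose[OF L measurable_emeasure_counting_space[OF B]] .

lemma measurable_counting_space_in:
  "L \<in> measurable N counting_space \<Longrightarrow> a \<in> space N \<Longrightarrow> L a \<in> counting_measures"
  using measurable_space[of L N counting_space a] by (simp add: space_counting_space)

section \<open>Exhaustion by balls and the atoms of a counting measure\<close>

lemma emeasure_SUP_cball:
  fixes \<mu> :: "'a::euclidean_space measure"
  assumes "sets \<mu> = sets borel" "B \<in> sets borel"
  shows "emeasure \<mu> B = (SUP n::nat. emeasure \<mu> (B \<inter> cball 0 (real n)))"
proof -
  have "(SUP n::nat. emeasure \<mu> (B \<inter> cball 0 (real n))) = emeasure \<mu> (\<Union>n::nat. B \<inter> cball 0 (real n))"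
  proof (rule SUP_emeasure_incseq)
    show "range (\<lambda>n::nat. B \<inter> cball 0 (real n)) \<subseteq> sets \<mu>"
      by (simp add: image_subset_iff assms sets.Int)
    show "incseq (\<lambda>n::nat. B \<inter> cball 0 (real n))"
      unfolding incseq_def by (intro allI impI Int_mono subset_refl subset_cball) simp
  qed
  also have "(\<Union>n::nat. B \<inter> cball 0 (real n)) = B"
  proof (intro equalityI subsetI)
    fix x assume "x \<in> B"
    then show "x \<in> (\<Union>n::nat. B \<inter> cball 0 (real n))"
      using real_arch_simple[of "norm x"] by auto
  qed auto
  finally show ?thesis by simp
qed

lemma measure_eqI_bounded:
  fixes \<mu> \<nu> :: "'a::euclidean_space measure"
  assumes "sets \<mu> = sets borel" "sets \<nu> = sets borel"
    and "\<And>B. B \<in> sets borel \<Longrightarrow> bounded B \<Longrightarrow> emeasure \<mu> B = emeasure \<nu> B"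
  shows "\<mu> = \<nu>"
proof (rule measure_eqI)
  fix B assume "B \<in> sets \<mu>"
  then have B: "B \<in> sets borel" using assms by simp
  show "emeasure \<mu> B = emeasure \<nu> B"
    unfolding emeasure_SUP_cball[OF assms(1) B] emeasure_SUP_cball[OF assms(2) B]
    using B by (intro SUP_cong refl assms(3)) auto
qed (use assms in simp)

text \<open>Masses of bounded sets are integers. Around a point without mass, small balls have mass
  tending to 0, hence exactly 0 from some radius on; by the Lindelof property countably many such
  balls cover \<open>B\<close>.\<close>

lemma counting_atom:
  fixes \<phi> :: "'a::euclidean_space measure"
  assumes \<phi>: "\<phi> \<in> counting_measures" and B: "B \<in> sets borel" "bounded B"
    and nz: "\<And>x. x \<in> B \<Longrightarrow> emeasure \<phi> {x} = 0"
  shows "emeasure \<phi> B = 0"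
proof -
  note S = sets_counting[OF \<phi>]
  have ex: "\<exists>e>0. emeasure \<phi> (B \<inter> ball x e) = 0" if x: "x \<in> B" for x
  proof -
    let ?A = "\<lambda>n::nat. B \<inter> ball x (inverse (real (Suc n)))"
    have "(\<lambda>n. emeasure \<phi> (?A n)) \<longlonglongrightarrow> emeasure \<phi> (\<Inter>n. ?A n)"
    proof (rule Lim_emeasure_decseq)
      show "range ?A \<subseteq> sets \<phi>" by (simp add: image_subset_iff B S sets.Int)
      show "decseq ?A"
        unfolding decseq_def
        by (intro allI impI Int_mono subset_refl subset_ball le_imp_inverse_le) auto
      show "emeasure \<phi> (?A i) \<noteq> \<infinity>" for i
        using counting_finite[OF \<phi>, of "?A i"] B by (simp add: bounded_Int less_top)
    qed
    also have "(\<Inter>n. ?A n) = {x}"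
    proof -
      have "dist x y = 0" if "\<forall>n. dist x y < inverse (real (Suc n))" for y
        using that reals_Archimedean[of "dist x y"] zero_le_dist[of x y]
        by (metis less_irrefl less_trans order_le_less)
      then have "y = x" if "\<forall>n. dist x y < inverse (real (Suc n))" for y
        using that by (metis dist_eq_0_iff)
      then show ?thesis using x by (auto simp del: of_nat_Suc)
    qed
    finally have "(\<lambda>n. emeasure \<phi> (?A n)) \<longlonglongrightarrow> 0" using nz[OF x] by simp
    then have "\<forall>\<^sub>F n in sequentially. emeasure \<phi> (?A n) < 1"
      by (rule order_tendstoD) simp
    then obtain n where n: "emeasure \<phi> (?A n) < 1"
      by (auto simp: eventually_sequentially)
    obtain m :: nat where m: "emeasure \<phi> (?A n) = of_nat m"
      using counting_bounded[OF \<phi>, of "?A n"] B by (auto intro: bounded_Int)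
    with n have "m = 0"
      by (cases m) (auto simp: add_increasing not_less[symmetric])
    with m show ?thesis by (intro exI[of _ "inverse (real (Suc n))"]) simp
  qed
  then obtain e where e: "\<And>x. x \<in> B \<Longrightarrow> e x > 0" "\<And>x. x \<in> B \<Longrightarrow> emeasure \<phi> (B \<inter> ball x (e x)) = 0"
    by metis
  obtain F' where F': "F' \<subseteq> (\<lambda>x. ball x (e x)) ` B" "countable F'" "\<Union>F' = (\<Union>x\<in>B. ball x (e x))"
    using Lindelof[of "(\<lambda>x. ball x (e x)) ` B"] by auto
  have "emeasure \<phi> (\<Union>U\<in>F'. B \<inter> U) = 0"
  proof (rule null_setsD1, rule null_sets_UN')
    show "countable F'" by fact
    show "B \<inter> U \<in> null_sets \<phi>" if "U \<in> F'" for U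
      using F'(1) that e B S by (auto simp: null_sets_def)
  qed
  also have "(\<Union>U\<in>F'. B \<inter> U) = B"
    using F'(3) e(1) by auto
  finally show ?thesis .
qed

lemma bounded_subset_cball_0:
  fixes B :: "'a::euclidean_space set"
  assumes "bounded B"
  obtains R where "B \<subseteq> cball 0 R"
  using assms by (auto simp: bounded_iff subset_iff)

lemma counting_singleton: "\<phi> \<in> counting_measures \<Longrightarrow> \<exists>n::nat. emeasure \<phi> {x} = of_nat n"
  by (rule counting_bounded) auto

lemma points_ge_1: "\<phi> \<in> counting_measures \<Longrightarrow> x \<in> points \<phi> \<Longrightarrow> 1 \<le> emeasure \<phi> {x}"
  using counting_singleton[of \<phi> x] by (auto simp: points_def)

text \<open>Each atom weighs at least 1, so a ball of mass n cannot contain n + 1 of them.\<close>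

lemma finite_points:
  fixes \<phi> :: "'a::euclidean_space measure"
  assumes \<phi>: "\<phi> \<in> counting_measures" and B: "bounded B"
  shows "finite (points \<phi> \<inter> B)"
proof (rule ccontr)
  assume inf: "infinite (points \<phi> \<inter> B)"
  obtain R where R: "B \<subseteq> cball 0 R" using bounded_subset_cball_0[OF B] .
  obtain n :: nat where n: "emeasure \<phi> (cball 0 R) = of_nat n"
    using counting_bounded[OF \<phi>, of "cball 0 R"] by auto
  obtain F where F: "F \<subseteq> points \<phi> \<inter> B" "finite F" "card F = Suc n"
    using infinite_arbitrarily_large[OF inf, of "Suc n"] by auto
  have "of_nat (Suc n) = (\<Sum>x\<in>F. (1::ennreal))" using F by simp
  also have "\<dots> \<le> (\<Sum>x\<in>F. emeasure \<phi> {x})"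
    using F points_ge_1[OF \<phi>] by (intro sum_mono) auto
  also have "\<dots> = emeasure \<phi> F"
    using F sets_counting[OF \<phi>] by (intro emeasure_eq_sum_singleton[symmetric]) auto
  also have "\<dots> \<le> emeasure \<phi> (cball 0 R)"
    using F R sets_counting[OF \<phi>] by (intro emeasure_mono) auto
  finally have "of_nat (Suc n) \<le> (of_nat n :: ennreal)" using n by simp
  then show False by (simp only: of_nat_le_iff)
qed

text \<open>The part of \<open>B\<close> outside the atoms is null by \<open>counting_atom\<close>;
  hence a counting measure is purely atomic.\<close>

lemma emeasure_counting_sum:
  assumes \<phi>: "\<phi> \<in> counting_measures" and B: "B \<in> sets borel" "bounded B"
  shows "emeasure \<phi> B = (\<Sum>x\<in>points \<phi> \<inter> B. emeasure \<phi> {x})"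
proof -
  have fin: "finite (points \<phi> \<inter> B)" using finite_points[OF \<phi> B(2)] .
  have mS: "points \<phi> \<inter> B \<in> sets \<phi>"
    unfolding sets_counting[OF \<phi>] by (rule borel_closed) (rule finite_imp_closed[OF fin])
  have "emeasure \<phi> (B - points \<phi> \<inter> B) = 0"
    by (rule counting_atom[OF \<phi>]) (use B mS sets_counting[OF \<phi>] in \<open>auto simp: points_def intro: bounded_subset\<close>)
  then have "emeasure \<phi> B = emeasure \<phi> (points \<phi> \<inter> B)"
    using emeasure_Diff_null_set[of "B - points \<phi> \<inter> B" \<phi> B] mS B sets_counting[OF \<phi>]
    by (simp add: null_sets_def Diff_Diff_Int Int_absorb1)
  also have "\<dots> = (\<Sum>x\<in>points \<phi> \<inter> B. emeasure \<phi> {x})"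
    using fin sets_counting[OF \<phi>] by (intro emeasure_eq_sum_singleton) auto
  finally show ?thesis .
qed

lemma nn_integral_count_space_points:
  assumes "finite (points \<phi> \<inter> {x. f x \<noteq> 0})"
  shows "(\<integral>\<^sup>+x. emeasure \<phi> {x} * f x \<partial>count_space UNIV)
    = (\<Sum>x\<in>points \<phi> \<inter> {x. f x \<noteq> 0}. emeasure \<phi> {x} * f x)"
  using assms by (intro nn_integral_count_space') (auto simp: points_def)

section \<open>Integrals against configurations as sums over atoms\<close>

text \<open>The same masses on the discrete sigma-field, where every function is measurable;
  \<open>displace\<close> is defined by sums of this kind.\<close>

abbreviation atoms :: "'a::euclidean_space measure \<Rightarrow> 'a measure" where
  "atoms \<phi> \<equiv> density (count_space UNIV) (\<lambda>x. emeasure \<phi> {x})"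

lemma counting_eq_distr_atoms:
  assumes \<phi>: "\<phi> \<in> counting_measures"
  shows "\<phi> = distr (atoms \<phi>) borel (\<lambda>x. x)"
proof (rule measure_eqI_bounded)
  fix B :: "'a set" assume B: "B \<in> sets borel" "bounded B"
  have "emeasure (distr (atoms \<phi>) borel (\<lambda>x. x)) B
      = (\<integral>\<^sup>+x. emeasure \<phi> {x} * indicator B x \<partial>count_space UNIV)"
    using B by (simp add: emeasure_distr emeasure_density)
  also have "\<dots> = (\<Sum>x\<in>points \<phi> \<inter> B. emeasure \<phi> {x} * indicator B x)"
    using nn_integral_count_space_points[of \<phi> "indicator B"] finite_points[OF \<phi> B(2)]
    by (simp add: indicator_def of_bool_def Collect_mem_eq cong: if_cong)
  also have "\<dots> = (\<Sum>x\<in>points \<phi> \<inter> B. emeasure \<phi> {x})" by (intro sum.cong) auto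
  finally show "emeasure \<phi> B = emeasure (distr (atoms \<phi>) borel (\<lambda>x. x)) B"
    using emeasure_counting_sum[OF \<phi> B] by simp
qed (use sets_counting[OF \<phi>] in auto)

lemma nn_integral_counting:
  assumes \<phi>: "\<phi> \<in> counting_measures" and f: "f \<in> borel_measurable borel"
  shows "(\<integral>\<^sup>+x. f x \<partial>\<phi>) = (\<integral>\<^sup>+x. emeasure \<phi> {x} * f x \<partial>count_space UNIV)"
proof -
  have "(\<integral>\<^sup>+x. f x \<partial>\<phi>) = (\<integral>\<^sup>+x. f x \<partial>distr (atoms \<phi>) borel (\<lambda>x. x))"
    by (rule arg_cong[OF counting_eq_distr_atoms[OF \<phi>]])
  also have "\<dots> = (\<integral>\<^sup>+x. emeasure \<phi> {x} * f x \<partial>count_space UNIV)"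
    using f by (simp add: nn_integral_distr nn_integral_density)
  finally show ?thesis .
qed

lemma counting_eqI:
  assumes "\<phi> \<in> counting_measures" "\<psi> \<in> counting_measures" "\<And>x. emeasure \<phi> {x} = emeasure \<psi> {x}"
  shows "\<phi> = \<psi>"
proof -
  have "\<phi> = distr (atoms \<phi>) borel (\<lambda>x. x)" by (rule counting_eq_distr_atoms[OF assms(1)])
  also have "\<dots> = distr (atoms \<psi>) borel (\<lambda>x. x)" by (simp only: assms(3))
  also have "\<dots> = \<psi>" by (rule counting_eq_distr_atoms[OF assms(2), symmetric])
  finally show ?thesis .
qed

lemma sum_points_of_nat:
  fixes \<phi> :: "'a::euclidean_space measure"
  assumes "\<phi> \<in> counting_measures"
  shows "\<exists>n::nat. (\<Sum>x\<in>A. emeasure \<phi> {x}) = of_nat n"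
proof -
  have "\<forall>x. \<exists>n::nat. emeasure \<phi> {x} = of_nat n" using counting_singleton[OF assms] by simp
  then have "\<exists>m. \<forall>x. emeasure \<phi> {x} = of_nat (m x :: nat)" by (simp only: choice_iff)
  then obtain m :: "'a \<Rightarrow> nat" where "\<forall>x. emeasure \<phi> {x} = of_nat (m x)" ..
  then have "(\<Sum>x\<in>A. emeasure \<phi> {x}) = of_nat (sum m A)" by simp
  then show ?thesis by blast
qed

section \<open>Restriction, translation and one displacement step\<close>

lemma sets_restr [simp]: "sets (restr \<phi> A) = sets \<phi>"
  by (simp add: restr_def)

lemma emeasure_restr:
  assumes "\<phi> \<in> counting_measures" "A \<in> sets borel" "B \<in> sets borel"
  shows "emeasure (restr \<phi> A) B = emeasure \<phi> (A \<inter> B)"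
proof -
  have "emeasure (restr \<phi> A) B = (\<integral>\<^sup>+x. indicator A x * indicator B x \<partial>\<phi>)"
    using assms sets_counting[OF assms(1)] by (simp add: restr_def emeasure_density)
  also have "\<dots> = (\<integral>\<^sup>+x. indicator (A \<inter> B) x \<partial>\<phi>)"
    by (simp only: indicator_inter_arith)
  finally show ?thesis using assms sets_counting[OF assms(1)] by simp
qed

lemma restr_counting:
  assumes "\<phi> \<in> counting_measures" "A \<in> sets borel"
  shows "restr \<phi> A \<in> counting_measures"
  using assms by (auto simp: counting_measures_def emeasure_restr bounded_Int)

lemma restr_cong:
  assumes "\<phi> \<in> counting_measures" "\<psi> \<in> counting_measures" "A \<in> sets borel"
    and "\<And>x. x \<in> A \<Longrightarrow> emeasure \<phi> {x} = emeasure \<psi> {x}"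
  shows "restr \<phi> A = restr \<psi> A"
proof (rule counting_eqI)
  fix x
  show "emeasure (restr \<phi> A) {x} = emeasure (restr \<psi> A) {x}"
    using assms by (cases "x \<in> A") (simp_all add: emeasure_restr)
qed (use assms restr_counting in auto)

lemma sets_translate [simp]: "sets (translate \<phi> x) = sets borel"
  by (simp add: translate_def)

lemma emeasure_translate:
  assumes "\<phi> \<in> counting_measures" "B \<in> sets borel"
  shows "emeasure (translate \<phi> x) B = emeasure \<phi> ((\<lambda>y. y + x) ` B)"
proof -
  have "(\<lambda>y. y - x) -` B = (\<lambda>y. y + x) ` B" by (auto simp: image_iff) (metis diff_add_cancel)
  moreover have "(\<lambda>y. y - x) \<in> measurable \<phi> borel"
    using sets_counting[OF assms(1)] by (simp cong: measurable_cong_sets)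
  ultimately show ?thesis
    using assms by (simp add: translate_def emeasure_distr space_counting)
qed

lemma translate_singleton:
  "\<phi> \<in> counting_measures \<Longrightarrow> emeasure (translate \<phi> x) {y} = emeasure \<phi> {y + x}"
  by (simp add: emeasure_translate)

lemma translate_counting:
  assumes "\<phi> \<in> counting_measures"
  shows "translate \<phi> x \<in> counting_measures"
proof -
  have "\<exists>n::nat. emeasure (translate \<phi> x) B = of_nat n" if B: "B \<in> sets borel" "bounded B" for B
  proof -
    have "(\<lambda>y. y + x) ` B = (\<lambda>y. y - x) -` B" by (auto simp: image_iff) (metis diff_add_cancel)
    also have "\<dots> \<in> sets borel" using B measurable_sets[of "\<lambda>y. y - x" borel borel B] by simp
    finally show ?thesis
      using assms B bounded_translation[OF B(2), of x]
      by (simp add: emeasure_translate counting_bounded add.commute)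
  qed
  then show ?thesis by (simp add: counting_measures_def)
qed

text \<open>On the discrete sigma-field any map can be pushed forward, so the identity holds for
  every \<open>Y\<close> and \<phi>, before any measurability or locality is known.\<close>

lemma displace_eq_distr:
  "displace Y \<phi> = distr (atoms \<phi>) borel (\<lambda>x. x + Y (translate \<phi> x))"
  by (rule measure_eqI) (auto simp: emeasure_displace emeasure_distr emeasure_density indicator_def
      intro!: nn_integral_cong)

lemma nn_integral_displace:
  "f \<in> borel_measurable borel \<Longrightarrow> (\<integral>\<^sup>+x. f x \<partial>displace Y \<phi>)
     = (\<integral>\<^sup>+x. emeasure \<phi> {x} * f (x + Y (translate \<phi> x)) \<partial>count_space UNIV)"
  by (simp add: displace_eq_distr nn_integral_distr nn_integral_density)

text \<open>A point that lands in \<open>B\<close> started within distance 1 of it, so only finitely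
  many points contribute, each with an integer multiplicity.\<close>

lemma displace_counting:
  fixes Y :: "'a::euclidean_space measure \<Rightarrow> 'a"
  assumes \<phi>: "\<phi> \<in> counting_measures" and Y: "\<forall>\<phi>\<in>counting_measures. Y \<phi> \<in> cball 0 1"
  shows "displace Y \<phi> \<in> counting_measures"
proof -
  have "\<exists>n::nat. emeasure (displace Y \<phi>) B = of_nat n" if B: "B \<in> sets borel" "bounded B" for B
  proof -
    let ?f = "\<lambda>x. indicator B (x + Y (translate \<phi> x)) :: ennreal"
    obtain R where R: "B \<subseteq> cball 0 R" using bounded_subset_cball_0[OF B(2)] .
    have "{x. ?f x \<noteq> 0} \<subseteq> cball 0 (R + 1)"
    proof
      fix x assume "x \<in> {x. ?f x \<noteq> 0}"
      then have "x + Y (translate \<phi> x) \<in> cball 0 R" using R by (auto simp: indicator_def split: if_splits)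
      moreover have "norm (Y (translate \<phi> x)) \<le> 1" using Y translate_counting[OF \<phi>] by auto
      moreover have "norm x \<le> norm (x + Y (translate \<phi> x)) + norm (Y (translate \<phi> x))"
        using norm_triangle_ineq4[of "x + Y (translate \<phi> x)" "Y (translate \<phi> x)"] by simp
      ultimately show "x \<in> cball 0 (R + 1)" by simp
    qed
    then have fin: "finite (points \<phi> \<inter> {x. ?f x \<noteq> 0})"
      by (intro finite_points[OF \<phi>]) (rule bounded_subset[OF bounded_cball])
    have "emeasure (displace Y \<phi>) B = (\<Sum>x\<in>points \<phi> \<inter> {x. ?f x \<noteq> 0}. emeasure \<phi> {x} * ?f x)"
      unfolding emeasure_displace[OF B(1)] by (rule nn_integral_count_space_points[OF fin])
    also have "\<dots> = (\<Sum>x\<in>points \<phi> \<inter> {x. ?f x \<noteq> 0}. emeasure \<phi> {x})"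
      by (intro sum.cong) (auto simp: indicator_def)
    finally show ?thesis using sum_points_of_nat[OF \<phi>] by simp
  qed
  then show ?thesis by (simp add: counting_measures_def)
qed

text \<open>Integration against a counting measure is measurable in the measure: after restriction to a
  ball and normalisation this is the corresponding fact about the Giry monad.\<close>

lemma measurable_nn_integral_counting:
  fixes L :: "'b \<Rightarrow> 'a::euclidean_space measure" and f :: "'b \<Rightarrow> 'a \<Rightarrow> ennreal"
  assumes f: "(\<lambda>(a, x). f a x) \<in> borel_measurable (N \<Otimes>\<^sub>M borel)"
    and L: "L \<in> measurable N counting_space"
  shows "(\<lambda>a. \<integral>\<^sup>+x. f a x \<partial>L a) \<in> borel_measurable N"
proof -
  define W where "W n = cball (0::'a) (real n)" for n
  have W: "W n \<in> sets borel" "bounded (W n)" for n by (auto simp: W_def)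
  \<comment> \<open>The summand 1 keeps the total mass at most 1 and the divisor nonzero, also when
    the ball is empty; multiplying by the divisor afterwards recovers the integral over the
    ball.\<close>
  define K where "K n a = density (L a) (\<lambda>x. indicator (W n) x / (1 + emeasure (L a) (W n)))" for n a
  note Lc = measurable_counting_space_in[OF L]
  have fin: "emeasure (L a) (W n) < \<infinity>" if "a \<in> space N" for a n
    using counting_finite[OF Lc[OF that] W] .
  have Lm: "measurable (L a) borel = borel_measurable (borel :: 'a measure)" if "a \<in> space N" for a
    by (rule measurable_cong_sets) (use sets_counting[OF Lc[OF that]] in auto)
  have intK: "(\<integral>\<^sup>+x. g x \<partial>K n a) = (\<integral>\<^sup>+x. indicator (W n) x * g x \<partial>L a) / (1 + emeasure (L a) (W n))"
    if "a \<in> space N" "g \<in> borel_measurable borel" for g n a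
    unfolding K_def using that W
    by (subst nn_integral_density) (auto simp: Lm[OF that(1)] nn_integral_divide[symmetric]
         ennreal_times_divide mult.commute intro!: nn_integral_cong)
  have K: "K n \<in> measurable N (subprob_algebra borel)" for n
  proof (rule measurable_subprob_algebra)
    have em: "emeasure (K n a) A = emeasure (L a) (W n \<inter> A) / (1 + emeasure (L a) (W n))"
      if "a \<in> space N" "A \<in> sets borel" for a A
    proof -
      have "emeasure (K n a) A = (\<integral>\<^sup>+x. indicator A x \<partial>K n a)"
        using that sets_counting[OF Lc[OF that(1)]] by (simp add: K_def)
      also have "\<dots> = emeasure (L a) (W n \<inter> A) / (1 + emeasure (L a) (W n))"
        using that W sets_counting[OF Lc[OF that(1)]]
        by (subst intK) (auto simp: indicator_inter_arith[symmetric])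
      finally show ?thesis .
    qed
    show "sets (K n a) = sets borel" if "a \<in> space N" for a
      using sets_counting[OF Lc[OF that]] by (simp add: K_def)
    show "subprob_space (K n a)" if a: "a \<in> space N" for a
    proof
      have "emeasure (K n a) (space (K n a)) = emeasure (L a) (W n) / (1 + emeasure (L a) (W n))"
        using em[OF a, of UNIV] space_counting[OF Lc[OF a]] by (simp add: K_def)
      also have "\<dots> \<le> 1"
        using fin[OF a, of n] by (intro divide_le_posI_ennreal) (auto simp: add_pos_nonneg)
      finally show "emeasure (K n a) (space (K n a)) \<le> 1" .
      show "space (K n a) \<noteq> {}" using space_counting[OF Lc[OF a]] by (simp add: K_def)
    qed
    show "(\<lambda>a. emeasure (K n a) A) \<in> borel_measurable N" if [measurable]: "A \<in> sets borel" for A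
    proof (subst measurable_cong[OF em])
      show "(\<lambda>a. emeasure (L a) (W n \<inter> A) / (1 + emeasure (L a) (W n))) \<in> borel_measurable N"
        using W L by measurable
    qed (use that in auto)
  qed
  have fx: "f a \<in> borel_measurable borel" if "a \<in> space N" for a
    using measurable_Pair2[OF f that] by simp
  have "(\<lambda>a. SUP n. (1 + emeasure (L a) (W n)) * (\<integral>\<^sup>+x. f a x \<partial>K n a)) \<in> borel_measurable N"
    using nn_integral_measurable_subprob_algebra2[OF f K] W L by measurable
  also have "?this \<longleftrightarrow> ?thesis"
  proof (rule measurable_cong)
    fix a assume a: "a \<in> space N"
    have "(1 + emeasure (L a) (W n)) * (\<integral>\<^sup>+x. f a x \<partial>K n a) = (\<integral>\<^sup>+x. indicator (W n) x * f a x \<partial>L a)" for n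
      unfolding intK[OF a fx[OF a]] using fin[OF a, of n]
      by (subst ennreal_times_divide, subst mult.commute, subst ennreal_mult_divide_eq) (auto simp: less_top)
    then have "(SUP n. (1 + emeasure (L a) (W n)) * (\<integral>\<^sup>+x. f a x \<partial>K n a))
       = (SUP n. \<integral>\<^sup>+x. indicator (W n) x * f a x \<partial>L a)" by simp
    also have "\<dots> = (\<integral>\<^sup>+x. (SUP n. indicator (W n) x * f a x) \<partial>L a)"
      using fx[OF a] W
      by (intro nn_integral_monotone_convergence_SUP[symmetric])
         (auto simp: Lm[OF a] incseq_def le_fun_def W_def indicator_def)
    also have "\<dots> = (\<integral>\<^sup>+x. f a x \<partial>L a)"
    proof (rule nn_integral_cong)
      fix x :: 'a
      obtain n0 :: nat where "norm x \<le> real n0" using real_arch_simple by blast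
      then have "f a x \<le> indicator (W n0) x * f a x" by (simp add: W_def)
      then show "(SUP n. indicator (W n) x * f a x) = f a x"
        by (intro antisym SUP_least) (auto simp: indicator_def intro: SUP_upper2)
    qed
    finally show "(SUP n. (1 + emeasure (L a) (W n)) * (\<integral>\<^sup>+x. f a x \<partial>K n a)) = (\<integral>\<^sup>+x. f a x \<partial>L a)" .
  qed
  finally show ?thesis .
qed

text \<open>Evaluations of the translate are integrals of \<open>indicator B (y - g a)\<close>,
  which is jointly measurable. The shift must be allowed to vary because a displacement recentres
  the configuration at each of its points.\<close>

lemma measurable_translate [measurable (raw)]:
  fixes L :: "'b \<Rightarrow> 'a::euclidean_space measure"
  assumes L: "L \<in> measurable N counting_space" and g [measurable]: "g \<in> borel_measurable N"
  shows "(\<lambda>a. translate (L a) (g a)) \<in> measurable N counting_space"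
proof (rule measurable_counting_spaceI)
  note Lc = measurable_counting_space_in[OF L]
  show "translate (L a) (g a) \<in> counting_measures" if "a \<in> space N" for a
    using translate_counting[OF Lc[OF that]] .
  fix B :: "'a set" assume B [measurable]: "B \<in> sets borel"
  have "(\<lambda>a. \<integral>\<^sup>+y. indicator B (y - g a) \<partial>L a) \<in> borel_measurable N"
    by (rule measurable_nn_integral_counting[OF _ L]) measurable
  also have "?this \<longleftrightarrow> (\<lambda>a. emeasure (translate (L a) (g a)) B) \<in> borel_measurable N"
  proof (rule measurable_cong)
    fix a assume a: "a \<in> space N"
    have "emeasure (translate (L a) (g a)) B = (\<integral>\<^sup>+y. indicator B y \<partial>translate (L a) (g a))"
      by simp
    also have "\<dots> = (\<integral>\<^sup>+y. indicator B (y - g a) \<partial>L a)"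
      unfolding translate_def using sets_counting[OF Lc[OF a]]
      by (subst nn_integral_distr) (auto cong: measurable_cong_sets)
    finally show "(\<integral>\<^sup>+y. indicator B (y - g a) \<partial>L a) = emeasure (translate (L a) (g a)) B" ..
  qed
  finally show "(\<lambda>a. emeasure (translate (L a) (g a)) B) \<in> borel_measurable N" .
qed

section \<open>Iterated displacement\<close>

text \<open>Comparing atoms avoids measurability conditions on \<open>W\<close>; for counting
  measures and Borel \<open>W\<close> it amounts to equality of the restrictions, see
  \<open>restr_cong\<close>.\<close>

definition agree :: "'a::euclidean_space set \<Rightarrow> 'a measure \<Rightarrow> 'a measure \<Rightarrow> bool" where
  "agree W \<phi> \<psi> \<longleftrightarrow> (\<forall>x\<in>W. emeasure \<phi> {x} = emeasure \<psi> {x})"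

lemma agree_mono: "agree W \<phi> \<psi> \<Longrightarrow> V \<subseteq> W \<Longrightarrow> agree V \<phi> \<psi>"
  by (auto simp: agree_def)

locale displacement =
  fixes Y :: "'a::euclidean_space measure \<Rightarrow> 'a"
  assumes Y_measurable: "Y \<in> borel_measurable counting_space"
    and Y_cball: "\<forall>\<phi>\<in>counting_measures. Y \<phi> \<in> cball 0 1"
    and Y_local: "\<forall>\<phi>\<in>counting_measures. Y \<phi> = Y (restr \<phi> (cball 0 1))"
begin

lemma measurable_Y [measurable (raw)]:
  "L \<in> measurable N counting_space \<Longrightarrow> (\<lambda>a. Y (L a)) \<in> borel_measurable N"
  by (rule measurable_compose[OF _ Y_measurable])

text \<open>Once \<phi> is a counting measure, \<open>x + Y (translate \<phi> x)\<close> is Borel in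
  \<open>x\<close>, so the discrete sum becomes an integral against \<phi>. In this form
  measurability in \<phi> and iteration become accessible.\<close>

lemma nn_integral_displace_counting:
  assumes \<phi>: "\<phi> \<in> counting_measures" and f [measurable]: "f \<in> borel_measurable borel"
  shows "(\<integral>\<^sup>+x. f x \<partial>displace Y \<phi>) = (\<integral>\<^sup>+x. f (x + Y (translate \<phi> x)) \<partial>\<phi>)"
proof -
  have [measurable]: "(\<lambda>_. \<phi>) \<in> measurable borel counting_space"
    using \<phi> by (intro measurable_const) (simp add: space_counting_space)
  have "(\<lambda>x. f (x + Y (translate \<phi> x))) \<in> borel_measurable borel" by measurable
  then show ?thesis by (simp add: nn_integral_displace nn_integral_counting[OF \<phi>])
qed

lemma measurable_displace [measurable (raw)]:
  fixes L :: "'b \<Rightarrow> 'a measure"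
  assumes L [measurable]: "L \<in> measurable N counting_space"
  shows "(\<lambda>a. displace Y (L a)) \<in> measurable N counting_space"
proof (rule measurable_counting_spaceI)
  note Lc = measurable_counting_space_in[OF L]
  show "displace Y (L a) \<in> counting_measures" if "a \<in> space N" for a
    using displace_counting[OF Lc[OF that] Y_cball] .
  fix B :: "'a set" assume B [measurable]: "B \<in> sets borel"
  have "(\<lambda>a. \<integral>\<^sup>+x. indicator B (x + Y (translate (L a) x)) \<partial>L a) \<in> borel_measurable N"
    by (rule measurable_nn_integral_counting[OF _ L]) measurable
  also have "?this \<longleftrightarrow> (\<lambda>a. emeasure (displace Y (L a)) B) \<in> borel_measurable N"
  proof (rule measurable_cong)
    fix a assume a: "a \<in> space N"
    have "emeasure (displace Y (L a)) B = (\<integral>\<^sup>+y. indicator B y \<partial>displace Y (L a))"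
      by simp
    then show "(\<integral>\<^sup>+x. indicator B (x + Y (translate (L a) x)) \<partial>L a) = emeasure (displace Y (L a)) B"
      using nn_integral_displace_counting[OF Lc[OF a], of "indicator B"] by simp
  qed
  finally show "(\<lambda>a. emeasure (displace Y (L a)) B) \<in> borel_measurable N" .
qed

section \<open>Trajectories of points and their finite range\<close>

abbreviation iter :: "nat \<Rightarrow> 'a measure \<Rightarrow> 'a measure" where
  "iter k \<equiv> displace Y ^^ k"

lemma iter_counting: "\<phi> \<in> counting_measures \<Longrightarrow> iter k \<phi> \<in> counting_measures"
  by (induction k) (auto intro: displace_counting[OF _ Y_cball])

lemma measurable_iter [measurable (raw)]:
  "L \<in> measurable N counting_space \<Longrightarrow> (\<lambda>a. iter k (L a)) \<in> measurable N counting_space"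
  by (induction k) (auto intro: measurable_displace)

text \<open>The position after \<open>k\<close> steps of the point that starts at \<open>x\<close>.\<close>

primrec pos :: "nat \<Rightarrow> 'a measure \<Rightarrow> 'a \<Rightarrow> 'a" where
  "pos 0 \<phi> x = x"
| "pos (Suc k) \<phi> x = pos k \<phi> x + Y (translate (iter k \<phi>) (pos k \<phi> x))"

lemma measurable_pos [measurable (raw)]:
  assumes [measurable]: "L \<in> measurable N counting_space" "g \<in> borel_measurable N"
  shows "(\<lambda>a. pos k (L a) (g a)) \<in> borel_measurable N"
  by (induction k) simp_all

text \<open>The last step is moved into the integrand while \<open>f\<close> stays arbitrary. A
  function of the starting location suffices to follow the points: coinciding points are displaced
  equally and carry their multiplicities along.\<close>

lemma nn_integral_iter:
  assumes \<phi>: "\<phi> \<in> counting_measures" and f: "f \<in> borel_measurable borel"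
  shows "(\<integral>\<^sup>+x. f x \<partial>iter k \<phi>) = (\<integral>\<^sup>+x. f (pos k \<phi> x) \<partial>\<phi>)"
  using f
proof (induction k arbitrary: f)
  case (Suc k)
  note [measurable] = Suc.prems
  have [measurable]: "(\<lambda>_. iter k \<phi>) \<in> measurable borel counting_space"
    using iter_counting[OF \<phi>] by (intro measurable_const) (simp add: space_counting_space)
  have "(\<lambda>x. f (x + Y (translate (iter k \<phi>) x))) \<in> borel_measurable borel" by measurable
  from Suc.IH[OF this] show ?case
    using nn_integral_displace_counting[OF iter_counting[OF \<phi>] Suc.prems, of k] by simp
qed simp

lemma emeasure_iter:
  assumes "\<phi> \<in> counting_measures" "B \<in> sets borel"
  shows "emeasure (iter k \<phi>) B = (\<integral>\<^sup>+x. indicator B (pos k \<phi> x) \<partial>\<phi>)"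
proof -
  have "emeasure (iter k \<phi>) B = (\<integral>\<^sup>+x. indicator B x \<partial>iter k \<phi>)"
    using assms sets_counting[OF iter_counting[OF assms(1)]] by simp
  then show ?thesis using nn_integral_iter[OF assms(1), of "indicator B" k] assms by simp
qed

lemma norm_Y: "\<phi> \<in> counting_measures \<Longrightarrow> norm (Y \<phi>) \<le> 1"
  using Y_cball by auto

lemma dist_pos:
  assumes "\<phi> \<in> counting_measures"
  shows "dist x (pos k \<phi> x) \<le> real k"
proof (induction k)
  case (Suc k)
  have "dist x (pos (Suc k) \<phi> x) \<le> dist x (pos k \<phi> x) + dist (pos k \<phi> x) (pos (Suc k) \<phi> x)"
    by (rule dist_triangle)
  also have "dist (pos k \<phi> x) (pos (Suc k) \<phi> x) \<le> 1"
    using norm_Y[OF translate_counting[OF iter_counting[OF assms]]] by (simp add: dist_norm)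
  finally show ?case using Suc by simp
qed simp

lemma Y_translate_local:
  assumes \<phi>: "\<phi> \<in> counting_measures" "\<psi> \<in> counting_measures" and "agree (cball x 1) \<phi> \<psi>"
  shows "Y (translate \<phi> x) = Y (translate \<psi> x)"
proof -
  have "restr (translate \<phi> x) (cball 0 1) = restr (translate \<psi> x) (cball 0 1)"
    by (rule restr_cong)
       (use assms in \<open>auto simp: translate_counting translate_singleton agree_def dist_norm\<close>)
  then show ?thesis
    using Y_local translate_counting \<phi> by metis
qed

text \<open>A point arriving in the ball of radius \<open>R\<close> started in radius
  \<open>R + 1\<close>, and its displacement reads the configuration up to distance 1 from the
  start.\<close>

lemma displace_local:
  assumes \<phi>: "\<phi> \<in> counting_measures" "\<psi> \<in> counting_measures" and ag: "agree (cball z (R + 2)) \<phi> \<psi>"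
  shows "agree (cball z R) (displace Y \<phi>) (displace Y \<psi>)"
  unfolding agree_def
proof
  fix y assume y: "y \<in> cball z R"
  have "emeasure \<phi> {x} * indicator {y} (x + Y (translate \<phi> x))
      = emeasure \<psi> {x} * indicator {y} (x + Y (translate \<psi> x))" for x
  proof (cases "x \<in> cball z (R + 1)")
    case True
    have "cball x 1 \<subseteq> cball z (R + 2)"
      using True dist_triangle[of z _ x] by (auto simp: dist_commute) (smt (verit))
    then have "agree (cball x 1) \<phi> \<psi>" using ag by (rule agree_mono[rotated])
    moreover have "emeasure \<phi> {x} = emeasure \<psi> {x}"
      using ag True by (auto simp: agree_def)
    ultimately show ?thesis using Y_translate_local[OF \<phi>] by simp
  next
    case False
    have "x + Y (translate \<eta> x) \<noteq> y" if "\<eta> \<in> counting_measures" for \<eta>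
    proof
      assume "x + Y (translate \<eta> x) = y"
      then have "dist x y \<le> 1" using norm_Y[OF translate_counting[OF that], of x]
        by (auto simp: dist_norm)
      then show False using y False dist_triangle[of z x y] by (auto simp: dist_commute)
    qed
    then show ?thesis using \<phi> by simp
  qed
  then show "emeasure (displace Y \<phi>) {y} = emeasure (displace Y \<psi>) {y}"
    by (simp add: emeasure_displace)
qed

lemma iter_local:
  assumes \<phi>: "\<phi> \<in> counting_measures" "\<psi> \<in> counting_measures"
  shows "agree (cball z (R + 2 * real k)) \<phi> \<psi> \<Longrightarrow> agree (cball z R) (iter k \<phi>) (iter k \<psi>)"
proof (induction k arbitrary: R)
  case (Suc k)
  have "agree (cball z (R + 2)) (iter k \<phi>) (iter k \<psi>)"
    by (rule Suc.IH) (use Suc.prems in \<open>simp add: algebra_simps\<close>)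
  then show ?case
    using displace_local[OF iter_counting[OF \<phi>(1)] iter_counting[OF \<phi>(2)]] by simp
qed simp

text \<open>Step k + 1 reads \<open>iter k \<phi>\<close> within distance 1 of the current position,
  hence \<phi> within \<open>1 + 2 * real k\<close> of it by \<open>iter_local\<close>, and that
  position is at most \<open>k\<close> away from \<open>x\<close>.\<close>

lemma pos_local:
  assumes \<phi>: "\<phi> \<in> counting_measures" "\<psi> \<in> counting_measures"
  shows "agree (cball x (3 * real k + 1)) \<phi> \<psi> \<Longrightarrow> pos k \<phi> x = pos k \<psi> x"
proof (induction k)
  case (Suc k)
  have eq: "pos k \<phi> x = pos k \<psi> x"
    by (rule Suc.IH) (rule agree_mono[OF Suc.prems], simp add: subset_cball)
  let ?p = "pos k \<phi> x"
  have "cball ?p (1 + 2 * real k) \<subseteq> cball x (3 * real (Suc k) + 1)"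
  proof
    fix y assume "y \<in> cball ?p (1 + 2 * real k)"
    then show "y \<in> cball x (3 * real (Suc k) + 1)"
      using dist_triangle[of x y ?p] dist_pos[OF \<phi>(1), of x k] by simp
  qed
  then have "agree (cball ?p 1) (iter k \<phi>) (iter k \<psi>)"
    by (intro iter_local[OF \<phi>] agree_mono[OF Suc.prems])
  then show ?case
    using Y_translate_local[OF iter_counting[OF \<phi>(1)] iter_counting[OF \<phi>(2)], of ?p k k] eq by simp
qed simp

end

section \<open>Campbell's formula\<close>

definition inj_tuples :: "nat \<Rightarrow> 'a set \<Rightarrow> (nat \<Rightarrow> 'a) set" where
  "inj_tuples n S = {x \<in> {..<n} \<rightarrow>\<^sub>E S. inj_on x {..<n}}"

lemma inj_tuples_0 [simp]: "inj_tuples 0 S = {\<lambda>_. undefined}"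
  by (auto simp: inj_tuples_def)

lemma finite_inj_tuples [intro]: "finite S \<Longrightarrow> finite (inj_tuples n S)"
  unfolding inj_tuples_def by (rule finite_subset[of _ "{..<n} \<rightarrow>\<^sub>E S"]) (auto intro: finite_PiE)

lemma bij_betw_inj_tuples_Suc:
  "bij_betw (\<lambda>(x, y). x(n := y)) (SIGMA x:inj_tuples n S. S - x ` {..<n}) (inj_tuples (Suc n) S)"
proof (rule bij_betw_byWitness[where f' = "\<lambda>z. (restrict z {..<n}, z n)"])
  show "\<forall>a\<in>SIGMA x:inj_tuples n S. S - x ` {..<n}.
      (restrict (case a of (x, y) \<Rightarrow> x(n := y)) {..<n}, (case a of (x, y) \<Rightarrow> x(n := y)) n) = a"
    by (auto simp: inj_tuples_def fun_eq_iff PiE_def extensional_def restrict_def)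
  show "\<forall>z\<in>inj_tuples (Suc n) S. (case (restrict z {..<n}, z n) of (x, y) \<Rightarrow> x(n := y)) = z"
    by (auto simp: inj_tuples_def fun_eq_iff PiE_def extensional_def restrict_def)
  show "(\<lambda>(x, y). x(n := y)) ` (SIGMA x:inj_tuples n S. S - x ` {..<n}) \<subseteq> inj_tuples (Suc n) S"
    by (auto simp: inj_tuples_def lessThan_Suc inj_on_def PiE_def extensional_def Pi_def)
  show "(\<lambda>z. (restrict z {..<n}, z n)) ` inj_tuples (Suc n) S \<subseteq> (SIGMA x:inj_tuples n S. S - x ` {..<n})"
    by (auto simp: inj_tuples_def lessThan_Suc inj_on_def PiE_def extensional_def Pi_def)
qed

text \<open>The last entry is split off. Its distinctness from the others is moved into the
  integrand, so that the inner sum runs over all of \<open>S\<close> and can be read as an integral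
  against the configuration.\<close>

lemma nn_integral_inj_tuples_Suc:
  "(\<integral>\<^sup>+x. f x \<partial>count_space (inj_tuples (Suc n) S))
    = (\<integral>\<^sup>+x. (\<integral>\<^sup>+y. (if \<forall>i\<in>{..<n}. x i \<noteq> y then f (x(n := y)) else 0) \<partial>count_space S)
        \<partial>count_space (inj_tuples n S))"
proof -
  have "(\<integral>\<^sup>+x. f x \<partial>count_space (inj_tuples (Suc n) S))
      = (\<integral>\<^sup>+z. f (case z of (x, y) \<Rightarrow> x(n := y)) \<partial>count_space (SIGMA x:inj_tuples n S. S - x ` {..<n}))"
    by (rule nn_integral_bij_count_space[OF bij_betw_inj_tuples_Suc, symmetric])
  also have "\<dots> = (\<integral>\<^sup>+z. f (case z of (x, y) \<Rightarrow> x(n := y))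
      * indicator (SIGMA x:inj_tuples n S. S - x ` {..<n}) z \<partial>count_space UNIV)"
    by (rule nn_integral_count_space_indicator) simp
  also have "\<dots> = (\<integral>\<^sup>+x. (\<integral>\<^sup>+y. f (x(n := y))
      * indicator (SIGMA x:inj_tuples n S. S - x ` {..<n}) (x, y) \<partial>count_space UNIV) \<partial>count_space UNIV)"
    by (subst nn_integral_fst_count_space[symmetric]) simp
  also have "\<dots> = (\<integral>\<^sup>+x. (\<integral>\<^sup>+y. (if \<forall>i\<in>{..<n}. x i \<noteq> y then f (x(n := y)) else 0)
      * indicator S y \<partial>count_space UNIV) * indicator (inj_tuples n S) x \<partial>count_space UNIV)"
    by (intro nn_integral_cong) (auto simp: indicator_def intro!: nn_integral_cong)
  also have "\<dots> = (\<integral>\<^sup>+x. (\<integral>\<^sup>+y. (if \<forall>i\<in>{..<n}. x i \<noteq> y then f (x(n := y)) else 0) \<partial>count_space S)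
        \<partial>count_space (inj_tuples n S))"
    by (simp add: nn_integral_count_space_indicator)
  finally show ?thesis .
qed

lemma simple_points:
  assumes "\<phi> \<in> counting_measures" "simple_config \<phi>"
  shows "emeasure \<phi> {x} = indicator (points \<phi>) x"
  using points_ge_1[OF assms(1), of x] assms(2)
  by (cases "x \<in> points \<phi>") (auto simp: simple_config_def points_def intro: antisym)

lemma nn_integral_simple:
  assumes \<phi>: "\<phi> \<in> counting_measures" "simple_config \<phi>" and f: "f \<in> borel_measurable borel"
  shows "(\<integral>\<^sup>+x. f x \<partial>\<phi>) = (\<integral>\<^sup>+x. f x \<partial>count_space (points \<phi>))"
  unfolding nn_integral_counting[OF \<phi>(1) f] simple_points[OF \<phi>]
  by (simp add: nn_integral_count_space_indicator mult.commute)

text \<open>Induction on the length: for a simple configuration the sum over the last entry is an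
  integral against \<open>L a\<close>, jointly measurable in \<open>a\<close> and the remaining
  entries. The induction therefore needs integrands that depend on \<open>a\<close>.\<close>

lemma measurable_nn_integral_inj_tuples:
  fixes L :: "'b \<Rightarrow> 'a::euclidean_space measure"
  assumes L [measurable]: "L \<in> measurable N counting_space"
    and simp: "\<And>a. a \<in> space N \<Longrightarrow> simple_config (L a)"
  shows "(\<lambda>(a, x). f a x) \<in> borel_measurable (N \<Otimes>\<^sub>M PiM {..<n} (\<lambda>_. lborel)) \<Longrightarrow>
    (\<lambda>a. \<integral>\<^sup>+x. f a x \<partial>count_space (inj_tuples n (points (L a)))) \<in> borel_measurable N"
proof (induction n arbitrary: f)
  case 0
  have "(\<lambda>a. (a, \<lambda>_. undefined)) \<in> measurable N (N \<Otimes>\<^sub>M PiM {..<0::nat} (\<lambda>_. lborel :: 'a measure))"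
    by (intro measurable_Pair measurable_const) (auto simp: space_PiM)
  from measurable_compose[OF this 0] show ?case
    by (simp add: nn_integral_count_space_finite)
next
  case (Suc n)
  note Lc = measurable_counting_space_in[OF L]
  let ?P = "N \<Otimes>\<^sub>M PiM {..<n} (\<lambda>_. lborel :: 'a measure)"
  define h where "h a x y = (if \<forall>i\<in>{..<n}. x i \<noteq> y then f a (x(n := y)) else 0)" for a x and y :: 'a
  have upd: "(\<lambda>p. (snd (fst p))(n := snd p)) \<in> measurable (?P \<Otimes>\<^sub>M borel) (PiM {..<Suc n} (\<lambda>_. lborel))"
    unfolding lessThan_Suc
    by (rule measurable_fun_upd[where J="{..<n}"]) auto
  have f': "(\<lambda>p. f (fst (fst p)) ((snd (fst p))(n := snd p))) \<in> borel_measurable (?P \<Otimes>\<^sub>M borel)"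
    using measurable_compose[OF measurable_Pair[OF _ upd] Suc.prems, of "\<lambda>p. fst (fst p)"] by simp
  have h: "(\<lambda>p. h (fst (fst p)) (snd (fst p)) (snd p)) \<in> borel_measurable (?P \<Otimes>\<^sub>M borel)"
  proof -
    have [measurable]: "Measurable.pred (?P \<Otimes>\<^sub>M borel) (\<lambda>p. snd (fst p) i \<noteq> snd p)" if "i \<in> {..<n}" for i
    proof -
      have "(\<lambda>p. snd (fst p) i) \<in> measurable (?P \<Otimes>\<^sub>M borel) lborel"
        by (rule measurable_compose[OF _ measurable_component_singleton[OF that]]) simp
      then have [measurable]: "(\<lambda>p. snd (fst p) i) \<in> borel_measurable (?P \<Otimes>\<^sub>M borel)"
        by simp
      show ?thesis by measurable
    qed
    have "Measurable.pred (?P \<Otimes>\<^sub>M borel) (\<lambda>p. \<forall>i\<in>{..<n}. snd (fst p) i \<noteq> snd p)"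
      by (intro pred_intros_finite) auto
    then show ?thesis unfolding h_def using f' by (intro measurable_If) auto
  qed
  have "(\<lambda>q. \<integral>\<^sup>+y. h (fst q) (snd q) y \<partial>L (fst q)) \<in> borel_measurable ?P"
    by (rule measurable_nn_integral_counting) (use h in \<open>simp_all add: case_prod_beta\<close>)
  then have "(\<lambda>a. \<integral>\<^sup>+x. (\<integral>\<^sup>+y. h a x y \<partial>L a) \<partial>count_space (inj_tuples n (points (L a)))) \<in> borel_measurable N"
    by (intro Suc.IH) (simp add: case_prod_beta)
  also have "?this \<longleftrightarrow> ?case"
  proof (rule measurable_cong)
    fix a assume a: "a \<in> space N"
    have "(\<integral>\<^sup>+y. h a x y \<partial>L a) = (\<integral>\<^sup>+y. h a x y \<partial>count_space (points (L a)))"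
      if x: "x \<in> inj_tuples n (points (L a))" for x
    proof (rule nn_integral_simple[OF Lc[OF a] simp[OF a]])
      have "(\<lambda>y. ((a, x), y)) \<in> measurable borel (?P \<Otimes>\<^sub>M borel)"
        using a x by (intro measurable_Pair measurable_const)
          (auto simp: space_pair_measure space_PiM inj_tuples_def)
      from measurable_compose[OF this h] show "h a x \<in> borel_measurable borel" by simp
    qed
    then show "(\<integral>\<^sup>+x. (\<integral>\<^sup>+y. h a x y \<partial>L a) \<partial>count_space (inj_tuples n (points (L a))))
        = (\<integral>\<^sup>+x. f a x \<partial>count_space (inj_tuples (Suc n) (points (L a))))"
      unfolding nn_integral_inj_tuples_Suc h_def by (intro nn_integral_cong) simp
  qed
  finally show ?case .
qed

text \<open>Simplicity is required at every sample point, so that identities between configurations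
  hold pointwise; \<open>proposition7p1\<close> reaches this situation by changing the process on a
  null set.\<close>

locale simple_process = prob_space M for M :: "'w measure" +
  fixes \<Phi> :: "'w \<Rightarrow> 'a::euclidean_space measure"
  assumes measurable_process [measurable]: "\<Phi> \<in> measurable M counting_space"
    and simple: "\<And>\<omega>. \<omega> \<in> space M \<Longrightarrow> simple_config (\<Phi> \<omega>)"
begin

lemma counting: "\<omega> \<in> space M \<Longrightarrow> \<Phi> \<omega> \<in> counting_measures"
  by (rule measurable_counting_space_in[OF measurable_process])

abbreviation lebesgue_tuples :: "nat \<Rightarrow> (nat \<Rightarrow> 'a) measure" where
  "lebesgue_tuples n \<equiv> PiM {..<n} (\<lambda>_. lborel)"

lemma measurable_tuple_sum:
  assumes f: "f \<in> borel_measurable (lebesgue_tuples n)"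
  shows "(\<lambda>\<omega>. \<integral>\<^sup>+x. f x \<partial>count_space (inj_tuples n (points (\<Phi> \<omega>)))) \<in> borel_measurable M"
  by (rule measurable_nn_integral_inj_tuples[OF measurable_process simple])
     (use f in \<open>simp_all add: case_prod_beta\<close>)

lemma factorial_moment_eq:
  "factorial_moment M \<Phi> n B
    = (\<integral>\<^sup>+\<omega>. (\<integral>\<^sup>+x. indicator B x \<partial>count_space (inj_tuples n (points (\<Phi> \<omega>)))) \<partial>M)"
  unfolding factorial_moment_def
proof (rule nn_integral_cong)
  fix \<omega>
  let ?T = "inj_tuples n (points (\<Phi> \<omega>))"
  have "(\<integral>\<^sup>+x. indicator B x \<partial>count_space ?T) = (\<integral>\<^sup>+x. indicator (?T \<inter> B) x \<partial>count_space UNIV)"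
    by (simp add: nn_integral_count_space_indicator indicator_inter_arith mult.commute)
  also have "\<dots> = emeasure (count_space UNIV) (?T \<inter> B)" by (rule nn_integral_indicator) simp
  also have "?T \<inter> B = {x \<in> {..<n} \<rightarrow>\<^sub>E points (\<Phi> \<omega>). inj_on x {..<n} \<and> x \<in> B}"
    by (auto simp: inj_tuples_def)
  finally show "emeasure (count_space UNIV) \<dots> = (\<integral>\<^sup>+x. indicator B x \<partial>count_space ?T)" ..
qed

text \<open>For indicators this is the definition of a correlation function; linearity and monotone
  convergence extend it to all nonnegative measurable \<open>f\<close>.\<close>

theorem campbell:
  assumes \<rho>: "correlation_function M \<Phi> n \<rho>" and f: "f \<in> borel_measurable (lebesgue_tuples n)"
  shows "(\<integral>\<^sup>+\<omega>. (\<integral>\<^sup>+x. f x \<partial>count_space (inj_tuples n (points (\<Phi> \<omega>)))) \<partial>M)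
    = (\<integral>\<^sup>+x. ennreal (\<rho> x) * f x \<partial>lebesgue_tuples n)"
  using f
proof (induction rule: borel_measurable_induct)
  have sp: "inj_tuples n S \<subseteq> space (lebesgue_tuples n)" for S
    by (auto simp: inj_tuples_def space_PiM)
  have [measurable]: "\<rho> \<in> borel_measurable (lebesgue_tuples n)"
    using \<rho> by (simp add: correlation_function_def)
  {
    case (cong f g)
    have "(\<integral>\<^sup>+x. f x \<partial>count_space (inj_tuples n S)) = (\<integral>\<^sup>+x. g x \<partial>count_space (inj_tuples n S))" for S
      using cong(3) sp by (intro nn_integral_cong) auto
    moreover have "(\<integral>\<^sup>+x. ennreal (\<rho> x) * f x \<partial>lebesgue_tuples n)
        = (\<integral>\<^sup>+x. ennreal (\<rho> x) * g x \<partial>lebesgue_tuples n)"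
      using cong(3) by (intro nn_integral_cong) simp
    ultimately show ?case using cong(4) by simp
  next
    case (set A)
    then show ?case
      using \<rho> factorial_moment_eq[of n A] by (simp add: correlation_function_def)
  next
    case (mult u c)
    note [measurable] = mult(2)
    show ?case
      using mult(4) by (simp add: nn_integral_cmult measurable_tuple_sum mult.left_commute)
  next
    case (add u v)
    note [measurable] = add(1,3)
    show ?case
      using add by (simp add: nn_integral_add measurable_tuple_sum distrib_left)
  next
    case (seq U)
    note [measurable] = seq(1)
    have inc: "incseq (\<lambda>i. U i x)" for x using seq(3) by (auto simp: incseq_def le_fun_def)
    have "(\<integral>\<^sup>+\<omega>. (\<integral>\<^sup>+x. (SUP i. U i x) \<partial>count_space (inj_tuples n (points (\<Phi> \<omega>)))) \<partial>M)
        = (\<integral>\<^sup>+\<omega>. (SUP i. \<integral>\<^sup>+x. U i x \<partial>count_space (inj_tuples n (points (\<Phi> \<omega>)))) \<partial>M)"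
      using seq(3) by (intro nn_integral_cong nn_integral_monotone_convergence_SUP) auto
    also have "\<dots> = (SUP i. \<integral>\<^sup>+\<omega>. (\<integral>\<^sup>+x. U i x \<partial>count_space (inj_tuples n (points (\<Phi> \<omega>)))) \<partial>M)"
      using seq(3) by (intro nn_integral_monotone_convergence_SUP measurable_tuple_sum seq(1))
        (auto simp: incseq_def le_fun_def intro!: nn_integral_mono)
    also have "\<dots> = (SUP i. \<integral>\<^sup>+x. ennreal (\<rho> x) * U i x \<partial>lebesgue_tuples n)"
      using seq.IH by simp
    also have "\<dots> = (\<integral>\<^sup>+x. (SUP i. ennreal (\<rho> x) * U i x) \<partial>lebesgue_tuples n)"
      using seq(3) by (intro nn_integral_monotone_convergence_SUP[symmetric])
        (auto simp: incseq_def le_fun_def intro!: mult_left_mono)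
    finally show ?case
      by (simp add: SUP_mult_left_ennreal image_comp)
  }
qed

end

section \<open>Exponential moments\<close>

lemma card_inj_tuples:
  assumes "finite S"
  shows "card (inj_tuples n S) = fact n * (card S choose n)"
proof (induction n)
  case (Suc n)
  have "card (inj_tuples (Suc n) S) = card (SIGMA x:inj_tuples n S. S - x ` {..<n})"
    using bij_betw_same_card[OF bij_betw_inj_tuples_Suc] by metis
  also have "\<dots> = (\<Sum>x\<in>inj_tuples n S. card (S - x ` {..<n}))"
    using assms by (intro card_SigmaI) auto
  also have "\<dots> = (\<Sum>x\<in>inj_tuples n S. card S - n)"
  proof (rule sum.cong)
    fix x assume "x \<in> inj_tuples n S"
    then have "x ` {..<n} \<subseteq> S" "card (x ` {..<n}) = n"
      by (auto simp: inj_tuples_def card_image)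
    then show "card (S - x ` {..<n}) = card S - n"
      using assms by (simp add: card_Diff_subset finite_subset)
  qed simp
  also have "\<dots> = fact n * ((card S choose n) * (card S - n))" by (simp add: Suc)
  also have "(card S choose n) * (card S - n) = Suc n * (card S choose Suc n)"
    using binomial_absorb_comp[of "card S" n] binomial_absorption[of n "card S"]
    by (simp only: mult.commute)
  finally show ?case by (simp add: algebra_simps)
qed simp

text \<open>Every subset with \<open>n\<close> elements is the image of exactly n! injective
  tuples.\<close>

lemma sum_inj_tuples_image:
  fixes h :: "'a set \<Rightarrow> real"
  assumes S: "finite S"
  shows "(\<Sum>x\<in>inj_tuples n S. h (x ` {..<n})) = fact n * (\<Sum>T | T \<subseteq> S \<and> card T = n. h T)"
proof -
  let ?A = "{T. T \<subseteq> S \<and> card T = n}"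
  have finA: "finite ?A" using S by simp
  have "(\<Sum>x\<in>inj_tuples n S. h (x ` {..<n}))
      = (\<Sum>T\<in>?A. \<Sum>x | x \<in> inj_tuples n S \<and> x ` {..<n} = T. h (x ` {..<n}))"
  proof (rule sum.group[symmetric])
    show "(\<lambda>x. x ` {..<n}) ` inj_tuples n S \<subseteq> ?A"
      by (fastforce simp: inj_tuples_def card_image)
  qed (use S finA in auto)
  also have "\<dots> = (\<Sum>T\<in>?A. fact n * h T)"
  proof (rule sum.cong)
    fix T assume T: "T \<in> ?A"
    then have finT: "finite T" using S finite_subset by auto
    have "{x. x \<in> inj_tuples n S \<and> x ` {..<n} = T} = inj_tuples n T"
    proof (intro equalityI subsetI)
      fix x assume x: "x \<in> inj_tuples n T"
      then have "x ` {..<n} \<subseteq> T" "card (x ` {..<n}) = n" by (auto simp: inj_tuples_def card_image)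
      then have "x ` {..<n} = T" using T finT by (intro card_subset_eq) auto
      then show "x \<in> {x. x \<in> inj_tuples n S \<and> x ` {..<n} = T}"
        using x T by (auto simp: inj_tuples_def)
    qed (auto simp: inj_tuples_def)
    then have card: "card {x. x \<in> inj_tuples n S \<and> x ` {..<n} = T} = fact n"
      using T card_inj_tuples[OF finT, of n] by simp
    have "(\<Sum>x | x \<in> inj_tuples n S \<and> x ` {..<n} = T. h (x ` {..<n}))
        = (\<Sum>x | x \<in> inj_tuples n S \<and> x ` {..<n} = T. h T)"
      by (rule sum.cong) auto
    then show "(\<Sum>x | x \<in> inj_tuples n S \<and> x ` {..<n} = T. h (x ` {..<n})) = fact n * h T"
      using card by simp
  qed simp
  finally show ?thesis by (simp add: sum_distrib_left)
qed

text \<open>Tuples longer than the number of points do not exist, so the upper limit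
  \<open>m\<close> is free. This lets expansions be truncated at a level independent of the
  configuration.\<close>

lemma sum_Pow_eq_sum_inj_tuples:
  fixes h :: "'a set \<Rightarrow> real"
  assumes S: "finite S" and m: "card S \<le> m"
  shows "(\<Sum>T\<in>Pow S. h T) = (\<Sum>n\<le>m. (\<Sum>x\<in>inj_tuples n S. h (x ` {..<n})) / fact n)"
proof -
  have "(\<Sum>T\<in>Pow S. h T) = (\<Sum>n\<le>m. \<Sum>T | T \<in> Pow S \<and> card T = n. h T)"
    by (rule sum.group[symmetric]) (use S m in \<open>auto intro: order_trans[OF card_mono]\<close>)
  then show ?thesis by (simp add: sum_inj_tuples_image[OF S])
qed

text \<open>Binomial theorem, with n! times the binomial coefficient read as a number of tuples. It
  turns exponential moments of a number of points into factorial moments.\<close>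

lemma sum_card_inj_tuples:
  assumes S: "finite S" and m: "card S \<le> m"
  shows "(1 + K) ^ card S = (\<Sum>n\<le>m. K ^ n / fact n * real (card (inj_tuples n S)))"
proof -
  have "(1 + K) ^ card S = (\<Sum>n\<le>card S. real (card S choose n) * K ^ n)"
    by (subst add.commute) (simp add: binomial_ring)
  also have "\<dots> = (\<Sum>n\<le>m. real (card S choose n) * K ^ n)"
    using m by (intro sum.mono_neutral_left) (auto simp: binomial_eq_0)
  finally show ?thesis by (simp add: card_inj_tuples[OF S] mult.commute)
qed

section \<open>Growth of the constants and size of the decay function\<close>

lemma fact_add_le: "fact (p + q) \<le> (fact p * fact q * 2 ^ (p + q) :: real)"
proof -
  have "(fact (p + q) :: real) = fact p * fact q * real (p + q choose p)"
    using binomial_fact_lemma[of p "p + q"] by (metis add_diff_cancel_left' le_add1 of_nat_fact of_nat_mult)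
  also have "\<dots> \<le> fact p * fact q * 2 ^ (p + q)"
    using binomial_le_pow2[of "p + q" p] by (intro mult_left_mono) (auto simp flip: of_nat_le_iff)
  finally show ?thesis .
qed

text \<open>A single term of the exponential series at \<open>n\<close>, in place of Stirling's
  formula.\<close>

lemma power_self_le_fact: "real n ^ n \<le> exp (real n) * fact n"
proof -
  have "real n ^ n /\<^sub>R fact n \<le> (\<Sum>k. real n ^ k /\<^sub>R fact k)"
    using sum_le_suminf[of "\<lambda>k. real n ^ k /\<^sub>R fact k" "{n}"] summable_exp_generic[of "real n"] by simp
  then show ?thesis by (simp add: exp_def field_simps)
qed

text \<open>By \<open>power_self_le_fact\<close> the left side is for large n at most
  \<open>c * fact n\<close> times the n-th power of
  \<open>real n powr (a - 1) * (K * exp 1)\<close>, a base that tends to 0 because a < 1.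
  \<open>A\<close> absorbs the finitely many remaining n.\<close>

lemma growth_fact_bound:
  fixes C :: "nat \<Rightarrow> real"
  assumes C: "C \<in> O(\<lambda>k. real k powr (a * real k))" and a: "a < 1" and K: "K > 0"
  shows "\<exists>A\<ge>0. \<forall>n. \<bar>C n\<bar> * K ^ n \<le> A * fact n"
proof -
  obtain c where c: "c > 0" "\<forall>\<^sub>F n in sequentially. \<bar>C n\<bar> \<le> c * \<bar>real n powr (a * real n)\<bar>"
    using landau_o.bigE[OF C] by auto
  have "((\<lambda>n. real n powr (a - 1) * (K * exp 1)) \<longlongrightarrow> 0) sequentially"
    using a by real_asymp
  then have "\<forall>\<^sub>F n in sequentially. real n powr (a - 1) * (K * exp 1) < 1"
    by (rule order_tendstoD) simp
  with c(2) eventually_gt_at_top[of 0]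
  have ev: "\<forall>\<^sub>F n in sequentially. \<bar>C n\<bar> * K ^ n / fact n \<le> c"
  proof eventually_elim
    case (elim n)
    have "real n powr (a * real n) * K ^ n = (real n powr (a - 1) * K) ^ n * real n ^ n"
    proof -
      have "real n powr (a * real n) = (real n powr a) ^ n"
        using elim(2) by (simp add: powr_powr[symmetric] powr_realpow)
      also have "real n powr a = real n powr (a - 1) * real n"
        using elim(2) by (simp add: powr_diff)
      finally show ?thesis by (simp add: power_mult_distrib)
    qed
    also have "\<dots> \<le> (real n powr (a - 1) * K) ^ n * (exp (real n) * fact n)"
      using K by (intro mult_left_mono power_self_le_fact) auto
    also have "\<dots> = (real n powr (a - 1) * (K * exp 1)) ^ n * fact n"
      by (simp add: power_mult_distrib exp_of_nat_mult[symmetric])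
    also have "\<dots> \<le> 1 * fact n"
      using elim(3) K by (intro mult_right_mono power_le_one) auto
    finally have *: "real n powr (a * real n) * K ^ n \<le> fact n" by simp
    have "\<bar>C n\<bar> * K ^ n \<le> c * (real n powr (a * real n) * K ^ n)"
      using elim(1) K by (simp add: mult_right_mono mult.assoc[symmetric])
    also have "\<dots> \<le> c * fact n" using * c by (intro mult_left_mono) auto
    finally show ?case by (simp add: field_simps)
  qed
  then obtain n0 where n0: "\<And>n. n \<ge> n0 \<Longrightarrow> \<bar>C n\<bar> * K ^ n / fact n \<le> c"
    by (auto simp: eventually_sequentially)
  define A where "A = c + (\<Sum>n<n0. \<bar>C n\<bar> * K ^ n / fact n)"
  have "\<bar>C n\<bar> * K ^ n / fact n \<le> A" for n
  proof (cases "n < n0")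
    case True
    then have "\<bar>C n\<bar> * K ^ n / fact n \<le> (\<Sum>n<n0. \<bar>C n\<bar> * K ^ n / fact n)"
      using K by (intro member_le_sum) auto
    then show ?thesis using c by (simp add: A_def)
  next
    case False
    moreover have "0 \<le> (\<Sum>n<n0. \<bar>C n\<bar> * K ^ n / fact n)" using K by (intro sum_nonneg) auto
    ultimately show ?thesis using n0[of n] by (simp add: A_def)
  qed
  moreover have "A \<ge> 0" unfolding A_def using K c by (intro add_nonneg_nonneg sum_nonneg) auto
  ultimately show ?thesis by (intro exI[of _ A]) (simp add: field_simps)
qed

text \<open>\<open>growth_fact_bound\<close> is applied with \<open>4 * K\<close>: one factor 2 pays
  for \<open>fact_add_le\<close>, the other leaves a geometric weight for the later double sum over
  p and q.\<close>

lemma growth_pair_bound: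
  fixes C :: "nat \<Rightarrow> real"
  assumes C: "C \<in> O(\<lambda>k. real k powr (a * real k))" and a: "a < 1" and K: "K > 0"
  shows "\<exists>A\<ge>0. \<forall>p q. \<bar>C (p + q)\<bar> * K ^ (p + q) \<le> A * fact p * fact q / 2 ^ (p + q)"
proof -
  obtain A where A: "A \<ge> 0" "\<And>n. \<bar>C n\<bar> * (4 * K) ^ n \<le> A * fact n"
    using growth_fact_bound[OF C a, of "4 * K"] K by auto
  have "\<bar>C (p + q)\<bar> * K ^ (p + q) \<le> A * fact p * fact q / 2 ^ (p + q)" for p q
  proof -
    have "\<bar>C (p + q)\<bar> * K ^ (p + q) * 4 ^ (p + q) \<le> A * fact (p + q)"
      using A(2)[of "p + q"] by (simp add: power_mult_distrib mult_ac)
    also have "\<dots> \<le> A * (fact p * fact q * 2 ^ (p + q))"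
      using A by (intro mult_left_mono fact_add_le)
    finally have "\<bar>C (p + q)\<bar> * K ^ (p + q) * 4 ^ (p + q) \<le> A * (fact p * fact q * 2 ^ (p + q))" .
    moreover have "(4::real) ^ (p + q) = 2 ^ (p + q) * 2 ^ (p + q)"
      by (simp only: power_mult_distrib[symmetric]) simp
    ultimately have "(\<bar>C (p + q)\<bar> * K ^ (p + q) * 2 ^ (p + q)) * 2 ^ (p + q) \<le> (A * fact p * fact q) * 2 ^ (p + q)"
      by (simp only: mult.assoc)
    then have "\<bar>C (p + q)\<bar> * K ^ (p + q) * 2 ^ (p + q) \<le> A * fact p * fact q"
      by (rule mult_right_le_imp_le) simp
    then show ?thesis by (simp add: pos_le_divide_eq)
  qed
  then show ?thesis using A(1) by blast
qed

text \<open>A negative limsup gives \<open>\<delta> s < exp (- c * s powr b)\<close> for large s,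
  which is below every inverse power. Values 0 are treated apart, since there \<open>elog\<close> is
  minus infinity.\<close>

lemma decay_function_power_bound:
  assumes "decay_function \<delta>"
  shows "\<exists>s0\<ge>0. \<forall>s\<ge>s0. \<delta> s \<le> 1 / (1 + s) ^ m"
proof -
  obtain b where b: "b > 0" "Limsup at_top (\<lambda>s. ereal (s powr (- b)) * elog (\<delta> s)) < 0"
    and nn: "\<And>s. s \<ge> 0 \<Longrightarrow> \<delta> s \<ge> 0"
    using assms by (auto simp: decay_function_def)
  obtain c' where c': "Limsup at_top (\<lambda>s. ereal (s powr (- b)) * elog (\<delta> s)) < ereal c'" "c' < 0"
    using ereal_dense2[OF b(2)] by (auto simp: zero_ereal_def)
  define c where "c = - c'"
  have c: "c > 0" using c' by (simp add: c_def)
  have "\<forall>\<^sub>F s in at_top. ereal (s powr (- b)) * elog (\<delta> s) < ereal c'"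
    using Limsup_lessD[OF c'(1)] .
  moreover have "\<forall>\<^sub>F s in at_top. exp (- c * s powr b) \<le> 1 / (1 + s) ^ m"
    using b c by real_asymp
  ultimately have "\<forall>\<^sub>F s in at_top. \<delta> s \<le> 1 / (1 + s) ^ m"
    using eventually_gt_at_top[of 0]
  proof eventually_elim
    case (elim s)
    show ?case
    proof (cases "\<delta> s = 0")
      case False
      then have pos: "\<delta> s > 0" using nn[of s] elim by simp
      have "s powr (- b) * ln (\<delta> s) < c'" using elim(1) False by (simp add: elog_def)
      then have "ln (\<delta> s) < - c * s powr b"
        using mult_strict_right_mono[of "s powr (- b) * ln (\<delta> s)" c' "s powr b"] elim(3)
        by (simp add: c_def powr_minus mult_ac)
      then have "\<delta> s < exp (- c * s powr b)" using pos by (metis exp_less_mono exp_ln)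
      then show ?thesis using elim(2) by simp
    qed (use elim in simp)
  qed
  then obtain s0 where "\<forall>s\<ge>s0. \<delta> s \<le> 1 / (1 + s) ^ m" by (auto simp: eventually_at_top_linorder)
  then show ?thesis by (intro exI[of _ "max 0 s0"]) auto
qed

section \<open>Points of the process in a bounded window\<close>

lemma (in simple_process) emeasure_eq_card:
  assumes "\<omega> \<in> space M" "W \<in> sets borel" "bounded W"
  shows "emeasure (\<Phi> \<omega>) W = of_nat (card (points (\<Phi> \<omega>) \<inter> W))"
  using emeasure_counting_sum[OF counting[OF assms(1)] assms(2,3)]
  by (simp add: simple_points[OF counting[OF assms(1)] simple[OF assms(1)]])

lemma (in simple_process) measure_eq_card:
  assumes "\<omega> \<in> space M" "W \<in> sets borel" "bounded W"
  shows "measure (\<Phi> \<omega>) W = real (card (points (\<Phi> \<omega>) \<inter> W))"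
  using emeasure_eq_card[OF assms] by (simp add: measure_def)

lemma (in simple_process) finite_window:
  "\<omega> \<in> space M \<Longrightarrow> bounded W \<Longrightarrow> finite (points (\<Phi> \<omega>) \<inter> W)"
  by (rule finite_points[OF counting])

lemma (in simple_process) measurable_card_window:
  assumes "W \<in> sets borel" "bounded W"
  shows "(\<lambda>\<omega>. real (card (points (\<Phi> \<omega>) \<inter> W))) \<in> borel_measurable M"
proof -
  have "(\<lambda>\<omega>. enn2real (emeasure (\<Phi> \<omega>) W)) \<in> borel_measurable M" using assms by measurable
  then show ?thesis
    by (rule measurable_cong[THEN iffD1, rotated]) (simp add: emeasure_eq_card assms)
qed

text \<open>A function that vanishes off the box only sees tuples of points in the window, of which
  there are finitely many.\<close>

lemma nn_integral_inj_tuples_window: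
  fixes f :: "(nat \<Rightarrow> 'a) \<Rightarrow> ennreal"
  assumes "finite (S \<inter> W)" and f: "\<And>x. x \<notin> {..<n} \<rightarrow>\<^sub>E W \<Longrightarrow> f x = 0"
  shows "(\<integral>\<^sup>+x. f x \<partial>count_space (inj_tuples n S)) = (\<Sum>x\<in>inj_tuples n (S \<inter> W). f x)"
proof (rule nn_integral_count_space')
  show "finite (inj_tuples n (S \<inter> W))" using assms by auto
  show "f x = 0" if "x \<in> inj_tuples n S" "x \<notin> inj_tuples n (S \<inter> W)" for x
    by (rule f) (use that in \<open>auto simp: inj_tuples_def PiE_def Pi_def\<close>)
qed (auto simp: inj_tuples_def)

section \<open>Factorial moments of windows and stationarity\<close>

text \<open>\<open>rho_0\<close> extends the family to the empty tuple, so that expansions can start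
  at n = 0, while decay is stated for nonempty tuples. As \<open>C\<close> is real-valued, bounds
  derived from it carry absolute values.\<close>

locale correlated_process = simple_process M \<Phi>
  for M :: "'w measure" and \<Phi> :: "'w \<Rightarrow> 'a::euclidean_space measure" +
  fixes \<rho> :: "nat \<Rightarrow> (nat \<Rightarrow> 'a) \<Rightarrow> real" and \<delta> :: "real \<Rightarrow> real" and C :: "nat \<Rightarrow> real" and a :: real
  assumes stationary: "stationary M \<Phi>"
    and rho_0: "\<rho> 0 = (\<lambda>_. 1)"
    and correlation: "correlation_function M \<Phi> n (\<rho> n)"
    and decay: "p \<ge> 1 \<Longrightarrow> q \<ge> 1 \<Longrightarrow>
      \<bar>\<rho> (p + q) (restrict x {..<p + q}) - \<rho> p (restrict x {..<p}) * \<rho> q (\<lambda>i\<in>{..<q}. x (p + i))\<bar>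
        \<le> C (p + q) * \<delta> (setdist (x ` {..<p}) (x ` {p..<p + q}))"
    and decay_function: "decay_function \<delta>"
    and growth: "C \<in> O(\<lambda>k. real k powr (a * real k))"
    and a_less_1: "a < 1"
begin

lemma rho_measurable [measurable]: "\<rho> n \<in> borel_measurable (lebesgue_tuples n)"
  using correlation[of n] by (simp add: correlation_function_def)

lemma rho_nonneg: "x \<in> {..<n} \<rightarrow>\<^sub>E UNIV \<Longrightarrow> 0 \<le> \<rho> n x"
  using correlation[of n] by (auto simp: correlation_function_def space_PiM)

lemma rho_restrict_nonneg: "0 \<le> \<rho> n (restrict x {..<n})"
  by (rule rho_nonneg) auto

lemma delta_nonneg: "0 \<le> s \<Longrightarrow> 0 \<le> \<delta> s"
  using decay_function by (simp add: decay_function_def)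

lemma nn_integral_stationary:
  assumes G: "G \<in> borel_measurable counting_space"
  shows "(\<integral>\<^sup>+\<omega>. G (translate (\<Phi> \<omega>) w) \<partial>M) = (\<integral>\<^sup>+\<omega>. G (\<Phi> \<omega>) \<partial>M)"
proof -
  have "(\<integral>\<^sup>+\<omega>. G (translate (\<Phi> \<omega>) w) \<partial>M)
      = (\<integral>\<^sup>+\<phi>. G \<phi> \<partial>distr M counting_space (\<lambda>\<omega>. translate (\<Phi> \<omega>) w))"
    by (rule nn_integral_distr[symmetric]) (use G in measurable)
  also have "\<dots> = (\<integral>\<^sup>+\<phi>. G \<phi> \<partial>distr M counting_space \<Phi>)"
    using stationary by (simp add: stationary_def)
  also have "\<dots> = (\<integral>\<^sup>+\<omega>. G (\<Phi> \<omega>) \<partial>M)"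
    by (rule nn_integral_distr) (use G in measurable)
  finally show ?thesis .
qed

text \<open>The factorial moment of \<open>W\<close> computed from \<rho>. It takes values in
  \<open>ennreal\<close> because its finiteness is a result, obtained through
  \<open>fmoment_bound\<close>.\<close>

definition fmoment :: "nat \<Rightarrow> 'a set \<Rightarrow> ennreal" where
  "fmoment n W = (\<integral>\<^sup>+x. ennreal (\<rho> n x) * indicator ({..<n} \<rightarrow>\<^sub>E W) x \<partial>lebesgue_tuples n)"

lemma sets_box [measurable]: "W \<in> sets borel \<Longrightarrow> {..<n} \<rightarrow>\<^sub>E W \<in> sets (lebesgue_tuples n)"
  by (intro sets_PiM_I_finite) auto

lemma fmoment_eq:
  assumes W: "W \<in> sets borel" "bounded W"
  shows "fmoment n W = (\<integral>\<^sup>+\<omega>. of_nat (card (inj_tuples n (points (\<Phi> \<omega>) \<inter> W))) \<partial>M)"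
proof -
  have "fmoment n W = (\<integral>\<^sup>+\<omega>. (\<integral>\<^sup>+x. indicator ({..<n} \<rightarrow>\<^sub>E W) x
      \<partial>count_space (inj_tuples n (points (\<Phi> \<omega>)))) \<partial>M)"
    unfolding fmoment_def
    by (rule campbell[OF correlation, symmetric]) (use W in measurable)
  also have "\<dots> = (\<integral>\<^sup>+\<omega>. of_nat (card (inj_tuples n (points (\<Phi> \<omega>) \<inter> W))) \<partial>M)"
  proof (rule nn_integral_cong)
    fix \<omega> assume "\<omega> \<in> space M"
    from finite_window[OF this W(2)]
    have "(\<integral>\<^sup>+x. indicator ({..<n} \<rightarrow>\<^sub>E W) x \<partial>count_space (inj_tuples n (points (\<Phi> \<omega>))))
        = (\<Sum>x\<in>inj_tuples n (points (\<Phi> \<omega>) \<inter> W). indicator ({..<n} \<rightarrow>\<^sub>E W) x)"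
      by (rule nn_integral_inj_tuples_window) simp
    also have "\<dots> = (\<Sum>x\<in>inj_tuples n (points (\<Phi> \<omega>) \<inter> W). 1)"
      by (rule sum.cong) (auto simp: inj_tuples_def PiE_def Pi_def indicator_def)
    finally show "(\<integral>\<^sup>+x. indicator ({..<n} \<rightarrow>\<^sub>E W) x \<partial>count_space (inj_tuples n (points (\<Phi> \<omega>))))
        = of_nat (card (inj_tuples n (points (\<Phi> \<omega>) \<inter> W)))" by simp
  qed
  finally show ?thesis .
qed

lemma borel_shift: "(\<lambda>y. y + w) ` W \<in> sets borel" if "W \<in> sets borel" for w :: 'a
proof -
  have "(\<lambda>y. y + w) ` W = (\<lambda>y. y - w) -` W \<inter> space borel"
    by (auto simp: image_iff) (metis diff_add_cancel)
  also have "\<dots> \<in> sets borel" by (rule measurable_sets[OF _ that]) simp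
  finally show ?thesis .
qed

lemma bounded_shift: "bounded W \<Longrightarrow> bounded ((\<lambda>y. y + w) ` W)" for w :: 'a
  using bounded_translation[of W w] by (simp add: add.commute)

text \<open>The number of tuples is a function of the mass of \<open>W\<close> alone, so invariance
  of the law suffices. The chosen versions \<rho> may fail to be invariant at individual
  points.\<close>

lemma fmoment_shift:
  assumes W: "W \<in> sets borel" "bounded W"
  shows "fmoment n ((\<lambda>y. y + w) ` W) = fmoment n W"
proof -
  let ?W = "(\<lambda>y. y + w) ` W"
  \<comment> \<open>Rounding down turns the mass back into a natural number, which makes the tuple
    count a measurable function of the configuration.\<close>
  define G :: "'a measure \<Rightarrow> ennreal"
    where "G \<phi> = of_nat (fact n * (nat \<lfloor>enn2real (emeasure \<phi> W)\<rfloor> choose n))" for \<phi>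
  have "(\<lambda>\<phi>. nat \<lfloor>enn2real (emeasure \<phi> W)\<rfloor>) \<in> measurable (counting_space :: 'a measure measure) (count_space UNIV)"
    using measurable_emeasure_counting_space[OF W(1)] by measurable
  then have G: "G \<in> borel_measurable counting_space"
    unfolding G_def by (rule measurable_compose) simp
  have "fmoment n ?W = (\<integral>\<^sup>+\<omega>. G (translate (\<Phi> \<omega>) w) \<partial>M)"
    unfolding fmoment_eq[OF borel_shift[OF W(1)] bounded_shift[OF W(2)]]
  proof (rule nn_integral_cong)
    fix \<omega> assume \<omega>: "\<omega> \<in> space M"
    show "of_nat (card (inj_tuples n (points (\<Phi> \<omega>) \<inter> ?W))) = G (translate (\<Phi> \<omega>) w)"
      unfolding card_inj_tuples[OF finite_window[OF \<omega> bounded_shift[OF W(2)]]] G_def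
        emeasure_translate[OF counting[OF \<omega>] W(1)]
        emeasure_eq_card[OF \<omega> borel_shift[OF W(1)] bounded_shift[OF W(2)]]
      by simp
  qed
  also have "\<dots> = (\<integral>\<^sup>+\<omega>. G (\<Phi> \<omega>) \<partial>M)" by (rule nn_integral_stationary[OF G])
  also have "\<dots> = fmoment n W"
    unfolding fmoment_eq[OF W]
  proof (rule nn_integral_cong)
    fix \<omega> assume \<omega>: "\<omega> \<in> space M"
    show "G (\<Phi> \<omega>) = of_nat (card (inj_tuples n (points (\<Phi> \<omega>) \<inter> W)))"
      unfolding card_inj_tuples[OF finite_window[OF \<omega> W(2)]] G_def emeasure_eq_card[OF \<omega> W]
      by simp
  qed
  finally show ?thesis .
qed

lemma fmoment_0: "fmoment 0 W = 1"
  by (simp add: fmoment_def rho_0 PiM_empty nn_integral_count_space_finite)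

text \<open>If some correlation function does not factorise at some tuple \<open>u\<close>, then the decay
  inequality for the splittings \<open>(x | u)\<close>, \<open>(x, u' | u'')\<close> and \<open>(x | u')\<close> bounds the correlation
  functions at all tuples \<open>x\<close> far away from \<open>u\<close>, although \<open>\<delta>\<close> may be unbounded near \<open>0\<close>.\<close>

lemma rho_far_bound:
  assumes pq: "p \<ge> 1" "q \<ge> 1"
    and ne: "\<rho> (p + q) (restrict u {..<p + q}) \<noteq> \<rho> p (restrict u {..<p}) * \<rho> q (\<lambda>i\<in>{..<q}. u (p + i))"
  shows "\<exists>s1\<ge>0. \<exists>A\<ge>0. \<forall>n\<ge>1. \<forall>x. (\<forall>i<n. s1 \<le> norm (x i)) \<longrightarrow>
    \<rho> n (restrict x {..<n}) \<le> A * (\<bar>C (n + (p + q))\<bar> + \<bar>C (n + p)\<bar>)"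
proof -
  obtain s0 where s0: "s0 \<ge> 0" "\<And>s. s \<ge> s0 \<Longrightarrow> \<delta> s \<le> 1"
    using decay_function_power_bound[OF decay_function, of 0] by auto
  obtain Ru where Ru: "\<And>j. j < p + q \<Longrightarrow> norm (u j) \<le> Ru"
    using finite_imp_bounded[of "u ` {..<p + q}"] unfolding bounded_iff by auto
  have Ru0: "0 \<le> Ru" using Ru[of 0] pq norm_ge_zero[of "u 0"] by linarith
  define d0 where "d0 = setdist (u ` {..<p}) (u ` {p..<p + q})"
  have d0: "d0 \<ge> 0" by (simp add: d0_def setdist_pos_le)
  \<comment> \<open>Points of norm at least \<open>s1\<close> are at distance at least
    \<open>s0 + d0\<close> from all \<open>u j\<close>: \<open>s0\<close> brings \<delta> below 1,
    and \<open>d0\<close> keeps the distance between the two parts of \<open>u\<close> unchanged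
    when \<open>x\<close> joins the first part.\<close>
  define s1 where "s1 = Ru + s0 + d0"
  define P where "P = \<rho> (p + q) (restrict u {..<p + q})"
  define \<alpha> where "\<alpha> = \<rho> p (restrict u {..<p})"
  define \<beta> where "\<beta> = \<rho> q (\<lambda>i\<in>{..<q}. u (p + i))"
  define D where "D = \<bar>P - \<alpha> * \<beta>\<bar>"
  have D: "D > 0" using ne by (simp add: D_def P_def \<alpha>_def \<beta>_def)
  define A where "A = (1 + \<delta> d0 + \<bar>\<beta>\<bar>) / D"
  have A: "A \<ge> 0" using D delta_nonneg[OF d0] by (simp add: A_def)
  have "\<rho> n (restrict x {..<n}) \<le> A * (\<bar>C (n + (p + q))\<bar> + \<bar>C (n + p)\<bar>)"
    if n: "n \<ge> 1" and x: "\<forall>i<n. s1 \<le> norm (x i)" for n x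
  proof -
    define v where "v i = (if i < n then x i else u (i - n))" for i
    have far: "s0 + d0 \<le> dist (x i) (u j)" if "i < n" "j < p + q" for i j
    proof -
      have "norm (x i) \<le> norm (x i - u j) + norm (u j)" using norm_triangle_sub by (simp add: add.commute)
      then show ?thesis using x Ru[OF that(2)] that by (auto simp: s1_def dist_norm)
    qed
    have v1: "v ` {..<n} = x ` {..<n}" by (auto simp: v_def)
    have v2: "v ` {n..<n + m} = u ` {..<m}" for m
      by (force simp: v_def image_iff intro: bexI[of _ "n + _"])
    have v3: "v ` {n + p..<n + p + q} = u ` {p..<p + q}"
    proof (intro equalityI subsetI)
      fix y assume "y \<in> u ` {p..<p + q}"
      then obtain j where "y = u j" "p \<le> j" "j < p + q" by auto
      then show "y \<in> v ` {n + p..<n + p + q}" by (intro image_eqI[of _ _ "n + j"]) (auto simp: v_def)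
    next
      fix y assume "y \<in> v ` {n + p..<n + p + q}"
      then obtain j where "y = v j" "n + p \<le> j" "j < n + p + q" by auto
      then show "y \<in> u ` {p..<p + q}" by (intro image_eqI[of _ _ "j - n"]) (auto simp: v_def)
    qed
    have v4: "v ` {..<n + p} = x ` {..<n} \<union> u ` {..<p}"
    proof -
      have "{..<n + p} = {..<n} \<union> {n..<n + p}" by auto
      then show ?thesis using v1 v2[of p] by (simp add: image_Un)
    qed
    have r1: "restrict v {..<n} = restrict x {..<n}" by (auto simp: v_def)
    have r2: "(\<lambda>i\<in>{..<m}. v (n + i)) = restrict u {..<m}" for m by (auto simp: v_def)
    have r3: "(\<lambda>i\<in>{..<q}. v (n + p + i)) = (\<lambda>i\<in>{..<q}. u (p + i))"
      by (auto simp: v_def add.assoc fun_eq_iff)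
    have bound: "C k * \<delta> s \<le> \<bar>C k\<bar>" if "s \<ge> s0" for k s
    proof -
      have "C k * \<delta> s \<le> \<bar>C k\<bar> * \<delta> s"
        using delta_nonneg[of s] s0(1) that by (intro mult_right_mono) auto
      also have "\<dots> \<le> \<bar>C k\<bar> * 1"
        using s0(2)[OF that] by (intro mult_left_mono) auto
      finally show ?thesis by simp
    qed
    have ne1: "x ` {..<n} \<noteq> {}" "u ` {..<m} \<noteq> {}" if "m \<ge> 1" for m
      using n that by (auto simp: lessThan_empty_iff)
    have sdx: "s0 \<le> setdist (x ` {..<n}) (u ` {..<m})" if m: "m \<ge> 1" "m \<le> p + q" for m
    proof (rule le_setdistI)
      fix y z assume "y \<in> x ` {..<n}" "z \<in> u ` {..<m}"
      then obtain i j where "y = x i" "z = u j" "i < n" "j < m" by auto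
      then show "s0 \<le> dist y z" using far[of i j] m d0 by simp
    qed (use ne1 m in auto)
    define r where "r = \<rho> n (restrict x {..<n})"
    define T where "T = \<rho> (n + p + q) (restrict v {..<n + p + q})"
    define T' where "T' = \<rho> (n + p) (restrict v {..<n + p})"
    have "\<bar>T - r * P\<bar> \<le> C (n + (p + q)) * \<delta> (setdist (x ` {..<n}) (u ` {..<p + q}))"
      using decay[of n "p + q" v] n pq by (simp add: r1 r2 v1 v2 T_def r_def P_def add.assoc)
    also have "\<dots> \<le> \<bar>C (n + (p + q))\<bar>"
      using pq by (intro bound sdx) auto
    finally have 1: "\<bar>T - r * P\<bar> \<le> \<bar>C (n + (p + q))\<bar>" .
    have "\<bar>T' - r * \<alpha>\<bar> \<le> C (n + p) * \<delta> (setdist (x ` {..<n}) (u ` {..<p}))"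
      using decay[of n p v] n pq by (simp add: r1 r2 v1 v2 T'_def r_def \<alpha>_def)
    also have "\<dots> \<le> \<bar>C (n + p)\<bar>"
      using pq by (intro bound sdx) auto
    finally have 2: "\<bar>T' - r * \<alpha>\<bar> \<le> \<bar>C (n + p)\<bar>" .
    \<comment> \<open>Here \<delta> is evaluated at \<open>d0\<close>, possibly close to 0; this is
      harmless because \<open>\<delta> d0\<close> is one fixed number independent of
      \<open>x\<close>.\<close>
    have sd: "setdist (v ` {..<n + p}) (v ` {n + p..<n + p + q}) = d0"
    proof (rule antisym)
      show "setdist (v ` {..<n + p}) (v ` {n + p..<n + p + q}) \<le> d0"
        unfolding d0_def v3 v4 using ne1(2)[of p] pq by (intro setdist_subset_left) auto
      show "d0 \<le> setdist (v ` {..<n + p}) (v ` {n + p..<n + p + q})"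
        unfolding v3 v4
      proof (rule le_setdistI)
        fix y z assume "y \<in> x ` {..<n} \<union> u ` {..<p}" and z: "z \<in> u ` {p..<p + q}"
        then show "d0 \<le> dist y z"
        proof (elim UnE)
          assume "y \<in> x ` {..<n}"
          then show ?thesis using z far s0(1) by force
        qed (use z in \<open>auto simp: d0_def intro: setdist_le_dist\<close>)
      qed (use ne1[of p] pq in auto)
    qed
    have "\<bar>T - T' * \<beta>\<bar> \<le> C (n + p + q) * \<delta> d0"
      using decay[of "n + p" q v] pq by (simp add: sd r3 T_def T'_def \<beta>_def)
    also have "\<dots> \<le> \<bar>C (n + (p + q))\<bar> * \<delta> d0"
      using delta_nonneg[OF d0] by (simp add: add.assoc mult_right_mono)
    finally have 3: "\<bar>T - T' * \<beta>\<bar> \<le> \<bar>C (n + (p + q))\<bar> * \<delta> d0" .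
    have r0: "r \<ge> 0" by (simp add: r_def rho_restrict_nonneg)
    \<comment> \<open>Telescoping through the values \<open>T\<close> at (x, u) and
      \<open>T'\<close> at (x, u'), both of which cancel; only the three decay estimates
      remain.\<close>
    have "r * D = \<bar>(r * P - T) + (T - T' * \<beta>) + (T' - r * \<alpha>) * \<beta>\<bar>"
    proof -
      have "(r * P - T) + (T - T' * \<beta>) + (T' - r * \<alpha>) * \<beta> = r * (P - \<alpha> * \<beta>)"
        by (simp add: algebra_simps)
      then show ?thesis using r0 by (simp add: D_def abs_mult)
    qed
    also have "\<dots> \<le> \<bar>T - r * P\<bar> + \<bar>T - T' * \<beta>\<bar> + \<bar>T' - r * \<alpha>\<bar> * \<bar>\<beta>\<bar>"
      unfolding abs_mult[symmetric] by linarith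
    also have "\<dots> \<le> \<bar>C (n + (p + q))\<bar> + \<bar>C (n + (p + q))\<bar> * \<delta> d0 + \<bar>C (n + p)\<bar> * \<bar>\<beta>\<bar>"
      by (intro add_mono 1 2 3 mult_right_mono) auto
    also have "\<dots> \<le> (1 + \<delta> d0 + \<bar>\<beta>\<bar>) * (\<bar>C (n + (p + q))\<bar> + \<bar>C (n + p)\<bar>)"
      using delta_nonneg[OF d0] by (simp add: algebra_simps)
    finally show ?thesis
      using D by (simp add: A_def r_def field_simps)
  qed
  moreover have "s1 \<ge> 0" using Ru0 s0 d0 by (simp add: s1_def)
  ultimately show ?thesis using A by blast
qed

lemma emeasure_box:
  assumes W: "W \<in> sets borel" "bounded W"
  shows "emeasure (lebesgue_tuples n) ({..<n} \<rightarrow>\<^sub>E W) = ennreal (measure lborel W ^ n)"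
proof -
  interpret product_sigma_finite "\<lambda>_::nat. lborel :: 'a measure" by standard
  have "emeasure lborel W = ennreal (measure lborel W)"
    using emeasure_bounded_finite[OF W(2)] by (intro emeasure_eq_ennreal_measure) auto
  then show ?thesis using W by (simp add: emeasure_PiM ennreal_power)
qed

end

context correlated_process
begin

section \<open>Finiteness of factorial and exponential moments\<close>

lemma rho_product:
  assumes fact: "\<And>p q u. p \<ge> 1 \<Longrightarrow> q \<ge> 1 \<Longrightarrow>
    \<rho> (p + q) (restrict u {..<p + q}) = \<rho> p (restrict u {..<p}) * \<rho> q (\<lambda>i\<in>{..<q}. u (p + i))"
  shows "\<rho> n (restrict x {..<n}) = (\<Prod>i<n. \<rho> 1 (\<lambda>_\<in>{..<1}. x i))"
proof (induction n)
  case (Suc n)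
  show ?case
  proof (cases "n = 0")
    case True
    have "restrict x {..<1} = (\<lambda>_\<in>{..<1::nat}. x 0)" by (auto simp: fun_eq_iff)
    then show ?thesis using True by simp
  next
    case False
    have "(\<lambda>i\<in>{..<1::nat}. x (n + i)) = (\<lambda>_\<in>{..<1}. x n)" by (auto simp: fun_eq_iff)
    then have "\<rho> (n + 1) (restrict x {..<n + 1})
        = \<rho> n (restrict x {..<n}) * \<rho> 1 (\<lambda>_\<in>{..<1}. x n)"
      using fact[of n 1 x] False by (simp only:)
    then show ?thesis by (simp only: Suc Suc_eq_plus1[symmetric] prod.lessThan_Suc)
  qed
qed (simp add: rho_0)

text \<open>The density of the tuples is a product by \<open>rho_product\<close>, so Fubini gives a
  power. These are the factorial moments of a Poisson variable whose mean is the intensity measure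
  of \<open>W\<close>.\<close>

lemma fmoment_product:
  assumes fact: "\<And>p q u. p \<ge> 1 \<Longrightarrow> q \<ge> 1 \<Longrightarrow>
    \<rho> (p + q) (restrict u {..<p + q}) = \<rho> p (restrict u {..<p}) * \<rho> q (\<lambda>i\<in>{..<q}. u (p + i))"
    and W: "W \<in> sets borel"
  shows "fmoment n W = (\<integral>\<^sup>+y. ennreal (\<rho> 1 (\<lambda>_\<in>{..<1}. y)) * indicator W y \<partial>lborel) ^ n"
proof -
  interpret product_sigma_finite "\<lambda>_::nat. lborel :: 'a measure" by standard
  have "(\<lambda>y. \<lambda>_\<in>{..<1::nat}. y) \<in> measurable lborel (lebesgue_tuples 1)"
    by (rule measurable_restrict) simp
  then have [measurable]: "(\<lambda>y. \<rho> 1 (\<lambda>_\<in>{..<1}. y)) \<in> borel_measurable lborel"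
    by (rule measurable_compose) (rule rho_measurable)
  have "fmoment n W = (\<integral>\<^sup>+x. (\<Prod>i<n. ennreal (\<rho> 1 (\<lambda>_\<in>{..<1}. x i)) * indicator W (x i)) \<partial>lebesgue_tuples n)"
    unfolding fmoment_def
  proof (rule nn_integral_cong)
    fix x :: "nat \<Rightarrow> 'a" assume x: "x \<in> space (lebesgue_tuples n)"
    then have "restrict x {..<n} = x" by (auto simp: space_PiM)
    then have \<rho>n: "\<rho> n x = (\<Prod>i<n. \<rho> 1 (\<lambda>_\<in>{..<1}. x i))"
      using rho_product[OF fact, of n x] by (simp only:)
    have r0: "0 \<le> \<rho> 1 (\<lambda>_\<in>{..<1}. y)" for y by (rule rho_nonneg) auto
    have "indicator ({..<n} \<rightarrow>\<^sub>E W) x = (\<Prod>i<n. indicator W (x i) :: ennreal)"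
    proof (cases "x \<in> {..<n} \<rightarrow>\<^sub>E W")
      case False
      then obtain i where "i < n" "x i \<notin> W" using x by (auto simp: space_PiM PiE_iff)
      then have "(\<Prod>i<n. indicator W (x i) :: ennreal) = 0" by (intro prod_zero bexI[of _ i]) auto
      then show ?thesis using False by simp
    next
      case True
      then have "x i \<in> W" if "i < n" for i using that by blast
      then show ?thesis using True by simp
    qed
    moreover have "ennreal (\<rho> n x) = (\<Prod>i<n. ennreal (\<rho> 1 (\<lambda>_\<in>{..<1}. x i)))"
      unfolding \<rho>n using r0 by (intro prod_ennreal[symmetric])
    ultimately show "ennreal (\<rho> n x) * indicator ({..<n} \<rightarrow>\<^sub>E W) x
        = (\<Prod>i<n. ennreal (\<rho> 1 (\<lambda>_\<in>{..<1}. x i)) * indicator W (x i))"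
      by (simp only: prod.distrib)
  qed
  also have "\<dots> = (\<Prod>i<n. \<integral>\<^sup>+y. ennreal (\<rho> 1 (\<lambda>_\<in>{..<1}. y)) * indicator W y \<partial>lborel)"
    by (rule product_nn_integral_prod) (use W in measurable)
  finally show ?thesis by simp
qed

lemma nn_integral_indicator_reflect:
  assumes [measurable]: "A \<in> sets borel"
  shows "(\<integral>\<^sup>+(w::'a). indicator A (y - w) \<partial>lborel) = emeasure lborel (A :: 'a set)"
proof -
  have "emeasure lborel A = emeasure (distr lborel borel (\<lambda>w. y - w)) A"
    using lborel_affine[of "-1" y] by (simp add: density_1)
  also have "\<dots> = (\<integral>\<^sup>+w. indicator A w \<partial>distr lborel borel (\<lambda>w. y - w))"
    by simp
  also have "\<dots> = (\<integral>\<^sup>+w. indicator A (y - w) \<partial>lborel)"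
    by (subst nn_integral_distr) auto
  finally show ?thesis ..
qed

text \<open>The density of the intensity measure is finite, hence bounded on a set \<open>A\<close> of positive
  measure; by stationarity all translates of \<open>A\<close> have the same finite intensity, and averaging
  over the translates bounds the intensity of any bounded set.\<close>

lemma shift_invariant_density_finite:
  fixes r :: "'a \<Rightarrow> real"
  assumes r [measurable]: "r \<in> borel_measurable borel" "\<And>y. 0 \<le> r y"
    and I: "\<And>B w. B \<in> sets borel \<Longrightarrow> bounded B \<Longrightarrow>
      (\<integral>\<^sup>+y. ennreal (r y) * indicator B (y - w) \<partial>lborel) = (\<integral>\<^sup>+y. ennreal (r y) * indicator B y \<partial>lborel)"
    and W [measurable]: "W \<in> sets borel" and bW: "bounded W"
  shows "(\<integral>\<^sup>+y. ennreal (r y) * indicator W y \<partial>lborel) < \<infinity>"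
proof -
  define A where "A m = {y \<in> cball 0 (real m). r y \<le> real m}" for m :: nat
  have [measurable]: "A m \<in> sets borel" for m unfolding A_def by measurable
  have "\<exists>m. emeasure lborel (A m) \<noteq> 0"
  proof (rule ccontr)
    assume "\<not> ?thesis"
    then have "emeasure lborel (\<Union>m. A m) = 0" by (intro emeasure_UN_eq_0) auto
    moreover have "(\<Union>m. A m) = UNIV"
    proof -
      have "y \<in> (\<Union>m. A m)" for y
      proof -
        obtain m :: nat where "max (norm y) (r y) \<le> real m" using real_arch_simple by blast
        then have "y \<in> A m" by (simp add: A_def)
        then show ?thesis by blast
      qed
      then show ?thesis by blast
    qed
    ultimately show False by simp
  qed
  then obtain m where m: "emeasure lborel (A m) \<noteq> 0" by blast
  have bA: "bounded (A m)" by (rule bounded_subset[of "cball 0 (real m)"]) (auto simp: A_def)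
  obtain R0 where R0: "W \<subseteq> cball 0 R0" using bounded_subset_cball_0[OF bW] .
  \<comment> \<open>A translate of \<open>A m\<close> by \<open>w\<close> can meet \<open>W\<close>
    only if \<open>w\<close> has norm at most \<open>R\<close>, so the average runs over a set of
    finite volume.\<close>
  define R where "R = R0 + real m"
  define J where "J = (\<integral>\<^sup>+y. ennreal (r y) * indicator (A m) y \<partial>lborel)"
  have "J \<le> (\<integral>\<^sup>+y. ennreal (real m) * indicator (A m) y \<partial>lborel)"
    unfolding J_def by (rule nn_integral_mono) (auto simp: A_def indicator_def ennreal_leI)
  also have "\<dots> = ennreal (real m) * emeasure lborel (A m)" by (simp add: nn_integral_cmult)
  also have "\<dots> < \<infinity>" using emeasure_bounded_finite[OF bA] by (simp add: ennreal_mult_less_top)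
  finally have J: "J < \<infinity>" .
  \<comment> \<open>For each \<open>y\<close>, \<open>emeasure lborel (A m)\<close> is the volume of
    those \<open>w\<close> for which \<open>y\<close> lies in the translate of \<open>A m\<close> by
    \<open>w\<close>; the average over translates thus appears as a double integral.\<close>
  have "emeasure lborel (A m) * (\<integral>\<^sup>+y. ennreal (r y) * indicator W y \<partial>lborel)
      = (\<integral>\<^sup>+y. (\<integral>\<^sup>+(w::'a). ennreal (r y) * indicator W y * indicator (A m) (y - w) \<partial>lborel) \<partial>lborel)"
    by (simp add: nn_integral_cmult nn_integral_indicator_reflect nn_integral_multc mult.commute)
  also have "\<dots> \<le> (\<integral>\<^sup>+y. (\<integral>\<^sup>+(w::'a). indicator (cball 0 R) w * (ennreal (r y) * indicator (A m) (y - w)) \<partial>lborel) \<partial>lborel)"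
  proof (intro nn_integral_mono)
    fix y w
    have "w \<in> cball 0 R" if "y \<in> W" "y - w \<in> A m"
      using that R0 norm_triangle_ineq4[of y "y - w"] by (auto simp: A_def R_def)
    then show "ennreal (r y) * indicator W y * indicator (A m) (y - w)
        \<le> indicator (cball 0 R) w * (ennreal (r y) * indicator (A m) (y - w))"
      by (auto simp: indicator_def)
  qed
  also have "\<dots> = (\<integral>\<^sup>+(w::'a). (\<integral>\<^sup>+y. indicator (cball 0 R) w * (ennreal (r y) * indicator (A m) (y - w)) \<partial>lborel) \<partial>lborel)"
  proof (rule lborel_pair.Fubini')
    have "cball (0::'a) R \<in> sets borel" by simp
    then show "(\<lambda>(w, y). indicator (cball 0 R) w * (ennreal (r y) * indicator (A m) (y - w)))
        \<in> borel_measurable (lborel \<Otimes>\<^sub>M lborel)"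
      by measurable
  qed
  also have "\<dots> = (\<integral>\<^sup>+(w::'a). indicator (cball 0 R) w * J \<partial>lborel)"
    unfolding J_def using I[OF _ bA] by (intro nn_integral_cong) (simp add: nn_integral_cmult)
  also have "\<dots> = emeasure lborel (cball (0::'a) R) * J"
    by (subst nn_integral_multc) (simp_all add: borel_measurable_indicator)
  also have "\<dots> < \<infinity>"
    using J emeasure_bounded_finite[OF bounded_cball, of "0::'a" R] by (simp add: ennreal_mult_less_top)
  finally show ?thesis using m by (auto simp: ennreal_mult_less_top)
qed

text \<open>If all correlation functions factorise, the moments are powers of a finite mean.
  Otherwise stationarity moves \<open>W\<close> into the region of \<open>rho_far_bound\<close>,
  where the growth of \<open>C\<close> takes over. The weight \<open>fact n / 2 ^ n\<close> makes
  the series for the exponential moment converge.\<close>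

lemma fmoment_bound:
  assumes W: "W \<in> sets borel" "bounded W" and K: "K > 0"
  shows "\<exists>A\<ge>0. \<forall>n. fmoment n W * ennreal (K ^ n) \<le> ennreal (A * fact n / 2 ^ n)"
proof (cases "\<forall>p\<ge>1. \<forall>q\<ge>1. \<forall>u. \<rho> (p + q) (restrict u {..<p + q})
    = \<rho> p (restrict u {..<p}) * \<rho> q (\<lambda>i\<in>{..<q}. u (p + i))")
  case True
  define r where "r y = \<rho> 1 (\<lambda>_\<in>{..<1}. y)" for y
  have prod: "fmoment n B = (\<integral>\<^sup>+y. ennreal (r y) * indicator B y \<partial>lborel) ^ n" if "B \<in> sets borel" for n B
    unfolding r_def using True that by (intro fmoment_product) blast+
  have r_nonneg: "0 \<le> r y" for y unfolding r_def by (rule rho_nonneg) auto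
  have "(\<lambda>y. \<lambda>_\<in>{..<1::nat}. y) \<in> measurable lborel (lebesgue_tuples 1)"
    by (rule measurable_restrict) simp
  then have "r \<in> borel_measurable lborel"
    unfolding r_def by (rule measurable_compose) (rule rho_measurable)
  then have r: "r \<in> borel_measurable borel" by simp
  have "(\<integral>\<^sup>+y. ennreal (r y) * indicator W y \<partial>lborel) < \<infinity>"
  proof (rule shift_invariant_density_finite[OF r r_nonneg _ W])
    fix B :: "'a set" and w assume B: "B \<in> sets borel" "bounded B"
    have "(\<integral>\<^sup>+y. ennreal (r y) * indicator B (y - w) \<partial>lborel)
        = (\<integral>\<^sup>+y. ennreal (r y) * indicator ((\<lambda>y. y + w) ` B) y \<partial>lborel)"
      by (intro nn_integral_cong arg_cong2[where f=times] refl)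
         (auto simp: indicator_def image_iff intro: bexI[of _ "_ - w"])
    also have "\<dots> = fmoment 1 ((\<lambda>y. y + w) ` B)" by (simp add: prod[OF borel_shift[OF B(1)]])
    also have "\<dots> = fmoment 1 B" by (rule fmoment_shift[OF B])
    also have "\<dots> = (\<integral>\<^sup>+y. ennreal (r y) * indicator B y \<partial>lborel)" by (simp add: prod[OF B(1)])
    finally show "(\<integral>\<^sup>+y. ennreal (r y) * indicator B (y - w) \<partial>lborel)
        = (\<integral>\<^sup>+y. ennreal (r y) * indicator B y \<partial>lborel)" .
  qed
  then obtain m where m: "m \<ge> 0" "(\<integral>\<^sup>+y. ennreal (r y) * indicator W y \<partial>lborel) = ennreal m"
    by (auto simp: less_top_ennreal)
  \<comment> \<open>One term of the exponential series at \<open>2 * m * K\<close>; the 2 supplies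
    the factor \<open>1 / 2 ^ n\<close>.\<close>
  have le: "m ^ n * K ^ n \<le> exp (2 * m * K) * fact n / 2 ^ n" for n
  proof -
    have "(2 * m * K) ^ n /\<^sub>R fact n \<le> (\<Sum>k. (2 * m * K) ^ k /\<^sub>R fact k)"
      using sum_le_suminf[of "\<lambda>k. (2 * m * K) ^ k /\<^sub>R fact k" "{n}"] summable_exp_generic[of "2 * m * K"] m K
      by simp
    then have "(2 * m * K) ^ n \<le> exp (2 * m * K) * fact n" by (simp add: exp_def field_simps)
    then show ?thesis by (simp add: field_simps power_mult_distrib)
  qed
  have "fmoment n W * ennreal (K ^ n) \<le> ennreal (exp (2 * m * K) * fact n / 2 ^ n)" for n
    using le[of n] m K by (simp add: prod[OF W(1)] ennreal_power ennreal_mult[symmetric] ennreal_leI)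
  then show ?thesis by (intro exI[of _ "exp (2 * m * K)"]) simp
next
  case False
  then obtain p q u where pq: "p \<ge> 1" "q \<ge> 1" and
    ne: "\<rho> (p + q) (restrict u {..<p + q}) \<noteq> \<rho> p (restrict u {..<p}) * \<rho> q (\<lambda>i\<in>{..<q}. u (p + i))"
    by blast
  obtain s1 A where s1: "s1 \<ge> 0" and A: "A \<ge> 0" and far: "\<And>n x. n \<ge> 1 \<Longrightarrow> \<forall>i<n. s1 \<le> norm (x i) \<Longrightarrow>
      \<rho> n (restrict x {..<n}) \<le> A * (\<bar>C (n + (p + q))\<bar> + \<bar>C (n + p)\<bar>)"
    using rho_far_bound[OF pq ne] by blast
  obtain R where R: "W \<subseteq> cball 0 R" using bounded_subset_cball_0[OF W(2)] .
  obtain b :: 'a where b: "b \<in> Basis" using nonempty_Basis by blast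
  \<comment> \<open>Any vector of this length carries \<open>W\<close> to points of norm at least
    \<open>s1\<close>. The absolute value covers an empty \<open>W\<close>, for which
    \<open>R\<close> may be negative.\<close>
  define w where "w = (s1 + \<bar>R\<bar>) *\<^sub>R b"
  have nw: "norm w = s1 + \<bar>R\<bar>" using b s1 by (simp add: w_def)
  let ?W = "(\<lambda>y. y + w) ` W"
  have W': "?W \<in> sets borel" "bounded ?W" using borel_shift bounded_shift W by auto
  have norm_W': "s1 \<le> norm y" if "y \<in> ?W" for y
  proof -
    from that obtain z where z: "z \<in> W" "y = z + w" by blast
    then have "norm z \<le> R" using R by auto
    moreover have "norm w \<le> norm y + norm z" using z norm_triangle_ineq4[of y z] by simp
    ultimately show ?thesis using nw by simp
  qed
  define V where "V = measure lborel ?W"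
  have V: "V \<ge> 0" by (simp add: V_def)
  \<comment> \<open>Being at least 1, it allows the exponent \<open>n\<close> to be raised to
    \<open>n + m\<close>, the index at which \<open>C\<close> is evaluated.\<close>
  define K' where "K' = K * V + 1"
  have K': "K' \<ge> 1" "K * V \<le> K'" using K V by (simp_all add: K'_def)
  obtain B where B: "B \<ge> 0" "\<And>n m. \<bar>C (n + m)\<bar> * K' ^ (n + m) \<le> B * fact n * fact m / 2 ^ (n + m)"
    using growth_pair_bound[OF growth a_less_1, of K'] K' by auto
  have CB: "\<bar>C (n + m)\<bar> * (K * V) ^ n \<le> B * fact m * (fact n / 2 ^ n)" for n m
  proof -
    have "(K * V) ^ n \<le> K' ^ n" using K V K' by (intro power_mono) auto
    also have "\<dots> \<le> K' ^ (n + m)" using K' by (intro power_increasing) auto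
    finally have "\<bar>C (n + m)\<bar> * (K * V) ^ n \<le> \<bar>C (n + m)\<bar> * K' ^ (n + m)"
      by (intro mult_left_mono) auto
    also have "\<dots> \<le> B * fact n * fact m / 2 ^ (n + m)" by (rule B)
    also have "\<dots> \<le> B * fact n * fact m / 2 ^ n"
      using B(1) by (intro divide_left_mono power_increasing) auto
    finally show ?thesis by (simp add: mult_ac)
  qed
  \<comment> \<open>The product collects the contributions of \<open>C (n + (p + q))\<close> and
    \<open>C (n + p)\<close>; the summand 1 covers n = 0, where the moment is 1.\<close>
  define A' where "A' = A * (B * fact (p + q) + B * fact p) + 1"
  have A': "A' \<ge> 1" using A B(1) by (simp add: A'_def)
  have "fmoment n W * ennreal (K ^ n) \<le> ennreal (A' * fact n / 2 ^ n)" for n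
  proof (cases "n = 0")
    case True
    then show ?thesis using A' by (simp add: fmoment_0)
  next
    case False
    define \<kappa> where "\<kappa> = A * (\<bar>C (n + (p + q))\<bar> + \<bar>C (n + p)\<bar>)"
    have \<kappa>: "\<kappa> \<ge> 0" using A by (simp add: \<kappa>_def)
    have "fmoment n W = fmoment n ?W" using fmoment_shift[OF W] by simp
    also have "\<dots> \<le> (\<integral>\<^sup>+x. ennreal \<kappa> * indicator ({..<n} \<rightarrow>\<^sub>E ?W) x \<partial>lebesgue_tuples n)"
      unfolding fmoment_def
    proof (rule nn_integral_mono)
      fix x
      show "ennreal (\<rho> n x) * indicator ({..<n} \<rightarrow>\<^sub>E ?W) x \<le> ennreal \<kappa> * indicator ({..<n} \<rightarrow>\<^sub>E ?W) x"
      proof (cases "x \<in> {..<n} \<rightarrow>\<^sub>E ?W")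
        case True
        then have "restrict x {..<n} = x" by (auto simp: PiE_def extensional_restrict)
        moreover have "\<forall>i<n. s1 \<le> norm (x i)" using True norm_W' by blast
        ultimately have "\<rho> n x \<le> \<kappa>" using far[of n x] False by (simp add: \<kappa>_def)
        then show ?thesis using True by (simp add: ennreal_leI)
      qed simp
    qed
    also have "\<dots> = ennreal \<kappa> * ennreal (V ^ n)"
      using emeasure_box[OF W', of n] W' by (simp add: nn_integral_cmult V_def)
    finally have "fmoment n W * ennreal (K ^ n) \<le> ennreal \<kappa> * ennreal (V ^ n) * ennreal (K ^ n)"
      by (rule mult_right_mono) simp
    also have "\<dots> = ennreal (\<kappa> * (K * V) ^ n)"
      using \<kappa> V K by (simp add: ennreal_mult[symmetric] power_mult_distrib mult_ac)
    also have "\<dots> \<le> ennreal (A' * fact n / 2 ^ n)"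
    proof (rule ennreal_leI)
      have "\<kappa> * (K * V) ^ n = A * (\<bar>C (n + (p + q))\<bar> * (K * V) ^ n + \<bar>C (n + p)\<bar> * (K * V) ^ n)"
        by (simp add: \<kappa>_def algebra_simps)
      also have "\<dots> \<le> A * (B * fact (p + q) * (fact n / 2 ^ n) + B * fact p * (fact n / 2 ^ n))"
        using A by (intro mult_left_mono add_mono CB)
      also have "\<dots> = (A * (B * fact (p + q) + B * fact p)) * (fact n / 2 ^ n)"
        by (simp add: algebra_simps)
      also have "\<dots> \<le> A' * (fact n / 2 ^ n)" by (rule mult_right_mono) (simp_all add: A'_def)
      finally show "\<kappa> * (K * V) ^ n \<le> A' * fact n / 2 ^ n" by simp
    qed
    finally show ?thesis .
  qed
  then show ?thesis using A' by (intro exI[of _ A']) auto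
qed

lemma fmoment_finite:
  assumes W: "W \<in> sets borel" "bounded W"
  shows "fmoment n W < \<infinity>"
proof -
  obtain A where "\<And>n. fmoment n W * ennreal (1 ^ n) \<le> ennreal (A * fact n / 2 ^ n)"
    using fmoment_bound[OF W, of 1] by auto
  from this[of n] show ?thesis by (simp add: le_less_trans[OF _ ennreal_less_top])
qed

text \<open>With \<open>K = c - 1\<close> the power is a series of tuple counts with nonnegative
  weights \<open>K ^ n / fact n\<close>. Integrating term by term leaves the factorial moments, and
  \<open>fmoment_bound\<close> gives a geometric majorant.\<close>

lemma integrable_exponential_moment:
  assumes W: "W \<in> sets borel" "bounded W" and c: "c > (1::real)"
  shows "integrable M (\<lambda>\<omega>. c ^ card (points (\<Phi> \<omega>) \<inter> W))"
proof (rule integrableI_nonneg)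
  define K where "K = c - 1"
  have K: "K > 0" using c by (simp add: K_def)
  let ?N = "\<lambda>\<omega>. card (points (\<Phi> \<omega>) \<inter> W)"
  have "(\<lambda>\<omega>. c powr real (?N \<omega>)) \<in> borel_measurable M"
    using measurable_card_window[OF W] by measurable
  then show "(\<lambda>\<omega>. c ^ ?N \<omega>) \<in> borel_measurable M" using c by (simp add: powr_realpow)
  show "AE \<omega> in M. 0 \<le> c ^ ?N \<omega>" using c by simp
  have tm: "(\<lambda>\<omega>. (of_nat (card (inj_tuples n (points (\<Phi> \<omega>) \<inter> W))) :: ennreal)) \<in> borel_measurable M" for n
  proof -
    have "(\<lambda>\<omega>. nat \<lfloor>real (?N \<omega>)\<rfloor>) \<in> measurable M (count_space UNIV)"
      using measurable_card_window[OF W] by measurable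
    then have "(\<lambda>\<omega>. (of_nat (fact n * (?N \<omega> choose n)) :: ennreal)) \<in> borel_measurable M"
      using measurable_compose[of ?N M "count_space UNIV"
          "\<lambda>k. of_nat (fact n * (k choose n)) :: ennreal" borel] by simp
    then show ?thesis
      by (rule measurable_cong[THEN iffD1, rotated]) (simp add: card_inj_tuples finite_window W)
  qed
  obtain A where A: "A \<ge> 0" "\<And>n. fmoment n W * ennreal (K ^ n) \<le> ennreal (A * fact n / 2 ^ n)"
    using fmoment_bound[OF W K] by blast
  have "(\<integral>\<^sup>+\<omega>. ennreal (c ^ ?N \<omega>) \<partial>M)
      = (\<integral>\<^sup>+\<omega>. (\<Sum>n. ennreal (K ^ n / fact n) * of_nat (card (inj_tuples n (points (\<Phi> \<omega>) \<inter> W)))) \<partial>M)"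
  proof (rule nn_integral_cong)
    fix \<omega> assume \<omega>: "\<omega> \<in> space M"
    let ?S = "points (\<Phi> \<omega>) \<inter> W"
    have fin: "finite ?S" using finite_window[OF \<omega> W(2)] .
    have "c ^ card ?S = (\<Sum>n\<le>card ?S. K ^ n / fact n * real (card (inj_tuples n ?S)))"
      using sum_card_inj_tuples[OF fin order_refl, of K] by (simp add: K_def)
    then have "ennreal (c ^ card ?S) = (\<Sum>n\<le>card ?S. ennreal (K ^ n / fact n) * of_nat (card (inj_tuples n ?S)))"
    proof -
      have "ennreal (\<Sum>n\<le>card ?S. K ^ n / fact n * real (card (inj_tuples n ?S)))
          = (\<Sum>n\<le>card ?S. ennreal (K ^ n / fact n * real (card (inj_tuples n ?S))))"
        using K by (intro sum_ennreal[symmetric]) simp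
      also have "\<dots> = (\<Sum>n\<le>card ?S. ennreal (K ^ n / fact n) * of_nat (card (inj_tuples n ?S)))"
        using K by (intro sum.cong refl) (simp only: ennreal_mult'' of_nat_0_le_iff ennreal_of_nat_eq_real_of_nat)
      finally show ?thesis by (simp only: \<open>c ^ card ?S = _\<close>)
    qed
    also have "\<dots> = (\<Sum>n. ennreal (K ^ n / fact n) * of_nat (card (inj_tuples n ?S)))"
      by (rule suminf_finite[symmetric]) (auto simp: card_inj_tuples[OF fin] binomial_eq_0)
    finally show "ennreal (c ^ card ?S) = (\<Sum>n. ennreal (K ^ n / fact n) * of_nat (card (inj_tuples n ?S)))" .
  qed
  also have "\<dots> = (\<Sum>n. ennreal (K ^ n / fact n) * fmoment n W)"
    using tm by (simp add: nn_integral_suminf nn_integral_cmult fmoment_eq[OF W])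
  also have "\<dots> \<le> (\<Sum>n. ennreal (A / 2 ^ n))"
  proof (intro suminf_le summableI)
    fix n
    have "ennreal (K ^ n / fact n) * fmoment n W = ennreal (1 / fact n) * (fmoment n W * ennreal (K ^ n))"
      using K by (simp add: divide_inverse ennreal_mult mult_ac)
    also have "\<dots> \<le> ennreal (1 / fact n) * ennreal (A * fact n / 2 ^ n)"
      by (intro mult_left_mono A) simp
    also have "\<dots> = ennreal (A / 2 ^ n)"
      using A(1) by (subst ennreal_mult[symmetric]) auto
    finally show "ennreal (K ^ n / fact n) * fmoment n W \<le> ennreal (A / 2 ^ n)" .
  qed
  also have "\<dots> = ennreal (\<Sum>n. A * (1 / 2) ^ n)"
  proof -
    have "summable (\<lambda>n. A * (1 / 2 :: real) ^ n)" by (intro summable_mult summable_geometric) simp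
    then have "(\<Sum>n. ennreal (A * (1 / 2) ^ n)) = ennreal (\<Sum>n. A * (1 / 2) ^ n)"
      using A(1) by (intro suminf_ennreal2) auto
    moreover have "A / 2 ^ n = A * (1 / 2) ^ n" for n by (simp add: power_one_over)
    ultimately show ?thesis by (simp only:)
  qed
  finally show "(\<integral>\<^sup>+\<omega>. ennreal (c ^ ?N \<omega>) \<partial>M) < \<infinity>" by (simp add: le_less_trans[OF _ ennreal_less_top])
qed

section \<open>Campbell's formula for bounded functions on a window\<close>

text \<open>The integral is at most \<open>B\<close> times a factorial moment of \<open>W\<close>,
  hence finite; this turns the identity for extended nonnegative integrals into one for real
  integrals.\<close>

lemma campbell_window_nonneg:
  fixes f :: "(nat \<Rightarrow> 'a) \<Rightarrow> real"
  assumes W: "W \<in> sets borel" "bounded W"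
    and f: "f \<in> borel_measurable (lebesgue_tuples n)" "\<And>x. 0 \<le> f x" "\<And>x. f x \<le> B"
    and supp: "\<And>x. x \<notin> {..<n} \<rightarrow>\<^sub>E W \<Longrightarrow> f x = 0"
  shows "integrable M (\<lambda>\<omega>. \<Sum>x\<in>inj_tuples n (points (\<Phi> \<omega>) \<inter> W). f x) \<and>
    integrable (lebesgue_tuples n) (\<lambda>x. \<rho> n x * f x) \<and>
    (\<integral>\<omega>. (\<Sum>x\<in>inj_tuples n (points (\<Phi> \<omega>) \<inter> W). f x) \<partial>M) = (\<integral>x. \<rho> n x * f x \<partial>lebesgue_tuples n)"
proof -
  note [measurable] = f(1)
  let ?X = "\<lambda>\<omega>. \<Sum>x\<in>inj_tuples n (points (\<Phi> \<omega>) \<inter> W). f x"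
  have eq: "(\<integral>\<^sup>+x. ennreal (f x) \<partial>count_space (inj_tuples n (points (\<Phi> \<omega>)))) = ennreal (?X \<omega>)"
    if "\<omega> \<in> space M" for \<omega>
    using finite_window[OF that W(2)] supp f(2)
    by (subst nn_integral_inj_tuples_window[where W=W]) (auto simp: sum_ennreal)
  have "(\<lambda>\<omega>. ennreal (?X \<omega>)) \<in> borel_measurable M"
    using measurable_tuple_sum[of "\<lambda>x. ennreal (f x)" n]
    by (rule measurable_cong[THEN iffD1, rotated]) (simp_all add: eq)
  then have "(\<lambda>\<omega>. enn2real (ennreal (?X \<omega>))) \<in> borel_measurable M" by measurable
  then have Xm: "?X \<in> borel_measurable M" using f(2) by (simp add: sum_nonneg)
  have \<rho>f: "0 \<le> \<rho> n x * f x" for x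
  proof (cases "x \<in> {..<n} \<rightarrow>\<^sub>E W")
    case True
    then have "x \<in> {..<n} \<rightarrow>\<^sub>E UNIV" by (simp add: PiE_iff)
    from rho_nonneg[OF this] show ?thesis using f(2)[of x] by simp
  qed (simp add: supp)
  have nn: "(\<integral>\<^sup>+\<omega>. ennreal (?X \<omega>) \<partial>M) = (\<integral>\<^sup>+x. ennreal (\<rho> n x * f x) \<partial>lebesgue_tuples n)"
  proof -
    have "(\<integral>\<^sup>+\<omega>. ennreal (?X \<omega>) \<partial>M)
      = (\<integral>\<^sup>+\<omega>. (\<integral>\<^sup>+x. ennreal (f x) \<partial>count_space (inj_tuples n (points (\<Phi> \<omega>)))) \<partial>M)"
      by (intro nn_integral_cong) (simp add: eq)
    also have "\<dots> = (\<integral>\<^sup>+x. ennreal (\<rho> n x) * ennreal (f x) \<partial>lebesgue_tuples n)"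
      by (rule campbell[OF correlation]) measurable
    also have "\<dots> = (\<integral>\<^sup>+x. ennreal (\<rho> n x * f x) \<partial>lebesgue_tuples n)"
      by (intro nn_integral_cong) (simp add: ennreal_mult'' f)
    finally show ?thesis .
  qed
  have "(\<integral>\<^sup>+x. ennreal (\<rho> n x * f x) \<partial>lebesgue_tuples n)
      \<le> (\<integral>\<^sup>+x. ennreal B * (ennreal (\<rho> n x) * indicator ({..<n} \<rightarrow>\<^sub>E W) x) \<partial>lebesgue_tuples n)"
  proof (rule nn_integral_mono)
    fix x
    show "ennreal (\<rho> n x * f x) \<le> ennreal B * (ennreal (\<rho> n x) * indicator ({..<n} \<rightarrow>\<^sub>E W) x)"
    proof (cases "x \<in> {..<n} \<rightarrow>\<^sub>E W")
      case True
      have "ennreal (\<rho> n x * f x) = ennreal (\<rho> n x) * ennreal (f x)" by (simp add: ennreal_mult'' f)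
      also have "\<dots> \<le> ennreal (\<rho> n x) * ennreal B" by (intro mult_left_mono ennreal_leI f) simp
      finally show ?thesis using True by (simp add: mult.commute)
    qed (simp add: supp)
  qed
  also have "\<dots> = ennreal B * fmoment n W"
    unfolding fmoment_def using sets_box[OF W(1), of n] by (intro nn_integral_cmult) simp
  also have "\<dots> < \<infinity>" using fmoment_finite[OF W, of n] by (simp add: ennreal_mult_less_top)
  finally have fin: "(\<integral>\<^sup>+x. ennreal (\<rho> n x * f x) \<partial>lebesgue_tuples n) < \<infinity>" .
  have "integrable M ?X"
    by (rule integrableI_nonneg) (use Xm f(2) nn fin in \<open>auto simp: sum_nonneg\<close>)
  moreover have "integrable (lebesgue_tuples n) (\<lambda>x. \<rho> n x * f x)"
    by (rule integrableI_nonneg) (use \<rho>f fin in auto)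
  moreover have "integral\<^sup>L M ?X = (\<integral>x. \<rho> n x * f x \<partial>lebesgue_tuples n)"
    using Xm f(2) \<rho>f nn
    by (simp add: integral_eq_nn_integral sum_nonneg)
  ultimately show ?thesis by blast
qed

text \<open>Positive and negative parts are treated separately; signed integrands are what Moebius
  transforms produce.\<close>

lemma campbell_window:
  fixes f :: "(nat \<Rightarrow> 'a) \<Rightarrow> real"
  assumes W: "W \<in> sets borel" "bounded W"
    and f: "f \<in> borel_measurable (lebesgue_tuples n)" "\<And>x. \<bar>f x\<bar> \<le> B"
    and supp: "\<And>x. x \<notin> {..<n} \<rightarrow>\<^sub>E W \<Longrightarrow> f x = 0"
  shows "integrable M (\<lambda>\<omega>. \<Sum>x\<in>inj_tuples n (points (\<Phi> \<omega>) \<inter> W). f x)" (is ?A)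
    and "integrable (lebesgue_tuples n) (\<lambda>x. \<rho> n x * f x)" (is ?B)
    and "(\<integral>\<omega>. (\<Sum>x\<in>inj_tuples n (points (\<Phi> \<omega>) \<inter> W). f x) \<partial>M) = (\<integral>x. \<rho> n x * f x \<partial>lebesgue_tuples n)" (is ?C)
proof -
  have pos: "(\<lambda>x. max 0 (f x)) \<in> borel_measurable (lebesgue_tuples n)"
    and neg: "(\<lambda>x. max 0 (- f x)) \<in> borel_measurable (lebesgue_tuples n)"
    using f(1) by measurable
  have bd: "max 0 (f x) \<le> \<bar>B\<bar>" "max 0 (- f x) \<le> \<bar>B\<bar>" for x using f(2)[of x] by auto
  note P = campbell_window_nonneg[OF W pos _ bd(1)] campbell_window_nonneg[OF W neg _ bd(2)]
  have split: "f x = max 0 (f x) - max 0 (- f x)" for x by auto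
  have sX: "(\<Sum>x\<in>T. f x) = (\<Sum>x\<in>T. max 0 (f x)) - (\<Sum>x\<in>T. max 0 (- f x))" for T
    by (subst split) (simp only: sum_subtractf)
  have s\<rho>: "\<rho> n x * f x = \<rho> n x * max 0 (f x) - \<rho> n x * max 0 (- f x)" for x
    by (subst split) (simp only: right_diff_distrib)
  show ?A unfolding sX using P supp by (intro Bochner_Integration.integrable_diff) auto
  show ?B unfolding s\<rho> using P supp by (intro Bochner_Integration.integrable_diff) auto
  show ?C unfolding sX s\<rho> using P supp by (subst (1 2) Bochner_Integration.integral_diff) auto
qed

end

section \<open>Decay of covariances\<close>

text \<open>Indexing by positions makes the configuration formed by part of a tuple a measurable
  function of the tuple, also when entries coincide. For distinct entries it is
  \<open>set_sum\<close> of the image.\<close>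

definition point_sum :: "nat set \<Rightarrow> (nat \<Rightarrow> 'a) \<Rightarrow> 'a::euclidean_space measure" where
  "point_sum J x = distr (count_space J) borel x"

definition set_sum :: "'a set \<Rightarrow> 'a::euclidean_space measure" where
  "set_sum S = distr (count_space S) borel (\<lambda>x. x)"

lemma emeasure_distr_count_space:
  assumes "finite J" "B \<in> sets borel"
  shows "emeasure (distr (count_space J) borel f) B = of_nat (card {i \<in> J. f i \<in> B})"
proof -
  have "f -` B \<inter> J = {i \<in> J. f i \<in> B}" by auto
  then show ?thesis using assms by (simp add: emeasure_distr emeasure_count_space)
qed

lemma distr_count_space_counting: "finite J \<Longrightarrow> distr (count_space J) borel f \<in> counting_measures"
  by (auto simp: counting_measures_def emeasure_distr_count_space)

lemma point_sum_counting: "finite J \<Longrightarrow> point_sum J x \<in> counting_measures"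
  by (simp add: point_sum_def distr_count_space_counting)

lemma set_sum_counting: "finite S \<Longrightarrow> set_sum S \<in> counting_measures"
  by (simp add: set_sum_def distr_count_space_counting)

lemma point_sum_eq_set_sum:
  assumes "finite J" "inj_on x J"
  shows "point_sum J x = set_sum (x ` J)"
proof (rule counting_eqI)
  fix y
  have "card {z \<in> x ` J. z \<in> {y}} = card (x ` {i \<in> J. x i \<in> {y}})"
    by (rule arg_cong[where f=card]) auto
  also have "\<dots> = card {i \<in> J. x i \<in> {y}}"
    using assms by (intro card_image) (auto intro: inj_on_subset)
  finally show "emeasure (point_sum J x) {y} = emeasure (set_sum (x ` J)) {y}"
    using assms by (simp add: point_sum_def set_sum_def emeasure_distr_count_space)
qed (use assms in \<open>auto intro: point_sum_counting set_sum_counting\<close>)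

lemma measurable_point_sum:
  assumes J: "J \<subseteq> {..<n}"
  shows "point_sum J \<in> measurable (PiM {..<n} (\<lambda>_. lborel :: 'a::euclidean_space measure)) counting_space"
proof (rule measurable_counting_spaceI)
  have fin: "finite J" using J finite_subset by blast
  show "point_sum J x \<in> counting_measures" for x :: "nat \<Rightarrow> 'a" using point_sum_counting[OF fin] .
  fix B :: "'a set" assume B: "B \<in> sets borel"
  have "(\<lambda>x. \<Sum>i\<in>J. indicator B (x i) :: ennreal) \<in> borel_measurable (PiM {..<n} (\<lambda>_. lborel :: 'a measure))"
  proof (rule borel_measurable_sum)
    fix i assume "i \<in> J"
    then have "(\<lambda>x. x i) \<in> measurable (PiM {..<n} (\<lambda>_. lborel :: 'a measure)) lborel"
      using J by (intro measurable_component_singleton) auto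
    then show "(\<lambda>x. indicator B (x i) :: ennreal) \<in> borel_measurable (PiM {..<n} (\<lambda>_. lborel :: 'a measure))"
      by (rule measurable_compose) (use B in simp)
  qed
  moreover have "emeasure (point_sum J x) B = (\<Sum>i\<in>J. indicator B (x i))" for x :: "nat \<Rightarrow> 'a"
    using fin B by (simp add: point_sum_def emeasure_distr_count_space indicator_def sum.If_cases Int_def of_bool_def)
  ultimately show "(\<lambda>x. emeasure (point_sum J x) B) \<in> borel_measurable (PiM {..<n} (\<lambda>_. lborel :: 'a measure))"
    by simp
qed

text \<open>The bound by the number of points in \<open>W\<close> normalises the functionals: it
  controls their moments and lets later constants depend on the window only.\<close>

definition local_functional :: "'a::euclidean_space set \<Rightarrow> ('a measure \<Rightarrow> real) \<Rightarrow> bool" where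
  "local_functional W F \<longleftrightarrow> F \<in> borel_measurable counting_space \<and>
     (\<forall>\<phi>\<in>counting_measures. \<forall>\<psi>\<in>counting_measures. agree W \<phi> \<psi> \<longrightarrow> F \<phi> = F \<psi>) \<and>
     (\<forall>\<phi>\<in>counting_measures. \<bar>F \<phi>\<bar> \<le> measure \<phi> W)"

text \<open>The sign is that of n - |J|, so this is the Moebius transform along the Boolean lattice
  of index sets. It refers to positions, not to sets of points, in order to be defined on all
  tuples.\<close>

definition moebius :: "('a::euclidean_space measure \<Rightarrow> real) \<Rightarrow> nat \<Rightarrow> (nat \<Rightarrow> 'a) \<Rightarrow> real" where
  "moebius F n x = (\<Sum>J\<in>Pow {..<n}. (-1) ^ n * ((-1) ^ card J * F (point_sum J x)))"

lemma moebius_measurable: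
  assumes F: "F \<in> borel_measurable counting_space"
  shows "moebius F n \<in> borel_measurable (PiM {..<n} (\<lambda>_. lborel))"
  unfolding moebius_def
proof (rule borel_measurable_sum)
  fix J assume "J \<in> Pow {..<n}"
  then have "(\<lambda>x. F (point_sum J x)) \<in> borel_measurable (PiM {..<n} (\<lambda>_. lborel))"
    by (intro measurable_compose[OF measurable_point_sum F]) auto
  then show "(\<lambda>x. (-1) ^ n * ((-1) ^ card J * F (point_sum J x))) \<in> borel_measurable (PiM {..<n} (\<lambda>_. lborel))"
    by measurable
qed

text \<open>There are \<open>2 ^ n\<close> index sets, each contributing at most n, which is below
  \<open>2 ^ n\<close>; this is the origin of the base 4 in later bounds.\<close>

lemma moebius_bound:
  assumes F: "local_functional W F" and W: "W \<in> sets borel"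
  shows "\<bar>moebius F n x\<bar> \<le> 4 ^ n"
proof -
  have "\<bar>moebius F n x\<bar> \<le> (\<Sum>J\<in>Pow {..<n}. \<bar>(-1) ^ n * ((-1) ^ card J * F (point_sum J x))\<bar>)"
    unfolding moebius_def by (rule sum_abs)
  also have "\<dots> \<le> (\<Sum>J\<in>Pow {..<n}. real n)"
  proof (rule sum_mono)
    fix J assume J: "J \<in> Pow {..<n}"
    then have fin: "finite J" using finite_subset by auto
    have "\<bar>F (point_sum J x)\<bar> \<le> measure (point_sum J x) W"
      using F point_sum_counting[OF fin] by (auto simp: local_functional_def)
    also have "\<dots> = real (card {i \<in> J. x i \<in> W})"
      using fin W by (simp add: measure_def point_sum_def emeasure_distr_count_space)
    also have "\<dots> \<le> real n"
      using J fin card_mono[of "{..<n}" "{i \<in> J. x i \<in> W}"] by auto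
    finally show "\<bar>(-1) ^ n * ((-1) ^ card J * F (point_sum J x))\<bar> \<le> real n"
      by (simp add: abs_mult)
  qed
  also have "\<dots> = 2 ^ n * real n" by (simp add: card_Pow)
  also have "\<dots> \<le> 2 ^ n * 2 ^ n"
    using less_exp[of n] by (intro mult_left_mono) (auto simp flip: of_nat_le_iff)
  also have "\<dots> = 4 ^ n" by (simp flip: power_mult_distrib)
  finally show ?thesis .
qed

text \<open>Moebius inversion over the subsets of \<open>S\<close>, after which each subset is
  replaced by its n! orderings.\<close>

lemma moebius_expansion:
  assumes S: "finite S" and m: "card S \<le> m"
  shows "F (set_sum S) = (\<Sum>n\<le>m. (\<Sum>x\<in>inj_tuples n S. moebius F n x) / fact n)"
proof -
  define g where "g S = (\<Sum>T\<in>Pow S. (-1) ^ card T * F (set_sum T))" for S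
  have "F (set_sum S) = (\<Sum>T\<in>Pow S. (-1) ^ card T * g T)"
    by (rule inclusion_exclusion_symmetric[OF _ S]) (simp add: g_def)
  also have "\<dots> = (\<Sum>n\<le>m. (\<Sum>x\<in>inj_tuples n S. (-1) ^ card (x ` {..<n}) * g (x ` {..<n})) / fact n)"
    by (rule sum_Pow_eq_sum_inj_tuples[OF S m])
  also have "\<dots> = (\<Sum>n\<le>m. (\<Sum>x\<in>inj_tuples n S. moebius F n x) / fact n)"
  proof (intro sum.cong refl arg_cong2[where f="(/)"])
    fix n x assume "x \<in> inj_tuples n S"
    then have inj: "inj_on x {..<n}" by (simp add: inj_tuples_def)
    have injP: "inj_on ((`) x) (Pow {..<n})" using inj by (rule inj_on_image_Pow)
    have "g (x ` {..<n}) = (\<Sum>T\<in>(`) x ` Pow {..<n}. (-1) ^ card T * F (set_sum T))"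
      unfolding g_def by (simp add: image_Pow_surj)
    also have "\<dots> = (\<Sum>J\<in>Pow {..<n}. (-1) ^ card (x ` J) * F (set_sum (x ` J)))"
      by (rule sum.reindex_cong[OF injP refl refl])
    also have "\<dots> = (\<Sum>J\<in>Pow {..<n}. (-1) ^ card J * F (point_sum J x))"
    proof (rule sum.cong[OF refl])
      fix J assume J: "J \<in> Pow {..<n}"
      then have "inj_on x J" "finite J" using inj inj_on_subset finite_subset by blast+
      then show "(-1) ^ card (x ` J) * F (set_sum (x ` J)) = (-1) ^ card J * F (point_sum J x)"
        by (simp add: card_image point_sum_eq_set_sum)
    qed
    finally show "(-1) ^ card (x ` {..<n}) * g (x ` {..<n}) = moebius F n x"
      using inj by (simp add: moebius_def card_image sum_distrib_left)
  qed
  finally show ?thesis .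
qed

section \<open>Concatenation of tuples\<close>

definition glue :: "nat \<Rightarrow> nat \<Rightarrow> (nat \<Rightarrow> 'a) \<Rightarrow> (nat \<Rightarrow> 'a) \<Rightarrow> nat \<Rightarrow> 'a" where
  "glue p q x y = (\<lambda>i\<in>{..<p + q}. if i < p then x i else y (i - p))"

lemma restrict_glue: "x \<in> extensional {..<p} \<Longrightarrow> restrict (glue p q x y) {..<p} = x"
  by (auto simp: glue_def fun_eq_iff extensional_def)

lemma shift_glue: "y \<in> extensional {..<q} \<Longrightarrow> (\<lambda>i\<in>{..<q}. glue p q x y (p + i)) = y"
  by (auto simp: glue_def fun_eq_iff extensional_def)

lemma glue_restrict_shift:
  "z \<in> extensional {..<p + q} \<Longrightarrow> glue p q (restrict z {..<p}) (\<lambda>i\<in>{..<q}. z (p + i)) = z"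
  by (auto simp: glue_def fun_eq_iff extensional_def)

lemma measurable_glue:
  "(\<lambda>(x, y). glue p q x y) \<in> measurable
     (PiM {..<p} (\<lambda>_. lborel) \<Otimes>\<^sub>M PiM {..<q} (\<lambda>_. lborel)) (PiM {..<p + q} (\<lambda>_. lborel :: 'a::euclidean_space measure))"
proof -
  have "(\<lambda>z. \<lambda>i\<in>{..<p + q}. if i < p then fst z i else snd z (i - p)) \<in> measurable
     (PiM {..<p} (\<lambda>_. lborel) \<Otimes>\<^sub>M PiM {..<q} (\<lambda>_. lborel)) (PiM {..<p + q} (\<lambda>_. lborel :: 'a measure))"
  proof (rule measurable_restrict)
    fix i assume i: "i \<in> {..<p + q}"
    show "(\<lambda>z. if i < p then fst z i else snd z (i - p)) \<in> measurable
       (PiM {..<p} (\<lambda>_. lborel) \<Otimes>\<^sub>M PiM {..<q} (\<lambda>_. lborel)) (lborel :: 'a measure)"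
    proof (cases "i < p")
      case True
      then show ?thesis
        using measurable_compose[OF measurable_fst measurable_component_singleton[of i "{..<p}"]] by simp
    next
      case False
      then have "i - p \<in> {..<q}" using i by auto
      then show ?thesis
        using False measurable_compose[OF measurable_snd measurable_component_singleton[of "i - p" "{..<q}"]] by simp
    qed
  qed
  then show ?thesis by (simp add: glue_def case_prod_beta)
qed

lemma sigma_finite_lebesgue_tuples: "sigma_finite_measure (PiM {..<n::nat} (\<lambda>_. lborel :: 'a::euclidean_space measure))"
proof -
  interpret product_sigma_finite "\<lambda>_::nat. lborel :: 'a measure" by standard
  show ?thesis by (rule sigma_finite) simp
qed

text \<open>By uniqueness of product measures it is enough to look at boxes, whose preimages are
  products of a box in p and a box in q coordinates.\<close>

lemma distr_glue:
  "distr (PiM {..<p} (\<lambda>_. lborel) \<Otimes>\<^sub>M PiM {..<q} (\<lambda>_. lborel)) (PiM {..<p + q} (\<lambda>_. lborel)) (\<lambda>(x, y). glue p q x y)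
    = PiM {..<p + q} (\<lambda>_. lborel :: 'a::euclidean_space measure)"
proof -
  interpret product_sigma_finite "\<lambda>_::nat. lborel :: 'a measure" by standard
  interpret Q: sigma_finite_measure "PiM {..<q} (\<lambda>_. lborel :: 'a measure)"
    by (rule sigma_finite_lebesgue_tuples)
  show ?thesis
  proof (rule PiM_eqI)
    fix A :: "nat \<Rightarrow> 'a set" assume A: "\<And>i. i \<in> {..<p + q} \<Longrightarrow> A i \<in> sets lborel"
    let ?P = "PiM {..<p} (\<lambda>_. lborel :: 'a measure)" and ?Q = "PiM {..<q} (\<lambda>_. lborel :: 'a measure)"
    let ?A1 = "PiE {..<p} A" and ?A2 = "PiE {..<q} (\<lambda>i. A (p + i))"
    have sA: "PiE {..<p + q} A \<in> sets (PiM {..<p + q} (\<lambda>_. lborel))" using A by (intro sets_PiM_I_finite) auto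
    have "(\<lambda>(x, y). glue p q x y) -` PiE {..<p + q} A \<inter> space (?P \<Otimes>\<^sub>M ?Q) = ?A1 \<times> ?A2"
    proof (intro equalityI subsetI)
      fix z assume z: "z \<in> (\<lambda>(x, y). glue p q x y) -` PiE {..<p + q} A \<inter> space (?P \<Otimes>\<^sub>M ?Q)"
      obtain x y where xy: "z = (x, y)" by (cases z)
      have ext: "x \<in> extensional {..<p}" "y \<in> extensional {..<q}"
        using z xy by (auto simp: space_pair_measure space_PiM PiE_iff)
      have j: "glue p q x y i \<in> A i" if "i < p + q" for i using z xy that by (auto simp: PiE_iff)
      have "x i \<in> A i" if "i < p" for i using j[of i] that by (simp add: glue_def)
      moreover have "y i \<in> A (p + i)" if "i < q" for i using j[of "p + i"] that by (simp add: glue_def)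
      ultimately show "z \<in> ?A1 \<times> ?A2" using ext xy by (simp add: PiE_iff)
    next
      fix z assume "z \<in> ?A1 \<times> ?A2"
      then obtain x y where xy: "z = (x, y)" "x \<in> ?A1" "y \<in> ?A2" by auto
      have "glue p q x y i \<in> A i" if i: "i < p + q" for i
      proof (cases "i < p")
        case True
        then show ?thesis using xy i by (auto simp: glue_def PiE_iff)
      next
        case False
        then have "y (i - p) \<in> A (p + (i - p))" using PiE_mem[OF xy(3), of "i - p"] i by simp
        then show ?thesis using False i by (simp add: glue_def)
      qed
      then show "z \<in> (\<lambda>(x, y). glue p q x y) -` PiE {..<p + q} A \<inter> space (?P \<Otimes>\<^sub>M ?Q)"
        using xy by (auto simp: space_pair_measure space_PiM PiE_iff glue_def)
    qed
    then have "emeasure (distr (?P \<Otimes>\<^sub>M ?Q) (PiM {..<p + q} (\<lambda>_. lborel)) (\<lambda>(x, y). glue p q x y)) (PiE {..<p + q} A)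
        = emeasure (?P \<Otimes>\<^sub>M ?Q) (?A1 \<times> ?A2)"
      by (simp add: emeasure_distr[OF measurable_glue sA])
    also have "\<dots> = emeasure ?P ?A1 * emeasure ?Q ?A2"
      using A by (intro Q.emeasure_pair_measure_Times sets_PiM_I_finite) auto
    also have "\<dots> = (\<Prod>i<p. emeasure lborel (A i)) * (\<Prod>i<q. emeasure lborel (A (p + i)))"
      using A by (subst (1 2) emeasure_PiM) auto
    also have "\<dots> = (\<Prod>i<p + q. emeasure lborel (A i))"
    proof -
      have "{..<p + q} = {..<p} \<union> {p..<p + q}" by auto
      moreover have "(\<Prod>i\<in>{p..<p + q}. emeasure lborel (A i)) = (\<Prod>i<q. emeasure lborel (A (p + i)))"
        by (rule prod.reindex_bij_witness[of _ "\<lambda>i. p + i" "\<lambda>i. i - p"]) auto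
      ultimately show ?thesis by (simp add: prod.union_disjoint ivl_disj_int)
    qed
    finally show "emeasure (distr (?P \<Otimes>\<^sub>M ?Q) (PiM {..<p + q} (\<lambda>_. lborel)) (\<lambda>(x, y). glue p q x y)) (PiE {..<p + q} A)
        = (\<Prod>i\<in>{..<p + q}. emeasure lborel (A i))" .
  qed auto
qed

text \<open>Change of variables along \<open>glue\<close>, then Fubini. It writes the product of two
  expectations as one integral over tuples of length p + q, ready to be subtracted from the
  expectation of the product.\<close>

lemma integral_glue_product:
  fixes u v :: "(nat \<Rightarrow> 'a::euclidean_space) \<Rightarrow> real"
  assumes u: "integrable (PiM {..<p} (\<lambda>_. lborel)) u" and v: "integrable (PiM {..<q} (\<lambda>_. lborel)) v"
  shows "integrable (PiM {..<p + q} (\<lambda>_. lborel)) (\<lambda>z. u (restrict z {..<p}) * v (\<lambda>i\<in>{..<q}. z (p + i)))"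
      (is "integrable ?PQ ?w")
    and "(\<integral>z. u (restrict z {..<p}) * v (\<lambda>i\<in>{..<q}. z (p + i)) \<partial>PiM {..<p + q} (\<lambda>_. lborel))
      = (\<integral>x. u x \<partial>PiM {..<p} (\<lambda>_. lborel)) * (\<integral>y. v y \<partial>PiM {..<q} (\<lambda>_. lborel))"
proof -
  let ?P = "PiM {..<p} (\<lambda>_. lborel :: 'a measure)" and ?Q = "PiM {..<q} (\<lambda>_. lborel :: 'a measure)"
  interpret pair_sigma_finite ?P ?Q
    by (intro pair_sigma_finite.intro sigma_finite_lebesgue_tuples)
  note [measurable] = borel_measurable_integrable[OF u] borel_measurable_integrable[OF v]
  have uv: "integrable (?P \<Otimes>\<^sub>M ?Q) (\<lambda>(x, y). u x * v y)"
  proof (rule Fubini_integrable)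
    show "integrable ?P (\<lambda>x. \<integral>y. norm (case (x, y) of (x, y) \<Rightarrow> u x * v y) \<partial>?Q)"
      using u by (simp add: abs_mult)
    show "AE x in ?P. integrable ?Q (\<lambda>y. case (x, y) of (x, y) \<Rightarrow> u x * v y)"
      using v by simp
  qed measurable
  have rm: "(\<lambda>z. restrict z {..<p}) \<in> measurable ?PQ ?P"
    by (rule measurable_restrict_subset) auto
  have sm: "(\<lambda>z. \<lambda>i\<in>{..<q}. z (p + i)) \<in> measurable ?PQ ?Q"
    by (rule measurable_restrict) (rule measurable_component_singleton, simp)
  have wm: "?w \<in> borel_measurable ?PQ"
    using measurable_compose[OF rm borel_measurable_integrable[OF u]]
      measurable_compose[OF sm borel_measurable_integrable[OF v]] by measurable
  have w: "?w (glue p q (fst z) (snd z)) = (case z of (x, y) \<Rightarrow> u x * v y)" if "z \<in> space (?P \<Otimes>\<^sub>M ?Q)" for z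
  proof -
    have "fst z \<in> extensional {..<p}" "snd z \<in> extensional {..<q}"
      using that by (auto simp: space_pair_measure space_PiM PiE_iff)
    then show ?thesis by (simp add: restrict_glue shift_glue case_prod_beta)
  qed
  have "integrable (?P \<Otimes>\<^sub>M ?Q) (\<lambda>z. ?w (case z of (x, y) \<Rightarrow> glue p q x y))"
    using uv by (rule Bochner_Integration.integrable_cong[THEN iffD1, rotated -1]) (use w in \<open>simp_all add: case_prod_beta\<close>)
  then have "integrable (distr (?P \<Otimes>\<^sub>M ?Q) ?PQ (\<lambda>(x, y). glue p q x y)) ?w"
    by (subst integrable_distr_eq[OF measurable_glue wm]) (simp add: case_prod_beta)
  then show "integrable ?PQ ?w" by (simp only: distr_glue)
  have "integral\<^sup>L ?PQ ?w = integral\<^sup>L (distr (?P \<Otimes>\<^sub>M ?Q) ?PQ (\<lambda>(x, y). glue p q x y)) ?w"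
    by (simp only: distr_glue)
  also have "\<dots> = (\<integral>z. ?w (case z of (x, y) \<Rightarrow> glue p q x y) \<partial>(?P \<Otimes>\<^sub>M ?Q))"
    by (rule integral_distr[OF measurable_glue wm])
  also have "\<dots> = (\<integral>z. (case z of (x, y) \<Rightarrow> u x * v y) \<partial>(?P \<Otimes>\<^sub>M ?Q))"
    by (rule Bochner_Integration.integral_cong) (use w in \<open>simp_all add: case_prod_beta\<close>)
  also have "\<dots> = (\<integral>x. (\<integral>y. u x * v y \<partial>?Q) \<partial>?P)"
    using integral_fst'[OF uv] by simp
  also have "\<dots> = integral\<^sup>L ?P u * integral\<^sup>L ?Q v" by simp
  finally show "integral\<^sup>L ?PQ ?w = integral\<^sup>L ?P u * integral\<^sup>L ?Q v" .
qed

context correlated_process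
begin

section \<open>Covariances of tuple sums in two windows\<close>

definition window_moebius :: "'a set \<Rightarrow> ('a measure \<Rightarrow> real) \<Rightarrow> nat \<Rightarrow> (nat \<Rightarrow> 'a) \<Rightarrow> real" where
  "window_moebius W F n x = moebius F n x * indicator ({..<n} \<rightarrow>\<^sub>E W) x"

definition tuple_sum :: "'a set \<Rightarrow> ('a measure \<Rightarrow> real) \<Rightarrow> nat \<Rightarrow> 'w \<Rightarrow> real" where
  "tuple_sum W F n \<omega> = (\<Sum>x\<in>inj_tuples n (points (\<Phi> \<omega>) \<inter> W). window_moebius W F n x)"

lemma window_moebius_outside: "x \<notin> {..<n} \<rightarrow>\<^sub>E W \<Longrightarrow> window_moebius W F n x = 0"
  by (simp add: window_moebius_def)

lemma window_moebius_bound: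
  assumes "local_functional W F" "W \<in> sets borel"
  shows "\<bar>window_moebius W F n x\<bar> \<le> 4 ^ n"
  using moebius_bound[OF assms, of n x] by (auto simp: window_moebius_def indicator_def)

lemma window_moebius_measurable:
  assumes F: "local_functional W F" and W: "W \<in> sets borel"
  shows "window_moebius W F n \<in> borel_measurable (lebesgue_tuples n)"
proof -
  have "moebius F n \<in> borel_measurable (lebesgue_tuples n)"
    using F by (intro moebius_measurable) (simp add: local_functional_def)
  then show ?thesis
    unfolding window_moebius_def using sets_box[OF W, of n] by (intro borel_measurable_times) auto
qed

lemma tuple_sum_integral:
  assumes F: "local_functional W F" and W: "W \<in> sets borel" "bounded W"
  shows "integrable M (tuple_sum W F n)"
    and "integrable (lebesgue_tuples n) (\<lambda>x. \<rho> n x * window_moebius W F n x)"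
    and "(\<integral>\<omega>. tuple_sum W F n \<omega> \<partial>M) = (\<integral>x. \<rho> n x * window_moebius W F n x \<partial>lebesgue_tuples n)"
  using campbell_window[OF W window_moebius_measurable[OF F W(1)] window_moebius_bound[OF F W(1)]
      window_moebius_outside, of n]
  by (simp_all add: tuple_sum_def[abs_def])

lemma tuple_sum_bound:
  assumes F: "local_functional W F" and W: "W \<in> sets borel"
  shows "\<bar>tuple_sum W F n \<omega>\<bar> \<le> 4 ^ n * real (card (inj_tuples n (points (\<Phi> \<omega>) \<inter> W)))"
proof -
  have "\<bar>tuple_sum W F n \<omega>\<bar> \<le> (\<Sum>x\<in>inj_tuples n (points (\<Phi> \<omega>) \<inter> W). \<bar>window_moebius W F n x\<bar>)"
    unfolding tuple_sum_def by (rule sum_abs)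
  also have "\<dots> \<le> (\<Sum>x\<in>inj_tuples n (points (\<Phi> \<omega>) \<inter> W). 4 ^ n)"
    by (intro sum_mono window_moebius_bound F W)
  finally show ?thesis by (simp add: mult.commute)
qed

text \<open>The product of two transforms as a function of the concatenated tuple. The last factor
  confines the support to the box over \<open>W1 \<union> W2\<close>, the form demanded by
  \<open>campbell_window\<close>.\<close>

definition glued :: "'a set \<Rightarrow> ('a measure \<Rightarrow> real) \<Rightarrow> nat \<Rightarrow> 'a set \<Rightarrow> ('a measure \<Rightarrow> real) \<Rightarrow> nat \<Rightarrow> (nat \<Rightarrow> 'a) \<Rightarrow> real" where
  "glued W1 F p W2 G q z = window_moebius W1 F p (restrict z {..<p})
     * window_moebius W2 G q (\<lambda>i\<in>{..<q}. z (p + i)) * indicator ({..<p + q} \<rightarrow>\<^sub>E W1 \<union> W2) z"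

text \<open>As the windows are disjoint, two injective tuples concatenate to an injective one, so no
  diagonal terms arise; tuples in the union whose entries are placed differently contribute
  0.\<close>

lemma tuple_sum_product:
  assumes \<omega>: "\<omega> \<in> space M" and W: "bounded W1" "bounded W2" and disj: "W1 \<inter> W2 = {}"
  shows "tuple_sum W1 F p \<omega> * tuple_sum W2 G q \<omega>
    = (\<Sum>z\<in>inj_tuples (p + q) (points (\<Phi> \<omega>) \<inter> (W1 \<union> W2)). glued W1 F p W2 G q z)"
proof -
  let ?S1 = "points (\<Phi> \<omega>) \<inter> W1" and ?S2 = "points (\<Phi> \<omega>) \<inter> W2"
  let ?S = "points (\<Phi> \<omega>) \<inter> (W1 \<union> W2)"
  have fin: "finite ?S1" "finite ?S2" "finite ?S"
    using finite_window[OF \<omega>] W bounded_Un[of W1 W2] by auto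
  define A where "A = {z \<in> inj_tuples (p + q) ?S. (\<forall>i<p. z i \<in> ?S1) \<and> (\<forall>i<q. z (p + i) \<in> ?S2)}"
  have "tuple_sum W1 F p \<omega> * tuple_sum W2 G q \<omega>
      = (\<Sum>(x, y)\<in>inj_tuples p ?S1 \<times> inj_tuples q ?S2. window_moebius W1 F p x * window_moebius W2 G q y)"
    by (simp add: tuple_sum_def sum_product sum.cartesian_product)
  also have "\<dots> = (\<Sum>z\<in>A. glued W1 F p W2 G q z)"
  proof (rule sum.reindex_bij_witness[of _ "\<lambda>z. (restrict z {..<p}, \<lambda>i\<in>{..<q}. z (p + i))" "\<lambda>(x, y). glue p q x y"])
    fix z assume z: "z \<in> A"
    then show "(\<lambda>(x, y). glue p q x y) (restrict z {..<p}, \<lambda>i\<in>{..<q}. z (p + i)) = z"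
      by (simp add: glue_restrict_shift A_def inj_tuples_def PiE_iff)
    show "(restrict z {..<p}, \<lambda>i\<in>{..<q}. z (p + i)) \<in> inj_tuples p ?S1 \<times> inj_tuples q ?S2"
    proof -
      have inj: "inj_on z {..<p + q}" using z by (simp add: A_def inj_tuples_def)
      have "inj_on (\<lambda>i\<in>{..<q}. z (p + i)) {..<q}"
      proof (rule inj_onI)
        fix i j assume "i \<in> {..<q}" "j \<in> {..<q}"
          "(\<lambda>i\<in>{..<q}. z (p + i)) i = (\<lambda>i\<in>{..<q}. z (p + i)) j"
        then show "i = j" using inj_onD[OF inj, of "p + i" "p + j"] by simp
      qed
      moreover have "inj_on (restrict z {..<p}) {..<p}"
        using inj_on_subset[OF inj, of "{..<p}"] by (simp add: inj_on_restrict_eq)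
      ultimately show ?thesis using z by (simp add: A_def inj_tuples_def PiE_iff)
    qed
  next
    fix a assume a: "a \<in> inj_tuples p ?S1 \<times> inj_tuples q ?S2"
    then obtain x y where xy: "a = (x, y)" "x \<in> inj_tuples p ?S1" "y \<in> inj_tuples q ?S2" by auto
    have ext: "x \<in> extensional {..<p}" "y \<in> extensional {..<q}"
      and xS: "\<And>i. i < p \<Longrightarrow> x i \<in> ?S1" and yS: "\<And>i. i < q \<Longrightarrow> y i \<in> ?S2"
      and inj: "inj_on x {..<p}" "inj_on y {..<q}"
      using xy by (auto simp: inj_tuples_def PiE_iff)
    let ?z = "glue p q x y"
    have z1: "?z i = x i" if "i < p" for i using that by (simp add: glue_def)
    have z2: "?z i = y (i - p)" if "p \<le> i" "i < p + q" for i using that by (simp add: glue_def)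
    have cross: "?z i \<noteq> ?z j" if "i < p" "p \<le> j" "j < p + q" for i j
      using z1[OF that(1)] z2[OF that(2,3)] xS[of i] yS[of "j - p"] that disj by auto
    have "inj_on ?z {..<p + q}"
    proof (rule inj_onI)
      fix i j assume ij: "i \<in> {..<p + q}" "j \<in> {..<p + q}" "?z i = ?z j"
      consider "i < p" "j < p" | "p \<le> i" "p \<le> j" | "i < p" "p \<le> j" | "p \<le> i" "j < p" by linarith
      then show "i = j"
      proof cases
        case 1
        then show ?thesis using ij z1 inj(1) by (auto simp: inj_on_def)
      next
        case 2
        then have "y (i - p) = y (j - p)" using ij z2 by auto
        moreover have "i - p < q" "j - p < q" using ij 2 by auto
        ultimately have "i - p = j - p" using inj(2) by (auto simp: inj_on_def)
        then show ?thesis using 2 by simp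
      qed (use ij cross[of i j] cross[of j i] in auto)
    qed
    moreover have zS: "?z i \<in> ?S" if "i < p + q" for i
      using z1[of i] z2[of i] xS[of i] yS[of "i - p"] that by (cases "i < p") auto
    moreover have "?z \<in> extensional {..<p + q}" by (simp add: glue_def)
    ultimately have zA: "?z \<in> A"
      using xS yS by (auto simp: A_def inj_tuples_def PiE_iff z1 z2)
    then show "(case a of (x, y) \<Rightarrow> glue p q x y) \<in> A" using xy by simp
    show "(restrict (case a of (x, y) \<Rightarrow> glue p q x y) {..<p},
        \<lambda>i\<in>{..<q}. (case a of (x, y) \<Rightarrow> glue p q x y) (p + i)) = a"
      using xy ext by (simp add: restrict_glue shift_glue)
    have "?z \<in> {..<p + q} \<rightarrow>\<^sub>E W1 \<union> W2"
      using zA by (auto simp: A_def inj_tuples_def PiE_iff)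
    then show "glued W1 F p W2 G q (case a of (x, y) \<Rightarrow> glue p q x y)
        = (case a of (x, y) \<Rightarrow> window_moebius W1 F p x * window_moebius W2 G q y)"
      using xy ext by (simp add: glued_def restrict_glue shift_glue)
  qed
  also have "\<dots> = (\<Sum>z\<in>inj_tuples (p + q) ?S. glued W1 F p W2 G q z)"
  proof (rule sum.mono_neutral_left)
    show "\<forall>z\<in>inj_tuples (p + q) ?S - A. glued W1 F p W2 G q z = 0"
    proof
      fix z assume z: "z \<in> inj_tuples (p + q) ?S - A"
      then have zS: "z i \<in> points (\<Phi> \<omega>)" if "i < p + q" for i using that by (auto simp: inj_tuples_def PiE_iff)
      from z consider i where "i < p" "z i \<notin> ?S1" | i where "i < q" "z (p + i) \<notin> ?S2" by (auto simp: A_def)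
      then show "glued W1 F p W2 G q z = 0"
      proof cases
        case 1
        then have "restrict z {..<p} \<notin> {..<p} \<rightarrow>\<^sub>E W1" using zS[of i] by (auto simp: PiE_iff)
        then show ?thesis by (simp add: glued_def window_moebius_outside)
      next
        case 2
        then have "(\<lambda>i\<in>{..<q}. z (p + i)) \<notin> {..<q} \<rightarrow>\<^sub>E W2" using zS[of "p + i"] by (auto simp: PiE_iff)
        then show ?thesis by (simp add: glued_def window_moebius_outside)
      qed
    qed
  qed (use fin in \<open>auto simp: A_def\<close>)
  finally show ?thesis .
qed

text \<open>Campbell's formula turns the covariance into an integral of
  \<open>\<rho> (p + q)\<close> minus the product of \<open>\<rho> p\<close> and
  \<open>\<rho> q\<close>, against a function bounded by \<open>4 ^ (p + q)\<close> and over a set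
  of measure at most \<open>V ^ (p + q)\<close>. There the two parts of the tuple are at distance at
  least \<open>D\<close>.\<close>

lemma covariance_tuple_sum:
  assumes F: "local_functional W1 F" and G: "local_functional W2 G"
    and W1: "W1 \<in> sets borel" "bounded W1" and W2: "W2 \<in> sets borel" "bounded W2"
    and V: "measure lborel W1 \<le> V" "measure lborel W2 \<le> V"
    and disj: "W1 \<inter> W2 = {}" and D: "0 \<le> D" "\<And>x y. x \<in> W1 \<Longrightarrow> y \<in> W2 \<Longrightarrow> D \<le> dist x y"
    and d: "0 \<le> d" "\<And>s. D \<le> s \<Longrightarrow> \<delta> s \<le> d"
  shows "integrable M (\<lambda>\<omega>. tuple_sum W1 F p \<omega> * tuple_sum W2 G q \<omega>)"
    and "\<bar>(\<integral>\<omega>. tuple_sum W1 F p \<omega> * tuple_sum W2 G q \<omega> \<partial>M)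
      - (\<integral>\<omega>. tuple_sum W1 F p \<omega> \<partial>M) * (\<integral>\<omega>. tuple_sum W2 G q \<omega> \<partial>M)\<bar>
      \<le> (4 * V) ^ (p + q) * \<bar>C (p + q)\<bar> * d"
proof -
  let ?W = "W1 \<union> W2" and ?P = "lebesgue_tuples (p + q)"
  have W: "?W \<in> sets borel" "bounded ?W" using W1 W2 by auto
  let ?f = "glued W1 F p W2 G q"
  have rm: "(\<lambda>z. restrict z {..<p}) \<in> measurable ?P (lebesgue_tuples p)"
    by (rule measurable_restrict_subset) auto
  have sm: "(\<lambda>z. \<lambda>i\<in>{..<q}. z (p + i)) \<in> measurable ?P (lebesgue_tuples q)"
    by (rule measurable_restrict) (rule measurable_component_singleton, simp)
  have fm: "?f \<in> borel_measurable ?P"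
    unfolding glued_def
    using measurable_compose[OF rm window_moebius_measurable[OF F W1(1)]]
      measurable_compose[OF sm window_moebius_measurable[OF G W2(1)]] sets_box[OF W(1), of "p + q"]
    by (intro borel_measurable_times) auto
  have hb: "\<bar>window_moebius W1 F p x * window_moebius W2 G q y\<bar> \<le> 4 ^ (p + q)" for x y
    unfolding abs_mult power_add
    by (intro mult_mono window_moebius_bound F G W1 W2) auto
  have fb: "\<bar>?f z\<bar> \<le> 4 ^ (p + q)" for z
    using hb[of "restrict z {..<p}" "\<lambda>i\<in>{..<q}. z (p + i)"] by (auto simp: glued_def indicator_def)
  have fs: "?f z = 0" if "z \<notin> {..<p + q} \<rightarrow>\<^sub>E ?W" for z using that by (simp add: glued_def)
  have cw: "integrable M (\<lambda>\<omega>. \<Sum>z\<in>inj_tuples (p + q) (points (\<Phi> \<omega>) \<inter> ?W). ?f z)"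
    "integrable ?P (\<lambda>z. \<rho> (p + q) z * ?f z)"
    "(\<integral>\<omega>. (\<Sum>z\<in>inj_tuples (p + q) (points (\<Phi> \<omega>) \<inter> ?W). ?f z) \<partial>M) = (\<integral>z. \<rho> (p + q) z * ?f z \<partial>?P)"
    by (rule campbell_window[OF W fm fb]; erule fs)+
  have int: "integrable M (\<lambda>\<omega>. tuple_sum W1 F p \<omega> * tuple_sum W2 G q \<omega>)
      \<longleftrightarrow> integrable M (\<lambda>\<omega>. \<Sum>z\<in>inj_tuples (p + q) (points (\<Phi> \<omega>) \<inter> ?W). ?f z)"
    by (intro Bochner_Integration.integrable_cong refl) (rule tuple_sum_product[OF _ W1(2) W2(2) disj])
  show "integrable M (\<lambda>\<omega>. tuple_sum W1 F p \<omega> * tuple_sum W2 G q \<omega>)"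
    unfolding int by (rule cw(1))
  have E: "(\<integral>\<omega>. tuple_sum W1 F p \<omega> * tuple_sum W2 G q \<omega> \<partial>M) = (\<integral>z. \<rho> (p + q) z * ?f z \<partial>?P)"
    unfolding cw(3)[symmetric]
    by (intro Bochner_Integration.integral_cong refl) (rule tuple_sum_product[OF _ W1(2) W2(2) disj])
  have V0: "0 \<le> V" using V(1) measure_nonneg[of lborel W1] by linarith
  have rhs0: "0 \<le> (4 * V) ^ (p + q) * \<bar>C (p + q)\<bar> * d" using V0 d by simp
  \<comment> \<open>The decay inequality speaks of nonempty tuples; a sum over empty tuples is
    constant, so its covariances vanish.\<close>
  consider "p = 0" | "q = 0" | "p \<ge> 1" "q \<ge> 1" by linarith
  then show "\<bar>(\<integral>\<omega>. tuple_sum W1 F p \<omega> * tuple_sum W2 G q \<omega> \<partial>M)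
      - (\<integral>\<omega>. tuple_sum W1 F p \<omega> \<partial>M) * (\<integral>\<omega>. tuple_sum W2 G q \<omega> \<partial>M)\<bar>
      \<le> (4 * V) ^ (p + q) * \<bar>C (p + q)\<bar> * d"
  proof cases
    case 1
    then show ?thesis using rhs0 by (simp add: tuple_sum_def prob_space)
  next
    case 2
    then show ?thesis using rhs0 by (simp add: tuple_sum_def prob_space)
  next
    case 3
    let ?u = "\<lambda>x. \<rho> p x * window_moebius W1 F p x" and ?v = "\<lambda>y. \<rho> q y * window_moebius W2 G q y"
    let ?b = "\<lambda>z. ?u (restrict z {..<p}) * ?v (\<lambda>i\<in>{..<q}. z (p + i))"
    note ts1 = tuple_sum_integral[OF F W1, of p] and ts2 = tuple_sum_integral[OF G W2, of q]
    note gp = integral_glue_product[OF ts1(2) ts2(2)]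
    \<comment> \<open>The first \<open>p\<close> entries lie in \<open>W1\<close>, the others in
      \<open>W2\<close>; outside this box both integrands vanish.\<close>
    define B where "B = PiE {..<p + q} (\<lambda>i. if i < p then W1 else W2)"
    have Bm: "B \<in> sets ?P" unfolding B_def using W1 W2 by (intro sets_PiM_I_finite) auto
    define c where "c = 4 ^ (p + q) * (\<bar>C (p + q)\<bar> * d)"
    have c0: "c \<ge> 0" using d by (simp add: c_def)
    have emB: "emeasure ?P B \<le> ennreal (V ^ (p + q))"
    proof -
      interpret product_sigma_finite "\<lambda>_::nat. lborel :: 'a measure" by standard
      have em: "emeasure lborel X = ennreal (measure lborel X)" if "X \<in> sets borel" "bounded X" for X :: "'a set"
        using emeasure_bounded_finite[OF that(2)] by (intro emeasure_eq_ennreal_measure) auto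
      have "emeasure ?P B = (\<Prod>i<p + q. emeasure lborel (if i < p then W1 else W2))"
        unfolding B_def using W1 W2 by (subst emeasure_PiM) auto
      also have "\<dots> = (\<Prod>i<p + q. ennreal (measure lborel (if i < p then W1 else W2)))"
        using em W1 W2 by (intro prod.cong refl) auto
      also have "\<dots> = ennreal (\<Prod>i<p + q. measure lborel (if i < p then W1 else W2))"
        by (rule prod_ennreal) simp
      also have "\<dots> \<le> ennreal (\<Prod>i<p + q. V)"
        using V by (intro ennreal_leI prod_mono) auto
      finally show ?thesis by simp
    qed
    have intB: "integrable ?P (\<lambda>z. c * indicator B z)"
      using Bm emB by (intro integrable_mult_right integrable_real_indicator) (auto intro: le_less_trans)
    have mB: "measure ?P B \<le> V ^ (p + q)"
      using emB V0 by (simp add: measure_def enn2real_leI)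
    have pt: "\<bar>\<rho> (p + q) z * ?f z - ?b z\<bar> \<le> c * indicator B z" if z: "z \<in> space ?P" for z
    proof (cases "z \<in> B")
      case False
      have "window_moebius W1 F p (restrict z {..<p}) = 0 \<or> window_moebius W2 G q (\<lambda>i\<in>{..<q}. z (p + i)) = 0"
      proof (rule ccontr)
        assume "\<not> ?thesis"
        then have m: "restrict z {..<p} \<in> {..<p} \<rightarrow>\<^sub>E W1" "(\<lambda>i\<in>{..<q}. z (p + i)) \<in> {..<q} \<rightarrow>\<^sub>E W2"
          using window_moebius_outside[of "restrict z {..<p}" p W1 F]
            window_moebius_outside[of "\<lambda>i\<in>{..<q}. z (p + i)" q W2 G] by blast+
        have "z i \<in> (if i < p then W1 else W2)" if "i < p + q" for i
        proof (cases "i < p")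
          case True
          then show ?thesis using PiE_mem[OF m(1), of i] by simp
        next
          case False
          then show ?thesis using PiE_mem[OF m(2), of "i - p"] that by simp
        qed
        then have "z \<in> B" using z by (auto simp: B_def space_PiM PiE_iff)
        then show False using False by simp
      qed
      then show ?thesis using False by (auto simp: glued_def)
    next
      case True
      then have zB: "z i \<in> (if i < p then W1 else W2)" if "i < p + q" for i
        using that by (auto simp: B_def PiE_iff)
      have z1: "z i \<in> W1" if "i < p" for i using zB[of i] that by simp
      have z2: "z i \<in> W2" if "p \<le> i" "i < p + q" for i using zB[of i] that by simp
      have ext: "restrict z {..<p + q} = z" using z by (auto simp: space_PiM)
      have inW: "z \<in> {..<p + q} \<rightarrow>\<^sub>E ?W"
      proof -
        have "z i \<in> ?W" if "i < p + q" for i using zB[OF that] by (auto split: if_splits)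
        then show ?thesis using z by (auto simp: space_PiM PiE_iff)
      qed
      let ?s = "setdist (z ` {..<p}) (z ` {p..<p + q})"
      have s: "D \<le> ?s"
        using 3 by (intro le_setdistI) (auto simp: lessThan_empty_iff intro!: D(2) z1 z2)
      have "\<bar>\<rho> (p + q) z - \<rho> p (restrict z {..<p}) * \<rho> q (\<lambda>i\<in>{..<q}. z (p + i))\<bar> \<le> C (p + q) * \<delta> ?s"
        using decay[OF 3, of z] ext by simp
      also have "\<dots> \<le> \<bar>C (p + q)\<bar> * \<delta> ?s"
        using delta_nonneg[of ?s] s D(1) by (intro mult_right_mono) auto
      also have "\<dots> \<le> \<bar>C (p + q)\<bar> * d" using d(2)[OF s] by (intro mult_left_mono) auto
      finally have dec: "\<bar>\<rho> (p + q) z - \<rho> p (restrict z {..<p}) * \<rho> q (\<lambda>i\<in>{..<q}. z (p + i))\<bar>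
          \<le> \<bar>C (p + q)\<bar> * d" .
      have "\<rho> (p + q) z * ?f z - ?b z
          = (\<rho> (p + q) z - \<rho> p (restrict z {..<p}) * \<rho> q (\<lambda>i\<in>{..<q}. z (p + i)))
            * (window_moebius W1 F p (restrict z {..<p}) * window_moebius W2 G q (\<lambda>i\<in>{..<q}. z (p + i)))"
        using inW by (simp add: glued_def algebra_simps)
      also have "\<bar>\<dots>\<bar> \<le> \<bar>C (p + q)\<bar> * d * 4 ^ (p + q)"
        unfolding abs_mult[of "_ - _"] using dec hb d(1) by (intro mult_mono) auto
      finally show ?thesis using True by (simp add: c_def mult_ac)
    qed
    define w where "w z = \<rho> (p + q) z * ?f z - ?b z" for z
    have wi: "integrable ?P w"
      unfolding w_def by (rule Bochner_Integration.integrable_diff[OF cw(2) gp(1)])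
    have diff: "(\<integral>\<omega>. tuple_sum W1 F p \<omega> * tuple_sum W2 G q \<omega> \<partial>M)
        - (\<integral>\<omega>. tuple_sum W1 F p \<omega> \<partial>M) * (\<integral>\<omega>. tuple_sum W2 G q \<omega> \<partial>M) = integral\<^sup>L ?P w"
      unfolding E ts1(3) ts2(3) gp(2)[symmetric] w_def
      by (rule Bochner_Integration.integral_diff[OF cw(2) gp(1), symmetric])
    have "\<bar>integral\<^sup>L ?P w\<bar> \<le> (\<integral>z. \<bar>w z\<bar> \<partial>?P)"
      by (rule integral_abs_bound)
    also have "\<dots> \<le> (\<integral>z. c * indicator B z \<partial>?P)"
      by (rule integral_mono[OF integrable_abs[OF wi] intB]) (simp add: w_def pt)
    also have "\<dots> = c * measure ?P B" using Bm by simp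
    also have "\<dots> \<le> c * V ^ (p + q)" using mB c0 by (rule mult_left_mono)
    also have "\<dots> = (4 * V) ^ (p + q) * \<bar>C (p + q)\<bar> * d" by (simp add: c_def power_mult_distrib mult_ac)
    finally have "\<bar>integral\<^sup>L ?P w\<bar> \<le> (4 * V) ^ (p + q) * \<bar>C (p + q)\<bar> * d" .
    then show ?thesis by (simp only: diff)
  qed
qed

section \<open>Truncated expansions and the mixing bound\<close>

lemma functional_eq_set_sum:
  assumes \<omega>: "\<omega> \<in> space M" and F: "local_functional W F" and W: "bounded W"
  shows "F (\<Phi> \<omega>) = F (set_sum (points (\<Phi> \<omega>) \<inter> W))"
proof -
  have fin: "finite (points (\<Phi> \<omega>) \<inter> W)" using finite_window[OF \<omega> W] .
  have "agree W (\<Phi> \<omega>) (set_sum (points (\<Phi> \<omega>) \<inter> W))"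
    unfolding agree_def
  proof
    fix x assume x: "x \<in> W"
    have "{i \<in> points (\<Phi> \<omega>) \<inter> W. i \<in> {x}} = (if x \<in> points (\<Phi> \<omega>) then {x} else {})" using x by auto
    then have "emeasure (set_sum (points (\<Phi> \<omega>) \<inter> W)) {x} = indicator (points (\<Phi> \<omega>)) x"
      using emeasure_distr_count_space[OF fin, of "{x}" "\<lambda>x. x"] by (simp add: set_sum_def)
    then show "emeasure (\<Phi> \<omega>) {x} = emeasure (set_sum (points (\<Phi> \<omega>) \<inter> W)) {x}"
      using simple_points[OF counting[OF \<omega>] simple[OF \<omega>]] by simp
  qed
  then show ?thesis
    using F counting[OF \<omega>] set_sum_counting[OF fin] by (auto simp: local_functional_def)
qed

lemma functional_measurable:
  "local_functional W F \<Longrightarrow> (\<lambda>\<omega>. F (\<Phi> \<omega>)) \<in> borel_measurable M"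
  unfolding local_functional_def by (auto intro: measurable_compose[OF measurable_process])

lemma real_le_exponential: "real k \<le> 5 ^ k" "(real k)\<^sup>2 \<le> 5 ^ k"
proof -
  have k: "real k \<le> 2 ^ k" using less_exp[of k] by (simp flip: of_nat_le_iff)
  have "(2::real) ^ k \<le> 5 ^ k" "(4::real) ^ k \<le> 5 ^ k" by (rule power_mono; simp)+
  moreover have "(real k)\<^sup>2 \<le> (2 ^ k)\<^sup>2" using k by (intro power_mono) auto
  moreover have "((2::real) ^ k)\<^sup>2 = 4 ^ k" by (simp add: power2_eq_square flip: power_mult_distrib)
  ultimately show "real k \<le> 5 ^ k" "(real k)\<^sup>2 \<le> 5 ^ k" using k by linarith+
qed

lemma functional_bound:
  assumes "\<omega> \<in> space M" "local_functional W F" "W \<in> sets borel" "bounded W"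
  shows "\<bar>F (\<Phi> \<omega>)\<bar> \<le> real (card (points (\<Phi> \<omega>) \<inter> W))"
proof -
  have "\<bar>F (\<Phi> \<omega>)\<bar> \<le> measure (\<Phi> \<omega>) W"
    using assms(2) counting[OF assms(1)] by (simp add: local_functional_def)
  then show ?thesis using measure_eq_card[OF assms(1,3,4)] by simp
qed

lemma functional_integrable:
  assumes F: "local_functional W F" and W: "W \<in> sets borel" "bounded W"
  shows "integrable M (\<lambda>\<omega>. F (\<Phi> \<omega>))" and "integrable M (\<lambda>\<omega>. (F (\<Phi> \<omega>))\<^sup>2)"
proof -
  have e: "integrable M (\<lambda>\<omega>. 5 ^ card (points (\<Phi> \<omega>) \<inter> W) :: real)"
    by (rule integrable_exponential_moment[OF W]) simp
  note [measurable] = functional_measurable[OF F]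
  have b: "\<bar>F (\<Phi> \<omega>)\<bar> \<le> 5 ^ card (points (\<Phi> \<omega>) \<inter> W)" "(F (\<Phi> \<omega>))\<^sup>2 \<le> 5 ^ card (points (\<Phi> \<omega>) \<inter> W)"
    if "\<omega> \<in> space M" for \<omega>
  proof -
    note fb = functional_bound[OF that F W]
    show "\<bar>F (\<Phi> \<omega>)\<bar> \<le> 5 ^ card (points (\<Phi> \<omega>) \<inter> W)"
      using fb real_le_exponential(1) by (rule order_trans)
    have "(F (\<Phi> \<omega>))\<^sup>2 \<le> (real (card (points (\<Phi> \<omega>) \<inter> W)))\<^sup>2"
      using power_mono[OF fb, of 2] by simp
    then show "(F (\<Phi> \<omega>))\<^sup>2 \<le> 5 ^ card (points (\<Phi> \<omega>) \<inter> W)"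
      using real_le_exponential(2) by (rule order_trans)
  qed
  show "integrable M (\<lambda>\<omega>. F (\<Phi> \<omega>))"
    by (rule Bochner_Integration.integrable_bound[OF e]) (use b(1) in \<open>auto intro!: AE_I2\<close>)
  show "integrable M (\<lambda>\<omega>. (F (\<Phi> \<omega>))\<^sup>2)"
    by (rule Bochner_Integration.integrable_bound[OF e]) (use b(2) in \<open>auto intro!: AE_I2\<close>)
qed

text \<open>For a fixed sample only finitely many terms are nonzero; the partial sums are constant
  from the number of points in \<open>W\<close> on.\<close>

lemma partial_sums_tendsto:
  assumes \<omega>: "\<omega> \<in> space M" and F: "local_functional W F" and W: "W \<in> sets borel" "bounded W"
  shows "(\<lambda>m. \<Sum>n\<le>m. tuple_sum W F n \<omega> / fact n) \<longlonglongrightarrow> F (\<Phi> \<omega>)"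
proof (rule tendsto_eventually)
  let ?S = "points (\<Phi> \<omega>) \<inter> W"
  have fin: "finite ?S" using finite_window[OF \<omega> W(2)] .
  have "(\<Sum>n\<le>m. tuple_sum W F n \<omega> / fact n) = F (\<Phi> \<omega>)" if "card ?S \<le> m" for m
  proof -
    have "tuple_sum W F n \<omega> = (\<Sum>x\<in>inj_tuples n ?S. moebius F n x)" for n
      unfolding tuple_sum_def
      by (intro sum.cong refl) (auto simp: window_moebius_def inj_tuples_def PiE_iff indicator_def)
    then show ?thesis
      using moebius_expansion[OF fin that, of F] functional_eq_set_sum[OF \<omega> F W(2)] by simp
  qed
  then show "\<forall>\<^sub>F m in sequentially. (\<Sum>n\<le>m. tuple_sum W F n \<omega> / fact n) = F (\<Phi> \<omega>)"
    by (auto simp: eventually_sequentially)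
qed

text \<open>The terms are bounded by \<open>4 ^ n / fact n\<close> times tuple counts, which sum to
  \<open>(1 + 4) ^ N\<close> for N points. The bound does not depend on the truncation and is
  integrable, whence the base 5.\<close>

lemma partial_sums_bound:
  assumes \<omega>: "\<omega> \<in> space M" and F: "local_functional W F" and W: "W \<in> sets borel" "bounded W"
  shows "\<bar>\<Sum>n\<le>m. tuple_sum W F n \<omega> / fact n\<bar> \<le> 5 ^ card (points (\<Phi> \<omega>) \<inter> W)"
proof -
  let ?S = "points (\<Phi> \<omega>) \<inter> W"
  have fin: "finite ?S" using finite_window[OF \<omega> W(2)] .
  have "\<bar>\<Sum>n\<le>m. tuple_sum W F n \<omega> / fact n\<bar> \<le> (\<Sum>n\<le>m. \<bar>tuple_sum W F n \<omega> / fact n\<bar>)" by (rule sum_abs)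
  also have "\<dots> \<le> (\<Sum>n\<le>m. 4 ^ n / fact n * real (card (inj_tuples n ?S)))"
    using tuple_sum_bound[OF F W(1), of _ \<omega>]
    by (intro sum_mono) (simp add: abs_divide divide_right_mono)
  also have "\<dots> \<le> (\<Sum>n\<le>max m (card ?S). 4 ^ n / fact n * real (card (inj_tuples n ?S)))"
    by (intro sum_mono2) auto
  also have "\<dots> = (1 + 4) ^ card ?S" by (rule sum_card_inj_tuples[OF fin, symmetric]) simp
  finally show ?thesis by simp
qed

text \<open>The expansions of \<open>F\<close> and \<open>G\<close> are truncated, so that only finite sums are interchanged with
  expectations, and the truncation is removed by dominated convergence.\<close>

theorem mixing:
  assumes V: "V > 0"
  obtains A where "A \<ge> 0" "\<And>W1 W2 F G D d. local_functional W1 F \<Longrightarrow> local_functional W2 G \<Longrightarrow>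
    W1 \<in> sets borel \<Longrightarrow> bounded W1 \<Longrightarrow> W2 \<in> sets borel \<Longrightarrow> bounded W2 \<Longrightarrow>
    measure lborel W1 \<le> V \<Longrightarrow> measure lborel W2 \<le> V \<Longrightarrow> W1 \<inter> W2 = {} \<Longrightarrow> 0 \<le> D \<Longrightarrow>
    (\<And>x y. x \<in> W1 \<Longrightarrow> y \<in> W2 \<Longrightarrow> D \<le> dist x y) \<Longrightarrow> 0 \<le> d \<Longrightarrow> (\<And>s. D \<le> s \<Longrightarrow> \<delta> s \<le> d) \<Longrightarrow>
    \<bar>(\<integral>\<omega>. F (\<Phi> \<omega>) * G (\<Phi> \<omega>) \<partial>M) - (\<integral>\<omega>. F (\<Phi> \<omega>) \<partial>M) * (\<integral>\<omega>. G (\<Phi> \<omega>) \<partial>M)\<bar> \<le> A * d"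
proof -
  obtain A0 where A0: "A0 \<ge> 0" "\<And>p q. \<bar>C (p + q)\<bar> * (4 * V) ^ (p + q) \<le> A0 * fact p * fact q / 2 ^ (p + q)"
    using growth_pair_bound[OF growth a_less_1, of "4 * V"] V by auto
  have "\<bar>(\<integral>\<omega>. F (\<Phi> \<omega>) * G (\<Phi> \<omega>) \<partial>M) - (\<integral>\<omega>. F (\<Phi> \<omega>) \<partial>M) * (\<integral>\<omega>. G (\<Phi> \<omega>) \<partial>M)\<bar> \<le> 4 * A0 * d"
    if F: "local_functional W1 F" and G: "local_functional W2 G"
      and W1: "W1 \<in> sets borel" "bounded W1" and W2: "W2 \<in> sets borel" "bounded W2"
      and Vm: "measure lborel W1 \<le> V" "measure lborel W2 \<le> V"
      and disj: "W1 \<inter> W2 = {}" and D: "0 \<le> D" "\<And>x y. x \<in> W1 \<Longrightarrow> y \<in> W2 \<Longrightarrow> D \<le> dist x y"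
      and d: "0 \<le> d" "\<And>s. D \<le> s \<Longrightarrow> \<delta> s \<le> d" for W1 W2 F G D d
  proof -
    note cov = covariance_tuple_sum[OF F G W1 W2 Vm disj D d]
    let ?X = "\<lambda>m \<omega>. \<Sum>p\<le>m. tuple_sum W1 F p \<omega> / fact p" and ?Y = "\<lambda>m \<omega>. \<Sum>q\<le>m. tuple_sum W2 G q \<omega> / fact q"
    let ?c = "\<lambda>p q. (\<integral>\<omega>. tuple_sum W1 F p \<omega> * tuple_sum W2 G q \<omega> \<partial>M)
      - (\<integral>\<omega>. tuple_sum W1 F p \<omega> \<partial>M) * (\<integral>\<omega>. tuple_sum W2 G q \<omega> \<partial>M)"
    note t1 = tuple_sum_integral(1)[OF F W1] and t2 = tuple_sum_integral(1)[OF G W2]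
    have iX: "integrable M (?X m)" and iY: "integrable M (?Y m)" for m
      using t1 t2 by (auto intro!: Bochner_Integration.integrable_sum integrable_divide)
    have XY: "?X m \<omega> * ?Y m \<omega> = (\<Sum>p\<le>m. \<Sum>q\<le>m. tuple_sum W1 F p \<omega> * tuple_sum W2 G q \<omega> / (fact p * fact q))" for m \<omega>
      by (simp add: sum_product)
    have iXY: "integrable M (\<lambda>\<omega>. ?X m \<omega> * ?Y m \<omega>)" for m
      unfolding XY by (intro Bochner_Integration.integrable_sum integrable_divide cov)
    have eX: "integral\<^sup>L M (?X m) = (\<Sum>p\<le>m. (\<integral>\<omega>. tuple_sum W1 F p \<omega> \<partial>M) / fact p)"
      and eY: "integral\<^sup>L M (?Y m) = (\<Sum>q\<le>m. (\<integral>\<omega>. tuple_sum W2 G q \<omega> \<partial>M) / fact q)" for m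
      using t1 t2 by (simp_all add: Bochner_Integration.integral_sum)
    have eXY: "(\<integral>\<omega>. ?X m \<omega> * ?Y m \<omega> \<partial>M)
        = (\<Sum>p\<le>m. \<Sum>q\<le>m. (\<integral>\<omega>. tuple_sum W1 F p \<omega> * tuple_sum W2 G q \<omega> \<partial>M) / (fact p * fact q))" for m
      unfolding XY using cov(1) by (simp add: Bochner_Integration.integral_sum)
    \<comment> \<open>The factorials of the expansion cancel against those of
      \<open>growth_pair_bound\<close>, leaving a product of two geometric weights; their sums are
      at most 2 each, hence the constant \<open>4 * A0\<close>.\<close>
    have cb: "\<bar>?c p q / (fact p * fact q)\<bar> \<le> A0 * d * ((1 / 2) ^ p * (1 / 2) ^ q)" for p q
    proof -
      have "\<bar>?c p q\<bar> \<le> (4 * V) ^ (p + q) * \<bar>C (p + q)\<bar> * d" by (rule cov(2))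
      also have "\<dots> \<le> A0 * fact p * fact q / 2 ^ (p + q) * d"
        using A0(2)[of p q] d(1) by (intro mult_right_mono) (simp_all add: mult.commute)
      finally show ?thesis
        by (simp add: abs_divide divide_le_eq power_one_over power_add mult_ac)
    qed
    have fin: "\<bar>(\<integral>\<omega>. ?X m \<omega> * ?Y m \<omega> \<partial>M) - integral\<^sup>L M (?X m) * integral\<^sup>L M (?Y m)\<bar> \<le> 4 * A0 * d" for m
    proof -
      define k where "k p q = ?c p q / (fact p * fact q)" for p q :: nat
      have eq: "(\<integral>\<omega>. ?X m \<omega> * ?Y m \<omega> \<partial>M) - integral\<^sup>L M (?X m) * integral\<^sup>L M (?Y m)
          = (\<Sum>p\<le>m. \<Sum>q\<le>m. k p q)"
        unfolding eXY eX eY k_def by (simp add: sum_product sum_subtractf diff_divide_distrib)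
      have "\<bar>\<Sum>p\<le>m. \<Sum>q\<le>m. k p q\<bar> \<le> (\<Sum>p\<le>m. \<bar>\<Sum>q\<le>m. k p q\<bar>)" by (rule sum_abs)
      also have "\<dots> \<le> (\<Sum>p\<le>m. \<Sum>q\<le>m. \<bar>k p q\<bar>)" by (intro sum_mono sum_abs)
      also have "\<dots> \<le> (\<Sum>p\<le>m. \<Sum>q\<le>m. A0 * d * ((1 / 2) ^ p * (1 / 2) ^ q))"
        unfolding k_def by (intro sum_mono cb)
      also have "\<dots> = A0 * d * ((\<Sum>p\<le>m. (1 / 2) ^ p) * (\<Sum>q\<le>m. (1 / 2) ^ q))"
        by (simp add: sum_distrib_left sum_distrib_right mult_ac)
      also have "\<dots> \<le> A0 * d * (2 * 2)"
      proof -
        have "(\<Sum>p\<le>m. (1 / 2 :: real) ^ p) \<le> 2" by (simp add: sum_gp0)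
        then show ?thesis using A0(1) d(1) by (intro mult_left_mono mult_mono) (auto intro: sum_nonneg)
      qed
      finally show ?thesis unfolding eq by simp
    qed
    let ?N = "\<lambda>W \<omega>. 5 ^ card (points (\<Phi> \<omega>) \<inter> W) :: real"
    have iN: "integrable M (?N W)" if "W \<in> sets borel" "bounded W" for W
      by (rule integrable_exponential_moment[OF that]) simp
    \<comment> \<open>Disjointness makes the product of the two dominating functions the exponential
      of the number of points in the union, hence integrable.\<close>
    have Nprod: "?N (W1 \<union> W2) \<omega> = ?N W1 \<omega> * ?N W2 \<omega>" if \<omega>: "\<omega> \<in> space M" for \<omega>
    proof -
      have "card (points (\<Phi> \<omega>) \<inter> (W1 \<union> W2)) = card (points (\<Phi> \<omega>) \<inter> W1) + card (points (\<Phi> \<omega>) \<inter> W2)"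
        using finite_window[OF \<omega>] W1 W2 disj unfolding Int_Un_distrib by (intro card_Un_disjoint) auto
      then show ?thesis by (simp add: power_add)
    qed
    have mF: "(\<lambda>\<omega>. F (\<Phi> \<omega>)) \<in> borel_measurable M" and mG: "(\<lambda>\<omega>. G (\<Phi> \<omega>)) \<in> borel_measurable M"
      using functional_measurable F G by auto
    have lX: "(\<lambda>m. integral\<^sup>L M (?X m)) \<longlonglongrightarrow> (\<integral>\<omega>. F (\<Phi> \<omega>) \<partial>M)"
      using iX mF partial_sums_bound[OF _ F W1] partial_sums_tendsto[OF _ F W1]
      by (intro integral_dominated_convergence[where w="?N W1"] iN W1 AE_I2) auto
    have lY: "(\<lambda>m. integral\<^sup>L M (?Y m)) \<longlonglongrightarrow> (\<integral>\<omega>. G (\<Phi> \<omega>) \<partial>M)"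
      using iY mG partial_sums_bound[OF _ G W2] partial_sums_tendsto[OF _ G W2]
      by (intro integral_dominated_convergence[where w="?N W2"] iN W2 AE_I2) auto
    have lXY: "(\<lambda>m. \<integral>\<omega>. ?X m \<omega> * ?Y m \<omega> \<partial>M) \<longlonglongrightarrow> (\<integral>\<omega>. F (\<Phi> \<omega>) * G (\<Phi> \<omega>) \<partial>M)"
    proof (rule integral_dominated_convergence[where w="?N (W1 \<union> W2)"])
      show "integrable M (?N (W1 \<union> W2))" using W1 W2 by (intro iN) auto
      show "AE \<omega> in M. (\<lambda>m. ?X m \<omega> * ?Y m \<omega>) \<longlonglongrightarrow> F (\<Phi> \<omega>) * G (\<Phi> \<omega>)"
        by (intro AE_I2 tendsto_mult partial_sums_tendsto F G W1 W2)
      show "AE \<omega> in M. norm (?X m \<omega> * ?Y m \<omega>) \<le> ?N (W1 \<union> W2) \<omega>" for m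
        using partial_sums_bound[OF _ F W1] partial_sums_bound[OF _ G W2]
        by (intro AE_I2) (auto simp: Nprod abs_mult intro!: mult_mono)
    qed (use iXY mF mG in auto)
    have "(\<lambda>m. \<bar>(\<integral>\<omega>. ?X m \<omega> * ?Y m \<omega> \<partial>M) - integral\<^sup>L M (?X m) * integral\<^sup>L M (?Y m)\<bar>)
      \<longlonglongrightarrow> \<bar>(\<integral>\<omega>. F (\<Phi> \<omega>) * G (\<Phi> \<omega>) \<partial>M) - (\<integral>\<omega>. F (\<Phi> \<omega>) \<partial>M) * (\<integral>\<omega>. G (\<Phi> \<omega>) \<partial>M)\<bar>"
      by (intro tendsto_rabs tendsto_diff tendsto_mult lX lY lXY)
    then show ?thesis
      by (rule LIMSEQ_le_const2) (use fin in auto)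
  qed
  then show thesis using A0(1) by (intro that[of "4 * A0"]) auto
qed

end

section \<open>Lattice cells\<close>

definition lattice :: "'a::euclidean_space set" where
  "lattice = {v. \<forall>b\<in>Basis. v \<bullet> b \<in> \<int>}"

text \<open>Half-open, so that the cells with lattice corners partition the space.\<close>

definition cell :: "'a::euclidean_space \<Rightarrow> 'a set" where
  "cell v = {x. \<forall>b\<in>Basis. v \<bullet> b \<le> x \<bullet> b \<and> x \<bullet> b < v \<bullet> b + 1}"

definition corner :: "'a::euclidean_space \<Rightarrow> 'a" where
  "corner x = (\<Sum>b\<in>Basis. of_int \<lfloor>x \<bullet> b\<rfloor> *\<^sub>R b)"

definition lattice_ball :: "real \<Rightarrow> 'a::euclidean_space set" where
  "lattice_ball r = {v \<in> lattice. norm v \<le> r}"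

lemma corner_lattice: "corner x \<in> lattice"
  by (auto simp: corner_def lattice_def)

lemma mem_cell_iff:
  assumes "v \<in> lattice"
  shows "x \<in> cell v \<longleftrightarrow> corner x = v"
proof -
  have "v \<bullet> b \<le> x \<bullet> b \<and> x \<bullet> b < v \<bullet> b + 1 \<longleftrightarrow> of_int \<lfloor>x \<bullet> b\<rfloor> = v \<bullet> b" if "b \<in> Basis" for b
  proof -
    have "v \<bullet> b \<in> \<int>" using assms that by (simp add: lattice_def)
    then obtain m where m: "v \<bullet> b = of_int m" by (rule Ints_cases)
    then show ?thesis by (auto simp: floor_eq_iff[symmetric])
  qed
  then show ?thesis unfolding cell_def corner_def by (auto simp: euclidean_eq_iff[where 'a='a])
qed

lemma cells_disjoint: "u \<in> lattice \<Longrightarrow> v \<in> lattice \<Longrightarrow> u \<noteq> v \<Longrightarrow> cell u \<inter> cell v = {}"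
  by (auto simp: mem_cell_iff)

lemma mem_cell_corner: "x \<in> cell (corner x)"
  by (simp add: mem_cell_iff corner_lattice)

text \<open>The norm is at most the l1 norm, and each coordinate difference is below 1. This crude
  constant serves as the margin for cells throughout.\<close>

lemma dist_cell:
  assumes "x \<in> cell (v :: 'a::euclidean_space)"
  shows "dist v x \<le> DIM('a)"
proof -
  have "norm (x - v) \<le> (\<Sum>b\<in>Basis. \<bar>(x - v) \<bullet> b\<bar>)" by (rule norm_le_l1)
  also have "\<dots> \<le> (\<Sum>b\<in>(Basis::'a set). 1)"
    using assms by (intro sum_mono) (auto simp: cell_def inner_diff_left)
  finally show ?thesis by (simp add: dist_norm norm_minus_commute)
qed

lemma cell_borel [measurable, simp]: "cell v \<in> sets borel"
proof -
  have "cell v = (\<Inter>b\<in>Basis. {x. b \<bullet> x \<ge> v \<bullet> b} \<inter> {x. b \<bullet> x < v \<bullet> b + 1})"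
    by (auto simp: cell_def inner_commute)
  also have "\<dots> \<in> sets borel"
    by (intro sets.finite_INT sets.Int borel_closed borel_open closed_halfspace_ge open_halfspace_lt) auto
  finally show ?thesis .
qed

lemma cell_subset_cball: "cell (v :: 'a::euclidean_space) \<subseteq> cball v DIM('a)"
  using dist_cell by auto

lemma cell_bounded [simp]: "bounded (cell v)"
  using bounded_subset[OF bounded_cball cell_subset_cball] .

lemma cell_fmeasurable: "cell v \<in> fmeasurable lborel"
  using emeasure_bounded_finite[OF cell_bounded] by (intro fmeasurableI) auto

lemma measure_cell: "measure lborel (cell v) = 1"
proof -
  have "emeasure lborel (cell v) = 1"
  proof (rule antisym)
    have "cell v \<subseteq> cbox v (v + One)" by (fastforce simp: cell_def mem_box inner_add_left)
    then have "emeasure lborel (cell v) \<le> emeasure lborel (cbox v (v + One))"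
      by (intro emeasure_mono) auto
    also have "\<dots> = 1" by (simp add: emeasure_lborel_cbox_eq inner_add_left)
    finally show "emeasure lborel (cell v) \<le> 1" .
    have "box v (v + One) \<subseteq> cell v" by (auto simp: cell_def mem_box inner_add_left less_imp_le)
    then have "emeasure lborel (box v (v + One)) \<le> emeasure lborel (cell v)"
      by (intro emeasure_mono) auto
    moreover have "emeasure lborel (box v (v + One)) = 1"
      by (simp add: emeasure_lborel_box_eq inner_add_left)
    ultimately show "1 \<le> emeasure lborel (cell v)" by simp
  qed
  then show ?thesis by (simp add: measure_def)
qed

lemma measure_cells:
  assumes J: "finite J" "J \<subseteq> lattice"
  shows "measure lborel (\<Union>v\<in>J. cell v) = real (card J)"
proof -
  have "measure lborel (\<Union>v\<in>J. cell v) = (\<Sum>v\<in>J. measure lborel (cell v))"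
  proof (rule measure_finite_Union)
    show "disjoint_family_on cell J"
      using J cells_disjoint by (auto simp: disjoint_family_on_def)
    show "emeasure lborel (cell v) \<noteq> \<infinity>" for v :: 'a
      using emeasure_bounded_finite[OF cell_bounded, of v] by simp
  qed (use J in auto)
  then show ?thesis by (simp add: measure_cell)
qed

section \<open>Lattice points in balls and volume asymptotics\<close>

lemma cells_subset: "J \<subseteq> lattice_ball r \<Longrightarrow> (\<Union>v\<in>J. cell v) \<subseteq> cball (0::'a::euclidean_space) (r + DIM('a))"
proof safe
  fix v x :: 'a assume J: "J \<subseteq> lattice_ball r" and v: "v \<in> J" "x \<in> cell v"
  have "norm x \<le> norm v + dist v x" using norm_triangle_sub[of x v] by (simp add: dist_norm norm_minus_commute)
  then show "x \<in> cball 0 (r + DIM('a))"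
    using dist_cell[OF v(2)] J v by (auto simp: lattice_ball_def)
qed

text \<open>The disjoint cells have volume 1 and fit into the enlarged ball. It is stated for finite
  subsets since finiteness of \<open>lattice_ball r\<close> is derived from it.\<close>

lemma card_lattice_subset:
  fixes J :: "'a::euclidean_space set"
  assumes "finite J" "J \<subseteq> lattice_ball r"
  shows "real (card J) \<le> measure lborel (cball (0::'a) (r + DIM('a)))"
proof -
  have "real (card J) = measure lborel (\<Union>v\<in>J. cell v)"
    using assms by (intro measure_cells[symmetric]) (auto simp: lattice_ball_def)
  also have "\<dots> \<le> measure lborel (cball (0::'a) (r + DIM('a)))"
    using cells_subset[OF assms(2)] assms(1)
    by (intro measure_mono_fmeasurable) (auto intro: fmeasurable_compact)
  finally show ?thesis .
qed

lemma finite_lattice_ball [simp]: "finite (lattice_ball r :: 'a::euclidean_space set)"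
proof (rule ccontr)
  assume inf: "infinite (lattice_ball r :: 'a set)"
  obtain n :: nat where n: "measure lborel (cball (0::'a) (r + DIM('a))) < real n"
    using reals_Archimedean2 by blast
  obtain J :: "'a set" where "J \<subseteq> lattice_ball r" "finite J" "card J = n"
    using infinite_arbitrarily_large[OF inf] by blast
  then show False using card_lattice_subset[of J r] n by simp
qed

lemma card_lattice_ball_le: "real (card (lattice_ball r :: 'a set)) \<le> measure lborel (cball (0::'a::euclidean_space) (r + DIM('a)))"
  by (rule card_lattice_subset) auto

lemma card_lattice_ball_ge: "measure lborel (cball (0::'a::euclidean_space) (r - DIM('a))) \<le> real (card (lattice_ball r :: 'a set))"
  for r :: real
proof -
  have "cball (0::'a) (r - DIM('a)) \<subseteq> (\<Union>v\<in>lattice_ball r. cell v)"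
  proof
    fix x :: 'a assume x: "x \<in> cball 0 (r - DIM('a))"
    have "norm (corner x) \<le> norm x + dist (corner x) x"
      using norm_triangle_sub[of "corner x" x] by (simp add: dist_norm)
    then have "corner x \<in> lattice_ball r"
      using dist_cell[OF mem_cell_corner, of x] x by (simp add: lattice_ball_def corner_lattice)
    then show "x \<in> (\<Union>v\<in>lattice_ball r. cell v)" using mem_cell_corner by blast
  qed
  then have "measure lborel (cball (0::'a) (r - DIM('a))) \<le> measure lborel (\<Union>v\<in>lattice_ball r. cell (v::'a))"
    by (intro measure_mono_fmeasurable fmeasurable.finite_UN) (auto intro: cell_fmeasurable)
  also have "\<dots> = real (card (lattice_ball r :: 'a set))"
    by (rule measure_cells[OF finite_lattice_ball]) (auto simp: lattice_ball_def)
  finally show ?thesis .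
qed

text \<open>Both volumes are the same constant times a d-th power of the radius, once the radii are
  nonnegative.\<close>

lemma volume_ratio:
  "((\<lambda>r. measure lborel (cball (0::'a::euclidean_space) (r + t)) / measure lborel (cball (0::'a) r)) \<longlongrightarrow> 1) at_top"
proof -
  have "((\<lambda>r::real. ((r + t) / r) ^ DIM('a)) \<longlongrightarrow> 1 ^ DIM('a)) at_top"
    by (intro tendsto_power) real_asymp
  then have "((\<lambda>r::real. ((r + t) / r) ^ DIM('a)) \<longlongrightarrow> 1) at_top" by simp
  moreover have "\<forall>\<^sub>F r in at_top. ((r + t) / r) ^ DIM('a)
      = measure lborel (cball (0::'a) (r + t)) / measure lborel (cball (0::'a) r)"
    using eventually_gt_at_top[of 0] eventually_ge_at_top[of "- t"]
  proof eventually_elim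
    case (elim r)
    have "unit_ball_vol (real DIM('a)) > 0" by (rule unit_ball_vol_pos) simp
    then have "unit_ball_vol (real DIM('a)) \<noteq> 0" by (rule less_imp_neq[symmetric])
    then show ?case using elim content_cball[of "r + t" "0::'a"] content_cball[of r "0::'a"]
      by (simp add: power_divide)
  qed
  ultimately show ?thesis by (rule Lim_transform_eventually)
qed

text \<open>The number of lattice points lies between the volumes of balls of radius r + t - d and r
  + t + d, with d the dimension. A fixed shift \<open>t\<close> disappears in the limit; different
  shifts will describe the two ends of a shell.\<close>

lemma lattice_ball_ratio:
  "((\<lambda>r. real (card (lattice_ball (r + t) :: 'a set)) / measure lborel (cball (0::'a::euclidean_space) r)) \<longlongrightarrow> 1) at_top"
proof (rule tendsto_sandwich)
  show "\<forall>\<^sub>F r in at_top. measure lborel (cball (0::'a) (r + (t - DIM('a)))) / measure lborel (cball (0::'a) r)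
      \<le> real (card (lattice_ball (r + t) :: 'a set)) / measure lborel (cball (0::'a) r)"
    using card_lattice_ball_ge[where 'a='a, of "_ + t"]
    by (intro always_eventually allI divide_right_mono) (simp_all add: add_diff_eq)
  show "\<forall>\<^sub>F r in at_top. real (card (lattice_ball (r + t) :: 'a set)) / measure lborel (cball (0::'a) r)
      \<le> measure lborel (cball (0::'a) (r + (t + DIM('a)))) / measure lborel (cball (0::'a) r)"
    using card_lattice_ball_le[where 'a='a, of "_ + t"]
    by (intro always_eventually allI divide_right_mono) (simp_all add: add.assoc)
qed (rule volume_ratio)+

section \<open>Summability over the lattice\<close>

lemma lattice_diff: "u \<in> lattice \<Longrightarrow> v \<in> lattice \<Longrightarrow> u - v \<in> lattice"
  by (auto simp: lattice_def inner_diff_left)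

lemma lattice_add: "u \<in> lattice \<Longrightarrow> v \<in> lattice \<Longrightarrow> u + v \<in> lattice"
  by (auto simp: lattice_def inner_add_left)

lemma sum_inverse_square_int: "\<exists>S\<ge>0. \<forall>N::nat. (\<Sum>n\<in>{- int N..int N}. 1 / (1 + \<bar>real_of_int n\<bar>)\<^sup>2) \<le> S"
proof -
  let ?g = "\<lambda>k::nat. 1 / (1 + real k)\<^sup>2"
  have "summable (\<lambda>k. 1 / (real k)\<^sup>2)" using inverse_power_summable[of 2, where 'a=real] by (simp add: inverse_eq_divide)
  then have "summable (\<lambda>k. 1 / (real (Suc k))\<^sup>2)" by (subst summable_Suc_iff)
  then have sm: "summable ?g" by (simp add: add.commute)
  have "(\<Sum>n\<in>{- int N..int N}. 1 / (1 + \<bar>real_of_int n\<bar>)\<^sup>2) \<le> 2 * (\<Sum>k. ?g k)" for N :: nat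
  proof -
    have "(\<Sum>n\<in>{- int N..int N}. 1 / (1 + \<bar>real_of_int n\<bar>)\<^sup>2)
        \<le> (\<Sum>n\<in>int ` {..N} \<union> (\<lambda>k. - int k) ` {..N}. 1 / (1 + \<bar>real_of_int n\<bar>)\<^sup>2)"
    proof (rule sum_mono2)
      show "{- int N..int N} \<subseteq> int ` {..N} \<union> (\<lambda>k. - int k) ` {..N}"
      proof
        fix n assume n: "n \<in> {- int N..int N}"
        show "n \<in> int ` {..N} \<union> (\<lambda>k. - int k) ` {..N}"
        proof (cases "n \<ge> 0")
          case True
          then show ?thesis using n by (intro UnI1 image_eqI[of _ _ "nat n"]) auto
        next
          case False
          then show ?thesis using n by (intro UnI2 image_eqI[of _ _ "nat (- n)"]) auto
        qed
      qed
    qed auto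
    also have "\<dots> \<le> (\<Sum>n\<in>int ` {..N}. 1 / (1 + \<bar>real_of_int n\<bar>)\<^sup>2)
        + (\<Sum>n\<in>(\<lambda>k. - int k) ` {..N}. 1 / (1 + \<bar>real_of_int n\<bar>)\<^sup>2)"
      by (subst sum.union_inter[symmetric]) (auto intro: sum_nonneg)
    also have "\<dots> = (\<Sum>k\<le>N. ?g k) + (\<Sum>k\<le>N. ?g k)"
      by (subst (1 2) sum.reindex) (auto simp: inj_on_def)
    also have "\<dots> \<le> (\<Sum>k. ?g k) + (\<Sum>k. ?g k)"
      by (intro add_mono sum_le_suminf sm) auto
    finally show ?thesis by simp
  qed
  moreover have "0 \<le> 2 * (\<Sum>k. ?g k)" using suminf_nonneg[OF sm] by simp
  ultimately show ?thesis by blast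
qed

text \<open>Each coordinate is at most the norm in absolute value, so the summand is at most a
  product over the coordinates of one-dimensional inverse squares, and the sum over an integer box
  factorises. Hence the exponent \<open>2 * DIM('a)\<close>.\<close>

lemma sum_lattice_bounded:
  "\<exists>S\<ge>0. \<forall>J::'a::euclidean_space set. finite J \<longrightarrow> J \<subseteq> lattice \<longrightarrow>
    (\<Sum>v\<in>J. 1 / (1 + norm v) ^ (2 * DIM('a))) \<le> S"
proof -
  obtain S where S: "S \<ge> 0" "\<And>N::nat. (\<Sum>n\<in>{- int N..int N}. 1 / (1 + \<bar>real_of_int n\<bar>)\<^sup>2) \<le> S"
    using sum_inverse_square_int by blast
  let ?g = "\<lambda>n::int. 1 / (1 + \<bar>real_of_int n\<bar>)\<^sup>2"
  have "(\<Sum>v\<in>J. 1 / (1 + norm v) ^ (2 * DIM('a))) \<le> S ^ DIM('a)" if J: "finite J" "J \<subseteq> lattice" for J :: "'a set"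
  proof -
    obtain R where R: "\<And>v. v \<in> J \<Longrightarrow> norm v \<le> R"
      using finite_imp_bounded[OF J(1)] by (auto simp: bounded_iff)
    obtain N :: nat where N: "R \<le> real N" using real_arch_simple by blast
    \<comment> \<open>The coordinate vector as an integer-valued function on the basis; it is
      injective on lattice points and embeds \<open>J\<close> into a box of integer vectors.\<close>
    define c where "c v = (\<lambda>b\<in>Basis. \<lfloor>v \<bullet> b\<rfloor>)" for v :: 'a
    have fl: "of_int \<lfloor>v \<bullet> b\<rfloor> = v \<bullet> b" if "v \<in> J" "b \<in> Basis" for v b
    proof -
      have "v \<bullet> b \<in> \<int>" using J that by (auto simp: lattice_def)
      then show ?thesis by (rule of_int_floor)
    qed
    have inj: "inj_on c J"
    proof (rule inj_onI)
      fix u v assume uv: "u \<in> J" "v \<in> J" "c u = c v"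
      have "u \<bullet> b = v \<bullet> b" if "b \<in> Basis" for b
      proof -
        have "\<lfloor>u \<bullet> b\<rfloor> = \<lfloor>v \<bullet> b\<rfloor>" using fun_cong[OF uv(3), of b] that by (simp add: c_def)
        then show ?thesis using fl[OF uv(1) that] fl[OF uv(2) that] by metis
      qed
      then show "u = v" by (rule euclidean_eqI)
    qed
    have "(\<Sum>v\<in>J. 1 / (1 + norm v) ^ (2 * DIM('a))) \<le> (\<Sum>v\<in>J. \<Prod>b\<in>Basis. ?g (c v b))"
    proof (rule sum_mono)
      fix v assume v: "v \<in> J"
      have "1 / (1 + norm v) ^ (2 * DIM('a)) = (\<Prod>b\<in>(Basis::'a set). 1 / (1 + norm v)\<^sup>2)"
        by (simp only: prod_constant power_one_over power_mult)
      also have "\<dots> \<le> (\<Prod>b\<in>Basis. ?g (c v b))"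
      proof (rule prod_mono, intro conjI)
        fix b :: 'a assume b: "b \<in> Basis"
        have "\<bar>real_of_int (c v b)\<bar> \<le> norm v"
          using fl[OF v b] b Basis_le_norm[OF b, of v] by (simp add: c_def del: of_int_floor_cancel)
        then show "1 / (1 + norm v)\<^sup>2 \<le> ?g (c v b)"
          by (intro divide_left_mono power_mono mult_pos_pos) (auto intro!: zero_less_power add_pos_nonneg)
      qed simp
      finally show "1 / (1 + norm v) ^ (2 * DIM('a)) \<le> (\<Prod>b\<in>Basis. ?g (c v b))" .
    qed
    also have "\<dots> = (\<Sum>f\<in>c ` J. \<Prod>b\<in>Basis. ?g (f b))"
      by (simp add: sum.reindex[OF inj])
    also have "\<dots> \<le> (\<Sum>f\<in>(Basis::'a set) \<rightarrow>\<^sub>E {- int N..int N}. \<Prod>b\<in>Basis. ?g (f b))"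
    proof (rule sum_mono2)
      show "c ` J \<subseteq> Basis \<rightarrow>\<^sub>E {- int N..int N}"
      proof (rule image_subsetI)
        fix v assume v: "v \<in> J"
        have "\<lfloor>v \<bullet> b\<rfloor> \<in> {- int N..int N}" if b: "b \<in> Basis" for b
        proof -
          have "\<bar>real_of_int \<lfloor>v \<bullet> b\<rfloor>\<bar> \<le> real N"
            using fl[OF v b] Basis_le_norm[OF b, of v] R[OF v] N by (simp del: of_int_floor_cancel)
          then have "\<bar>\<lfloor>v \<bullet> b\<rfloor>\<bar> \<le> int N" by linarith
          then show ?thesis by auto
        qed
        then show "c v \<in> Basis \<rightarrow>\<^sub>E {- int N..int N}" by (auto simp: c_def)
      qed
    qed (auto intro: finite_PiE prod_nonneg)
    also have "\<dots> = (\<Prod>b\<in>(Basis::'a set). \<Sum>n\<in>{- int N..int N}. ?g n)"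
      by (rule prod_sum_PiE[symmetric]) auto
    also have "\<dots> = (\<Sum>n\<in>{- int N..int N}. ?g n) ^ DIM('a)" by simp
    also have "\<dots> \<le> S ^ DIM('a)" by (intro power_mono S sum_nonneg) auto
    finally show ?thesis .
  qed
  then show ?thesis using S(1) by (intro exI[of _ "S ^ DIM('a)"]) auto
qed

context prob_space
begin

section \<open>Variance of sums and of perturbations\<close>

lemma variance_sum:
  fixes Z :: "'i \<Rightarrow> 'a \<Rightarrow> real"
  assumes Z: "\<And>v. v \<in> J \<Longrightarrow> integrable M (Z v)"
    and ZZ: "\<And>u v. u \<in> J \<Longrightarrow> v \<in> J \<Longrightarrow> integrable M (\<lambda>\<omega>. Z u \<omega> * Z v \<omega>)"
  shows "integrable M (\<lambda>\<omega>. (\<Sum>v\<in>J. Z v \<omega>)\<^sup>2)"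
    and "variance (\<lambda>\<omega>. \<Sum>v\<in>J. Z v \<omega>)
      = (\<Sum>u\<in>J. \<Sum>v\<in>J. expectation (\<lambda>\<omega>. Z u \<omega> * Z v \<omega>) - expectation (Z u) * expectation (Z v))"
proof -
  have sq: "(\<Sum>v\<in>J. Z v \<omega>)\<^sup>2 = (\<Sum>u\<in>J. \<Sum>v\<in>J. Z u \<omega> * Z v \<omega>)" for \<omega>
    by (simp add: power2_eq_square sum_product)
  show i2: "integrable M (\<lambda>\<omega>. (\<Sum>v\<in>J. Z v \<omega>)\<^sup>2)"
    unfolding sq using ZZ by (intro Bochner_Integration.integrable_sum) auto
  have i1: "integrable M (\<lambda>\<omega>. \<Sum>v\<in>J. Z v \<omega>)" using Z by (intro Bochner_Integration.integrable_sum)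
  have "variance (\<lambda>\<omega>. \<Sum>v\<in>J. Z v \<omega>) = expectation (\<lambda>\<omega>. (\<Sum>v\<in>J. Z v \<omega>)\<^sup>2) - (expectation (\<lambda>\<omega>. \<Sum>v\<in>J. Z v \<omega>))\<^sup>2"
    by (rule variance_eq[OF i1 i2])
  also have "expectation (\<lambda>\<omega>. (\<Sum>v\<in>J. Z v \<omega>)\<^sup>2) = (\<Sum>u\<in>J. \<Sum>v\<in>J. expectation (\<lambda>\<omega>. Z u \<omega> * Z v \<omega>))"
    unfolding sq using ZZ by (simp add: Bochner_Integration.integral_sum)
  also have "(expectation (\<lambda>\<omega>. \<Sum>v\<in>J. Z v \<omega>))\<^sup>2 = (\<Sum>u\<in>J. \<Sum>v\<in>J. expectation (Z u) * expectation (Z v))"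
    using Z by (simp add: Bochner_Integration.integral_sum power2_eq_square sum_product)
  finally show "variance (\<lambda>\<omega>. \<Sum>v\<in>J. Z v \<omega>)
      = (\<Sum>u\<in>J. \<Sum>v\<in>J. expectation (\<lambda>\<omega>. Z u \<omega> * Z v \<omega>) - expectation (Z u) * expectation (Z v))"
    by (simp add: sum_subtractf)
qed

text \<open>Expanding the square leaves a cross term, estimated by 2|xe| \<le> \<epsilon> x^2 + e^2
  / \<epsilon> from a complete square. Since \<epsilon> is free, it can later depend on the
  radius.\<close>

lemma variance_perturbation:
  assumes X: "integrable M X" "integrable M (\<lambda>\<omega>. (X \<omega>)\<^sup>2)"
    and D: "integrable M D" "integrable M (\<lambda>\<omega>. (D \<omega>)\<^sup>2)" and \<epsilon>: "\<epsilon> > (0::real)"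
  shows "\<bar>variance (\<lambda>\<omega>. X \<omega> + D \<omega>) - variance X\<bar> \<le> \<epsilon> * variance X + (1 + 1 / \<epsilon>) * variance D"
proof -
  define x where "x \<omega> = X \<omega> - expectation X" for \<omega>
  define e where "e \<omega> = D \<omega> - expectation D" for \<omega>
  have ix: "integrable M (\<lambda>\<omega>. (x \<omega>)\<^sup>2)" and ie: "integrable M (\<lambda>\<omega>. (e \<omega>)\<^sup>2)"
    unfolding x_def e_def using X D by (simp_all add: power2_diff)
  have am: "\<bar>2 * (x \<omega> * e \<omega>)\<bar> \<le> \<epsilon> * (x \<omega>)\<^sup>2 + (1 / \<epsilon>) * (e \<omega>)\<^sup>2" for \<omega>
  proof -
    have "0 \<le> (sqrt \<epsilon> * \<bar>x \<omega>\<bar> - \<bar>e \<omega>\<bar> / sqrt \<epsilon>)\<^sup>2" by simp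
    also have "\<dots> = \<epsilon> * (x \<omega>)\<^sup>2 + (1 / \<epsilon>) * (e \<omega>)\<^sup>2 - 2 * \<bar>x \<omega>\<bar> * \<bar>e \<omega>\<bar>"
      using \<epsilon> by (simp add: power2_diff power_mult_distrib power_divide)
    finally show ?thesis by (simp add: abs_mult)
  qed
  have mx: "x \<in> borel_measurable M" "e \<in> borel_measurable M"
    unfolding x_def e_def using X(1) D(1) by auto
  have ixe: "integrable M (\<lambda>\<omega>. 2 * (x \<omega> * e \<omega>))"
  proof (rule Bochner_Integration.integrable_bound)
    show "integrable M (\<lambda>\<omega>. \<epsilon> * (x \<omega>)\<^sup>2 + (1 / \<epsilon>) * (e \<omega>)\<^sup>2)" using ix ie by simp
    show "AE \<omega> in M. norm (2 * (x \<omega> * e \<omega>)) \<le> norm (\<epsilon> * (x \<omega>)\<^sup>2 + (1 / \<epsilon>) * (e \<omega>)\<^sup>2)"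
      using am by (intro AE_I2) (metis real_norm_def order_trans abs_ge_self)
  qed (use mx in auto)
  have "variance (\<lambda>\<omega>. X \<omega> + D \<omega>) = expectation (\<lambda>\<omega>. (x \<omega>)\<^sup>2 + (2 * (x \<omega> * e \<omega>) + (e \<omega>)\<^sup>2))"
    using X(1) D(1) by (intro Bochner_Integration.integral_cong refl)
      (simp add: x_def e_def power2_eq_square algebra_simps)
  also have "\<dots> = variance X + expectation (\<lambda>\<omega>. 2 * (x \<omega> * e \<omega>) + (e \<omega>)\<^sup>2)"
    using ix ie ixe by (subst Bochner_Integration.integral_add) (auto simp: x_def)
  finally have eq: "variance (\<lambda>\<omega>. X \<omega> + D \<omega>) - variance X = expectation (\<lambda>\<omega>. 2 * (x \<omega> * e \<omega>) + (e \<omega>)\<^sup>2)" by simp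
  have "\<bar>expectation (\<lambda>\<omega>. 2 * (x \<omega> * e \<omega>) + (e \<omega>)\<^sup>2)\<bar> \<le> expectation (\<lambda>\<omega>. \<bar>2 * (x \<omega> * e \<omega>) + (e \<omega>)\<^sup>2\<bar>)"
    by (rule integral_abs_bound)
  also have "\<dots> \<le> expectation (\<lambda>\<omega>. \<epsilon> * (x \<omega>)\<^sup>2 + (1 + 1 / \<epsilon>) * (e \<omega>)\<^sup>2)"
  proof (rule integral_mono)
    show "\<bar>2 * (x \<omega> * e \<omega>) + (e \<omega>)\<^sup>2\<bar> \<le> \<epsilon> * (x \<omega>)\<^sup>2 + (1 + 1 / \<epsilon>) * (e \<omega>)\<^sup>2" for \<omega>
    proof -
      have "\<bar>2 * (x \<omega> * e \<omega>) + (e \<omega>)\<^sup>2\<bar> \<le> \<bar>2 * (x \<omega> * e \<omega>)\<bar> + (e \<omega>)\<^sup>2"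
        using abs_triangle_ineq[of "2 * (x \<omega> * e \<omega>)" "(e \<omega>)\<^sup>2"] by simp
      also have "\<dots> \<le> \<epsilon> * (x \<omega>)\<^sup>2 + (1 / \<epsilon>) * (e \<omega>)\<^sup>2 + (e \<omega>)\<^sup>2" using am[of \<omega>] by linarith
      finally show ?thesis by (simp add: distrib_right)
    qed
  qed (use ix ie ixe in auto)
  also have "\<dots> = \<epsilon> * variance X + (1 + 1 / \<epsilon>) * variance D"
    using ix ie by (subst Bochner_Integration.integral_add) (auto simp: x_def e_def)
  finally show ?thesis unfolding eq .
qed

end

section \<open>Asymptotics of the variance\<close>

lemma agree_emeasure:
  assumes "\<phi> \<in> counting_measures" "\<psi> \<in> counting_measures" "A \<in> sets borel" "agree A \<phi> \<psi>"
  shows "emeasure \<phi> A = emeasure \<psi> A"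
proof -
  have "restr \<phi> A = restr \<psi> A" using assms by (intro restr_cong) (auto simp: agree_def)
  then show ?thesis using emeasure_restr[OF assms(1,3,3)] emeasure_restr[OF assms(2,3,3)] by simp
qed

lemma measure_counting_mono:
  assumes "\<phi> \<in> counting_measures" "A \<in> sets borel" "W \<in> sets borel" "bounded W" "A \<subseteq> W"
  shows "measure \<phi> A \<le> measure \<phi> W"
proof (rule measure_mono_fmeasurable)
  show "W \<in> fmeasurable \<phi>"
    using counting_finite[OF assms(1,3,4)] sets_counting[OF assms(1)] assms(3) by (intro fmeasurableI) auto
qed (use assms sets_counting[OF assms(1)] in auto)

lemma local_functional_measure:
  assumes "A \<in> sets borel" "W \<in> sets borel" "bounded W" "A \<subseteq> W"
  shows "local_functional W (\<lambda>\<phi>. measure \<phi> A)"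
  unfolding local_functional_def
proof (intro conjI ballI impI)
  show "(\<lambda>\<phi>. measure \<phi> A) \<in> borel_measurable counting_space"
    using measurable_emeasure_counting_space[OF assms(1)] unfolding measure_def by measurable
  show "measure \<phi> A = measure \<psi> A"
    if "\<phi> \<in> counting_measures" "\<psi> \<in> counting_measures" "agree W \<phi> \<psi>" for \<phi> \<psi>
    using agree_emeasure[OF that(1,2) assms(1) agree_mono[OF that(3) assms(4)]] by (simp add: measure_def)
  show "\<bar>measure \<phi> A\<bar> \<le> measure \<phi> W" if "\<phi> \<in> counting_measures" for \<phi>
    using measure_counting_mono[OF that assms] by simp
qed

context correlated_process
begin

section \<open>Covariances of local functionals\<close>

definition covariance :: "('a measure \<Rightarrow> real) \<Rightarrow> ('a measure \<Rightarrow> real) \<Rightarrow> real" where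
  "covariance F G = expectation (\<lambda>\<omega>. F (\<Phi> \<omega>) * G (\<Phi> \<omega>)) - expectation (\<lambda>\<omega>. F (\<Phi> \<omega>)) * expectation (\<lambda>\<omega>. G (\<Phi> \<omega>))"

lemma expectation_stationary:
  fixes G :: "'a measure \<Rightarrow> real"
  assumes G: "G \<in> borel_measurable counting_space"
  shows "expectation (\<lambda>\<omega>. G (translate (\<Phi> \<omega>) w)) = expectation (\<lambda>\<omega>. G (\<Phi> \<omega>))"
proof -
  have "expectation (\<lambda>\<omega>. G (translate (\<Phi> \<omega>) w))
      = integral\<^sup>L (distr M counting_space (\<lambda>\<omega>. translate (\<Phi> \<omega>) w)) G"
    by (rule integral_distr[symmetric]) (use G in measurable)
  also have "\<dots> = integral\<^sup>L (distr M counting_space \<Phi>) G"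
    using stationary by (simp add: stationary_def)
  also have "\<dots> = expectation (\<lambda>\<omega>. G (\<Phi> \<omega>))"
    by (rule integral_distr) (use G in measurable)
  finally show ?thesis .
qed

lemma measure_translate:
  "\<omega> \<in> space M \<Longrightarrow> A \<in> sets borel \<Longrightarrow> measure (translate (\<Phi> \<omega>) w) A = measure (\<Phi> \<omega>) ((\<lambda>y. y + w) ` A)"
  using emeasure_translate[OF counting] by (simp add: measure_def)

lemma shift_cball: "(\<lambda>y. y + z) ` cball 0 R = cball (z :: 'a) R"
  using cball_translation[of z 0 R] by (simp add: add.commute)

lemma shift_cell: "(\<lambda>y. y + u) ` cell v = cell (v + u :: 'a)"
proof (intro equalityI subsetI)
  fix x assume "x \<in> cell (v + u)"
  then show "x \<in> (\<lambda>y. y + u) ` cell v"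
    by (intro image_eqI[of _ _ "x - u"]) (auto simp: cell_def inner_add_left inner_diff_left algebra_simps)
qed (auto simp: cell_def inner_add_left)

lemma second_moment_cball:
  "expectation (\<lambda>\<omega>. (measure (\<Phi> \<omega>) (cball z R))\<^sup>2) = expectation (\<lambda>\<omega>. (measure (\<Phi> \<omega>) (cball 0 R))\<^sup>2)"
proof -
  have "(\<lambda>\<phi>. (measure \<phi> (cball (0::'a) R))\<^sup>2) \<in> borel_measurable counting_space"
    using measurable_emeasure_counting_space[of "cball (0::'a) R"] unfolding measure_def by measurable
  from expectation_stationary[OF this, of z] show ?thesis
    by (subst (asm) Bochner_Integration.integral_cong[OF refl]) (auto simp: measure_translate shift_cball)
qed

lemma functional_product_integrable:
  assumes F: "local_functional W1 F" "W1 \<in> sets borel" "bounded W1"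
    and G: "local_functional W2 G" "W2 \<in> sets borel" "bounded W2"
  shows "integrable M (\<lambda>\<omega>. F (\<Phi> \<omega>) * G (\<Phi> \<omega>))"
proof (rule Bochner_Integration.integrable_bound)
  show "integrable M (\<lambda>\<omega>. (F (\<Phi> \<omega>))\<^sup>2 + (G (\<Phi> \<omega>))\<^sup>2)"
    using functional_integrable(2)[OF F] functional_integrable(2)[OF G] by simp
  show "(\<lambda>\<omega>. F (\<Phi> \<omega>) * G (\<Phi> \<omega>)) \<in> borel_measurable M"
    using functional_measurable[OF F(1)] functional_measurable[OF G(1)] by simp
  have "\<bar>x * y\<bar> \<le> x\<^sup>2 + y\<^sup>2" for x y :: real
  proof -
    have "\<bar>x * y\<bar> \<le> (x\<^sup>2 + y\<^sup>2) / 2"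
      using sum_squares_bound[of "\<bar>x\<bar>" "\<bar>y\<bar>"] by (simp add: abs_mult)
    also have "\<dots> \<le> x\<^sup>2 + y\<^sup>2" by simp
    finally show ?thesis .
  qed
  then show "AE \<omega> in M. norm (F (\<Phi> \<omega>) * G (\<Phi> \<omega>)) \<le> norm ((F (\<Phi> \<omega>))\<^sup>2 + (G (\<Phi> \<omega>))\<^sup>2)"
    by (intro AE_I2) simp
qed

text \<open>It follows from |xy| \<le> (x^2 + y^2) / 2 and the domination of the functionals by
  point counts. By stationarity the bound does not depend on the centres; it serves the pairs that
  are too close for mixing.\<close>

lemma covariance_crude_bound:
  assumes F: "local_functional (cball z1 R) F" and G: "local_functional (cball z2 R) G"
  shows "\<bar>covariance F G\<bar> \<le> 2 * expectation (\<lambda>\<omega>. (measure (\<Phi> \<omega>) (cball 0 R))\<^sup>2)"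
proof -
  define Q where "Q = expectation (\<lambda>\<omega>. (measure (\<Phi> \<omega>) (cball 0 R))\<^sup>2)"
  have Q0: "Q \<ge> 0" by (simp add: Q_def)
  have sq: "expectation (\<lambda>\<omega>. (H (\<Phi> \<omega>))\<^sup>2) \<le> Q" if H: "local_functional (cball z R) H" for z H
  proof -
    have "expectation (\<lambda>\<omega>. (H (\<Phi> \<omega>))\<^sup>2) \<le> expectation (\<lambda>\<omega>. (measure (\<Phi> \<omega>) (cball z R))\<^sup>2)"
    proof (rule integral_mono)
      show "integrable M (\<lambda>\<omega>. (H (\<Phi> \<omega>))\<^sup>2)" by (rule functional_integrable(2)[OF H]) auto
      show "integrable M (\<lambda>\<omega>. (measure (\<Phi> \<omega>) (cball z R))\<^sup>2)"
        by (rule functional_integrable(2)[OF local_functional_measure[OF _ _ _ order_refl]]) auto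
      show "(H (\<Phi> \<omega>))\<^sup>2 \<le> (measure (\<Phi> \<omega>) (cball z R))\<^sup>2" if "\<omega> \<in> space M" for \<omega>
      proof -
        have "\<bar>H (\<Phi> \<omega>)\<bar> \<le> measure (\<Phi> \<omega>) (cball z R)"
          using H counting[OF that] by (simp add: local_functional_def)
        from power_mono[OF this, of 2] show ?thesis by simp
      qed
    qed
    also note second_moment_cball
    finally show ?thesis by (simp only: Q_def)
  qed
  have sqE: "(expectation (\<lambda>\<omega>. H (\<Phi> \<omega>)))\<^sup>2 \<le> Q" if H: "local_functional (cball z R) H" for z H
  proof -
    have i: "integrable M (\<lambda>\<omega>. H (\<Phi> \<omega>))" "integrable M (\<lambda>\<omega>. (H (\<Phi> \<omega>))\<^sup>2)"
      by (rule functional_integrable[OF H]; simp)+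
    have "0 \<le> variance (\<lambda>\<omega>. H (\<Phi> \<omega>))" by (rule variance_positive)
    then show ?thesis using variance_eq[OF i] sq[OF H] by simp
  qed
  have i: "integrable M (\<lambda>\<omega>. (F (\<Phi> \<omega>))\<^sup>2)" "integrable M (\<lambda>\<omega>. (G (\<Phi> \<omega>))\<^sup>2)"
    by (rule functional_integrable(2)[OF F] functional_integrable(2)[OF G]; simp)+
  have am: "\<bar>x * y\<bar> \<le> (x\<^sup>2 + y\<^sup>2) / 2" for x y :: real
    using sum_squares_bound[of "\<bar>x\<bar>" "\<bar>y\<bar>"] by (simp add: abs_mult)
  have "\<bar>expectation (\<lambda>\<omega>. F (\<Phi> \<omega>) * G (\<Phi> \<omega>))\<bar> \<le> expectation (\<lambda>\<omega>. \<bar>F (\<Phi> \<omega>) * G (\<Phi> \<omega>)\<bar>)"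
    by (rule integral_abs_bound)
  also have "\<dots> \<le> expectation (\<lambda>\<omega>. ((F (\<Phi> \<omega>))\<^sup>2 + (G (\<Phi> \<omega>))\<^sup>2) / 2)"
    using i am by (intro integral_mono integrable_abs functional_product_integrable[OF F _ _ G]) auto
  also have "\<dots> = (expectation (\<lambda>\<omega>. (F (\<Phi> \<omega>))\<^sup>2) + expectation (\<lambda>\<omega>. (G (\<Phi> \<omega>))\<^sup>2)) / 2"
    using i by simp
  also have "\<dots> \<le> Q" using sq[OF F] sq[OF G] by simp
  finally have 1: "\<bar>expectation (\<lambda>\<omega>. F (\<Phi> \<omega>) * G (\<Phi> \<omega>))\<bar> \<le> Q" .
  have 2: "\<bar>expectation (\<lambda>\<omega>. F (\<Phi> \<omega>)) * expectation (\<lambda>\<omega>. G (\<Phi> \<omega>))\<bar> \<le> Q"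
    by (rule order_trans[OF am]) (use sqE[OF F] sqE[OF G] in simp)
  show ?thesis unfolding covariance_def Q_def[symmetric] using 1 2 by linarith
qed

text \<open>For distant centres the mixing bound applies with the gap between the balls, for the
  others the crude bound; a single weight covers both. \<open>K\<close> is uniform in the centres
  and in the functionals.\<close>

lemma covariance_decay:
  assumes R: "R \<ge> 0"
  shows "\<exists>K\<ge>0. \<forall>z1 z2 F G. local_functional (cball z1 R) F \<longrightarrow> local_functional (cball z2 R) G \<longrightarrow>
    \<bar>covariance F G\<bar> \<le> K * (1 / (1 + norm (z1 - z2)) ^ (2 * DIM('a)))"
proof -
  let ?m = "2 * DIM('a)"
  obtain s0 where s0: "s0 \<ge> 0" "\<And>s. s \<ge> s0 \<Longrightarrow> \<delta> s \<le> 1 / (1 + s) ^ ?m"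
    using decay_function_power_bound[OF decay_function] by blast
  \<comment> \<open>The summand 1 makes \<open>V\<close> positive also for R = 0, as
    \<open>mixing\<close> requires.\<close>
  define V where "V = measure lborel (cball (0::'a) R) + 1"
  have V: "V > 0" unfolding V_def by (simp add: add_nonneg_pos)
  have ball: "measure lborel (cball z R) \<le> V" for z :: 'a
    using content_cball[OF R, of z] content_cball[OF R, of "0::'a"] by (simp add: V_def)
  obtain A where A: "A \<ge> 0" "\<And>W1 W2 F G D d. local_functional W1 F \<Longrightarrow> local_functional W2 G \<Longrightarrow>
    W1 \<in> sets borel \<Longrightarrow> bounded W1 \<Longrightarrow> W2 \<in> sets borel \<Longrightarrow> bounded W2 \<Longrightarrow>
    measure lborel W1 \<le> V \<Longrightarrow> measure lborel W2 \<le> V \<Longrightarrow> W1 \<inter> W2 = {} \<Longrightarrow> 0 \<le> D \<Longrightarrow>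
    (\<And>x y. x \<in> W1 \<Longrightarrow> y \<in> W2 \<Longrightarrow> D \<le> dist x y) \<Longrightarrow> 0 \<le> d \<Longrightarrow> (\<And>s. D \<le> s \<Longrightarrow> \<delta> s \<le> d) \<Longrightarrow>
    \<bar>(\<integral>\<omega>. F (\<Phi> \<omega>) * G (\<Phi> \<omega>) \<partial>M) - (\<integral>\<omega>. F (\<Phi> \<omega>) \<partial>M) * (\<integral>\<omega>. G (\<Phi> \<omega>) \<partial>M)\<bar> \<le> A * d"
    using mixing[OF V] by blast
  define Q where "Q = 2 * expectation (\<lambda>\<omega>. (measure (\<Phi> \<omega>) (cball 0 R))\<^sup>2)"
  have Q: "Q \<ge> 0" by (simp add: Q_def)
  define T where "T = s0 + 2 * R + 1"
  have T: "T \<ge> 1" using s0 R by (simp add: T_def)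
  \<comment> \<open>The first summand passes from the gap \<open>D\<close> back to the distance of
    the centres, by \<open>1 + D + 2 * R \<le> (1 + 2 * R) * (1 + D)\<close>; the second compensates
    the weight at distances below \<open>T\<close>.\<close>
  define K where "K = A * (1 + 2 * R) ^ ?m + Q * (1 + T) ^ ?m"
  have K: "K \<ge> 0" using A(1) Q R T by (simp add: K_def)
  have "\<bar>covariance F G\<bar> \<le> K * (1 / (1 + norm (z1 - z2)) ^ ?m)"
    if F: "local_functional (cball z1 R) F" and G: "local_functional (cball z2 R) G" for z1 z2 F G
  proof (cases "norm (z1 - z2) \<ge> T")
    case True
    define D where "D = norm (z1 - z2) - 2 * R"
    have D: "D \<ge> s0" "D > 0" using True s0(1) by (simp_all add: D_def T_def)
    have dist: "D \<le> dist x y" if "x \<in> cball z1 R" "y \<in> cball z2 R" for x y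
    proof -
      have "dist z1 z2 \<le> dist z1 x + dist x y + dist y z2"
        using dist_triangle[of z1 z2 x] dist_triangle[of x z2 y] by linarith
      then show ?thesis using that by (simp add: D_def dist_norm[of z1 z2, symmetric] dist_commute)
    qed
    define d where "d = 1 / (1 + D) ^ ?m"
    have d0: "d \<ge> 0" using D by (simp add: d_def)
    have dd: "\<delta> s \<le> d" if "D \<le> s" for s
    proof -
      have "\<delta> s \<le> 1 / (1 + s) ^ ?m" using s0(2) D that by simp
      also have "\<dots> \<le> d" unfolding d_def using D that
        by (intro divide_left_mono power_mono mult_pos_pos zero_less_power) auto
      finally show ?thesis .
    qed
    have disj: "cball z1 R \<inter> cball z2 R = {}"
    proof (rule ccontr)
      assume "\<not> ?thesis"
      then obtain x where "x \<in> cball z1 R" "x \<in> cball z2 R" by blast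
      from dist[OF this] D(2) show False by simp
    qed
    have "\<bar>covariance F G\<bar> \<le> A * d"
      unfolding covariance_def
      by (rule A(2)[OF F G _ _ _ _ ball ball disj less_imp_le[OF D(2)] dist d0 dd]) auto
    also have "d \<le> (1 + 2 * R) ^ ?m * (1 / (1 + norm (z1 - z2)) ^ ?m)"
    proof -
      have "1 + norm (z1 - z2) \<le> (1 + 2 * R) * (1 + D)"
        using R D(2) mult_nonneg_nonneg[of R D] by (simp add: D_def algebra_simps)
      then have "(1 + norm (z1 - z2)) ^ ?m \<le> ((1 + 2 * R) * (1 + D)) ^ ?m"
        by (intro power_mono) auto
      then show ?thesis
        using D(2) by (simp only: d_def power_mult_distrib)
          (simp add: divide_simps add_pos_nonneg mult.commute)
    qed
    finally have "\<bar>covariance F G\<bar> \<le> A * ((1 + 2 * R) ^ ?m * (1 / (1 + norm (z1 - z2)) ^ ?m))"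
      using A(1) by (simp add: mult_left_mono)
    also have "\<dots> \<le> K * (1 / (1 + norm (z1 - z2)) ^ ?m)"
      unfolding mult.assoc[symmetric] K_def using Q T by (intro mult_right_mono) auto
    finally show ?thesis .
  next
    case False
    have "\<bar>covariance F G\<bar> \<le> Q * 1"
      using covariance_crude_bound[OF F G] by (simp add: Q_def)
    also have "\<dots> \<le> Q * ((1 + T) ^ ?m * (1 / (1 + norm (z1 - z2)) ^ ?m))"
    proof (rule mult_left_mono[OF _ Q])
      have "(1 + norm (z1 - z2)) ^ ?m \<le> (1 + T) ^ ?m" using False by (intro power_mono) auto
      then show "1 \<le> (1 + T) ^ ?m * (1 / (1 + norm (z1 - z2)) ^ ?m)"
        by (simp add: divide_simps add_pos_nonneg)
    qed
    also have "\<dots> \<le> K * (1 / (1 + norm (z1 - z2)) ^ ?m)"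
      unfolding mult.assoc[symmetric] K_def using A(1) R by (intro mult_right_mono) auto
    finally show ?thesis .
  qed
  then show ?thesis using K by blast
qed

text \<open>For fixed \<open>u\<close> the differences \<open>u - v\<close> are distinct lattice
  points, so each row of the covariance matrix sums to at most \<open>K * S\<close>. The constant is
  the same for all families \<open>Z\<close>, which admits boundary terms that depend on the
  radius.\<close>

lemma variance_local_sum:
  assumes R: "R \<ge> 0"
  shows "\<exists>K\<ge>0. \<forall>J Z. finite J \<longrightarrow> J \<subseteq> lattice \<longrightarrow> (\<forall>v\<in>J. local_functional (cball v R) (Z v)) \<longrightarrow>
    variance (\<lambda>\<omega>. \<Sum>v\<in>J. Z v (\<Phi> \<omega>)) \<le> K * real (card J)"
proof -
  obtain K where K: "K \<ge> 0" "\<And>z1 z2 F G. local_functional (cball z1 R) F \<Longrightarrow> local_functional (cball z2 R) G \<Longrightarrow>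
    \<bar>covariance F G\<bar> \<le> K * (1 / (1 + norm (z1 - z2)) ^ (2 * DIM('a)))"
    using covariance_decay[OF R] by blast
  obtain S where S: "S \<ge> 0" "\<And>J::'a set. finite J \<Longrightarrow> J \<subseteq> lattice \<Longrightarrow>
    (\<Sum>v\<in>J. 1 / (1 + norm v) ^ (2 * DIM('a))) \<le> S"
    using sum_lattice_bounded by blast
  have "variance (\<lambda>\<omega>. \<Sum>v\<in>J. Z v (\<Phi> \<omega>)) \<le> K * S * real (card J)"
    if J: "finite J" "J \<subseteq> lattice" and Z: "\<And>v. v \<in> J \<Longrightarrow> local_functional (cball v R) (Z v)" for J Z
  proof -
    have "variance (\<lambda>\<omega>. \<Sum>v\<in>J. Z v (\<Phi> \<omega>)) = (\<Sum>u\<in>J. \<Sum>v\<in>J. covariance (Z u) (Z v))"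
      unfolding covariance_def
    proof (rule variance_sum(2))
      show "integrable M (\<lambda>\<omega>. Z v (\<Phi> \<omega>))" if "v \<in> J" for v
        by (rule functional_integrable(1)[OF Z[OF that]]) auto
      show "integrable M (\<lambda>\<omega>. Z u (\<Phi> \<omega>) * Z v (\<Phi> \<omega>))" if "u \<in> J" "v \<in> J" for u v
        by (rule functional_product_integrable[OF Z[OF that(1)] _ _ Z[OF that(2)]]) auto
    qed
    also have "\<dots> \<le> (\<Sum>u\<in>J. K * S)"
    proof (rule sum_mono)
      fix u assume u: "u \<in> J"
      have "(\<Sum>v\<in>J. covariance (Z u) (Z v)) \<le> (\<Sum>v\<in>J. K * (1 / (1 + norm (u - v)) ^ (2 * DIM('a))))"
        using K(2)[OF Z[OF u] Z] by (intro sum_mono) (meson abs_le_iff)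
      also have "\<dots> = K * (\<Sum>v\<in>(\<lambda>v. u - v) ` J. 1 / (1 + norm v) ^ (2 * DIM('a)))"
        by (subst sum.reindex) (auto simp: inj_on_def sum_distrib_left)
      also have "\<dots> \<le> K * S"
        using J u by (intro mult_left_mono S(2) K(1)) (auto intro: lattice_diff)
      finally show "(\<Sum>v\<in>J. covariance (Z u) (Z v)) \<le> K * S" .
    qed
    finally show ?thesis by (simp add: mult.commute)
  qed
  then show ?thesis using K(1) S(1) by (intro exI[of _ "K * S"]) auto
qed

lemma cell_functional: "local_functional (cball v DIM('a)) (\<lambda>\<phi>. measure \<phi> (cell v))" for v :: 'a
  by (rule local_functional_measure) (use cell_subset_cball in auto)

section \<open>Limit of the variance for sums over lattice cells\<close>

lemma covariance_cells:
  "covariance (\<lambda>\<phi>. measure \<phi> (cell u)) (\<lambda>\<phi>. measure \<phi> (cell w))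
    = covariance (\<lambda>\<phi>. measure \<phi> (cell 0)) (\<lambda>\<phi>. measure \<phi> (cell (w - u)))"
proof -
  have m: "(\<lambda>\<phi>. measure \<phi> (cell v)) \<in> borel_measurable counting_space" for v :: 'a
    using cell_functional[of v] by (simp add: local_functional_def)
  have tr: "measure (translate (\<Phi> \<omega>) u) (cell v) = measure (\<Phi> \<omega>) (cell (v + u))" if "\<omega> \<in> space M" for \<omega> v
    using measure_translate[OF that, of "cell v" u] by (simp add: shift_cell)
  have E1: "expectation (\<lambda>\<omega>. measure (\<Phi> \<omega>) (cell (v + u))) = expectation (\<lambda>\<omega>. measure (\<Phi> \<omega>) (cell v))" for v
    using expectation_stationary[OF m[of v], of u]
    by (subst (asm) Bochner_Integration.integral_cong[OF refl tr]) auto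
  have "(\<lambda>\<phi>. measure \<phi> (cell 0) * measure \<phi> (cell (w - u))) \<in> borel_measurable counting_space"
    by (intro borel_measurable_times m)
  from expectation_stationary[OF this, of u]
  have E2: "expectation (\<lambda>\<omega>. measure (\<Phi> \<omega>) (cell u) * measure (\<Phi> \<omega>) (cell w))
      = expectation (\<lambda>\<omega>. measure (\<Phi> \<omega>) (cell 0) * measure (\<Phi> \<omega>) (cell (w - u)))"
    by (subst (asm) Bochner_Integration.integral_cong[OF refl]) (auto simp: tr)
  show ?thesis using E1[of 0] E1[of "w - u"] E2 by (simp add: covariance_def)
qed

text \<open>Grouping pairs of cells by their difference writes the variance as a sum of
  \<open>c v * N v r\<close>. After division by the volume each multiplicity tends to 1, and
  dominated convergence identifies the limit as the sum of \<open>c\<close> over the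
  lattice.\<close>

lemma lattice_variance_limit:
  "\<exists>L. ((\<lambda>r. variance (\<lambda>\<omega>. \<Sum>v\<in>lattice_ball r. measure (\<Phi> \<omega>) (cell v)) / measure lborel (cball (0::'a) r)) \<longlongrightarrow> L) at_top"
proof -
  define c where "c v = covariance (\<lambda>\<phi>. measure \<phi> (cell 0)) (\<lambda>\<phi>. measure \<phi> (cell v))" for v
  let ?L = "lattice :: 'a set" and ?I = "\<lambda>r. lattice_ball r :: 'a set" and ?vol = "\<lambda>r. measure lborel (cball (0::'a) r)"
  obtain K where K: "K \<ge> 0" "\<And>z1 z2 F G. local_functional (cball z1 (real DIM('a))) F \<Longrightarrow> local_functional (cball z2 DIM('a)) G \<Longrightarrow>
    \<bar>covariance F G\<bar> \<le> K * (1 / (1 + norm (z1 - z2)) ^ (2 * DIM('a)))"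
    using covariance_decay[of "real DIM('a)"] by auto
  obtain S where S: "S \<ge> 0" "\<And>J::'a set. finite J \<Longrightarrow> J \<subseteq> lattice \<Longrightarrow>
    (\<Sum>v\<in>J. 1 / (1 + norm v) ^ (2 * DIM('a))) \<le> S"
    using sum_lattice_bounded by blast
  have cb: "\<bar>c v\<bar> \<le> K * (1 / (1 + norm v) ^ (2 * DIM('a)))" for v
    using K(2)[OF cell_functional[of 0] cell_functional[of v]] by (simp add: c_def)
  have csum: "(\<Sum>v\<in>J. \<bar>c v\<bar>) \<le> K * S" if "finite J" "J \<subseteq> ?L" for J
  proof -
    have "(\<Sum>v\<in>J. \<bar>c v\<bar>) \<le> (\<Sum>v\<in>J. K * (1 / (1 + norm v) ^ (2 * DIM('a))))" by (intro sum_mono cb)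
    also have "\<dots> \<le> K * S" unfolding sum_distrib_left[symmetric] by (intro mult_left_mono S(2) K(1) that)
    finally show ?thesis .
  qed
  have "(\<lambda>v. norm (c v)) summable_on ?L"
    by (rule nonneg_bdd_above_summable_on) (use csum in \<open>auto intro!: bdd_aboveI[of _ "K * S"]\<close>)
  then have "Infinite_Set_Sum.abs_summable_on c ?L" by (rule abs_summable_equivalent[THEN iffD1])
  \<comment> \<open>The sum over the lattice is handled as an integral for counting measure, so that
    dominated convergence is available.\<close>
  then have ci: "integrable (count_space ?L) c" by (simp add: Infinite_Set_Sum.abs_summable_on_def)
  define N where "N v r = real (card {u \<in> ?I r. u + v \<in> ?I r})" for v r
  have Nle: "N v r \<le> real (card (?I r))" for v r
    unfolding N_def by (intro of_nat_mono card_mono) auto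
  \<comment> \<open>A shift by \<open>v\<close> keeps points of norm at most
    \<open>r - norm v\<close> in the ball, so \<open>N\<close> lies between two lattice counts in
    balls whose radii differ by a constant.\<close>
  have Nge: "real (card (?I (r - norm v))) \<le> N v r" if "v \<in> ?L" for v r
    unfolding N_def
  proof (intro of_nat_mono card_mono subsetI)
    fix u assume u: "u \<in> ?I (r - norm v)"
    then have "norm u + norm v \<le> r" by (simp add: lattice_ball_def)
    then have "norm u \<le> r" "norm (u + v) \<le> r"
      using norm_triangle_ineq[of u v] norm_ge_zero[of v] by linarith+
    then show "u \<in> {u \<in> ?I r. u + v \<in> ?I r}"
      using u that lattice_add by (auto simp: lattice_ball_def)
  qed auto
  have var: "variance (\<lambda>\<omega>. \<Sum>v\<in>?I r. measure (\<Phi> \<omega>) (cell v)) = (\<integral>v. c v * N v r \<partial>count_space ?L)" for r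
  proof -
    have "variance (\<lambda>\<omega>. \<Sum>v\<in>?I r. measure (\<Phi> \<omega>) (cell v))
        = (\<Sum>u\<in>?I r. \<Sum>w\<in>?I r. covariance (\<lambda>\<phi>. measure \<phi> (cell u)) (\<lambda>\<phi>. measure \<phi> (cell w)))"
      unfolding covariance_def
    proof (rule variance_sum(2))
      show "integrable M (\<lambda>\<omega>. measure (\<Phi> \<omega>) (cell v))" for v
        by (rule functional_integrable(1)[OF cell_functional]) auto
      show "integrable M (\<lambda>\<omega>. measure (\<Phi> \<omega>) (cell u) * measure (\<Phi> \<omega>) (cell v))" for u v
        by (rule functional_product_integrable[OF cell_functional _ _ cell_functional]) auto
    qed
    also have "\<dots> = (\<Sum>u\<in>?I r. \<Sum>w\<in>?I r. c (w - u))"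
      unfolding c_def by (intro sum.cong refl covariance_cells)
    also have "\<dots> = (\<Sum>u\<in>?I r. \<integral>v. c v * indicator {v. u + v \<in> ?I r} v \<partial>count_space ?L)"
    proof (rule sum.cong[OF refl])
      fix u assume u: "u \<in> ?I r"
      have sup: "{v \<in> ?L. c v * indicator {v. u + v \<in> ?I r} v \<noteq> 0} \<subseteq> (\<lambda>w. w - u) ` ?I r"
        by (auto simp: indicator_def image_iff intro!: bexI[of _ "u + _"])
      have sub: "(\<lambda>w. w - u) ` ?I r \<subseteq> ?L"
        using u by (auto simp: lattice_ball_def intro: lattice_diff)
      have "(\<integral>v. c v * indicator {v. u + v \<in> ?I r} v \<partial>count_space ?L)
          = (\<Sum>v | v \<in> ?L \<and> c v * indicator {v. u + v \<in> ?I r} v \<noteq> 0. c v * indicator {v. u + v \<in> ?I r} v)"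
        by (rule lebesgue_integral_count_space_finite_support) (rule finite_subset[OF sup], simp)
      also have "\<dots> = (\<Sum>v\<in>(\<lambda>w. w - u) ` ?I r. c v * indicator {v. u + v \<in> ?I r} v)"
        by (rule sum.mono_neutral_left) (use sup sub in auto)
      also have "\<dots> = (\<Sum>w\<in>?I r. c (w - u))"
        by (subst sum.reindex) (auto simp: inj_on_def)
      finally show "(\<Sum>w\<in>?I r. c (w - u)) = (\<integral>v. c v * indicator {v. u + v \<in> ?I r} v \<partial>count_space ?L)" ..
    qed
    also have "\<dots> = (\<integral>v. (\<Sum>u\<in>?I r. c v * indicator {v. u + v \<in> ?I r} v) \<partial>count_space ?L)"
    proof (rule Bochner_Integration.integral_sum[symmetric])
      fix u
      show "integrable (count_space ?L) (\<lambda>v. c v * indicator {v. u + v \<in> ?I r} v)"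
        by (rule Bochner_Integration.integrable_bound[OF ci]) (auto simp: indicator_def)
    qed
    also have "\<dots> = (\<integral>v. c v * N v r \<partial>count_space ?L)"
    proof (rule Bochner_Integration.integral_cong[OF refl])
      fix v
      have "(\<Sum>u\<in>?I r. indicator {v. u + v \<in> ?I r} v) = N v r"
        unfolding N_def by (subst real_of_card) (simp add: sum.inter_filter[symmetric] indicator_def of_bool_def if_distrib cong: if_cong)
      then show "(\<Sum>u\<in>?I r. c v * indicator {v. u + v \<in> ?I r} v) = c v * N v r"
        by (simp add: sum_distrib_left[symmetric])
    qed
    finally show ?thesis .
  qed
  have ratio: "((\<lambda>r. N v r / ?vol r) \<longlongrightarrow> 1) at_top" if v: "v \<in> ?L" for v
  proof (rule tendsto_sandwich)
    show "\<forall>\<^sub>F r in at_top. real (card (?I (r + (- norm v)))) / ?vol r \<le> N v r / ?vol r"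
      using Nge[OF v] by (intro always_eventually allI divide_right_mono) auto
    show "\<forall>\<^sub>F r in at_top. N v r / ?vol r \<le> real (card (?I (r + 0))) / ?vol r"
      using Nle by (intro always_eventually allI divide_right_mono) auto
  qed (rule lattice_ball_ratio)+
  have "((\<lambda>r. \<integral>v. c v * (N v r / ?vol r) \<partial>count_space ?L) \<longlongrightarrow> (\<integral>v. c v \<partial>count_space ?L)) at_top"
  proof (rule integral_dominated_convergence_at_top[where w="\<lambda>v. 2 * \<bar>c v\<bar>"])
    show "integrable (count_space ?L) (\<lambda>v. 2 * \<bar>c v\<bar>)" using ci by simp
    \<comment> \<open>This yields the factor 2 in the dominating function: from some radius on
      \<open>N v r\<close> is at most twice the volume, for all \<open>v\<close> at once.\<close>
    have "((\<lambda>r. real (card (?I (r + 0))) / ?vol r) \<longlongrightarrow> 1) at_top" by (rule lattice_ball_ratio)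
    then have "\<forall>\<^sub>F r in at_top. real (card (?I (r + 0))) / ?vol r < 2" by (rule order_tendstoD) simp
    then show "\<forall>\<^sub>F r in at_top. AE v in count_space ?L. norm (c v * (N v r / ?vol r)) \<le> 2 * \<bar>c v\<bar>"
    proof eventually_elim
      case (elim r)
      have "N v r / ?vol r \<le> 2" for v
        using elim divide_right_mono[OF Nle[of v r], of "?vol r"] by simp
      moreover have "0 \<le> N v r / ?vol r" for v by (simp add: N_def)
      ultimately have "\<bar>c v\<bar> * \<bar>N v r / ?vol r\<bar> \<le> \<bar>c v\<bar> * 2" for v
        by (intro mult_left_mono) (simp_all only: abs_of_nonneg abs_ge_zero)
      then show ?case by (intro AE_I2) (simp add: abs_mult mult.commute)
    qed
    show "AE v in count_space ?L. ((\<lambda>r. c v * (N v r / ?vol r)) \<longlongrightarrow> c v) at_top"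
    proof (intro AE_I2)
      fix v assume "v \<in> space (count_space ?L)"
      then have "((\<lambda>r. c v * (N v r / ?vol r)) \<longlongrightarrow> c v * 1) at_top"
        by (intro tendsto_mult tendsto_const ratio) simp
      then show "((\<lambda>r. c v * (N v r / ?vol r)) \<longlongrightarrow> c v) at_top" by simp
    qed
  qed auto
  then show ?thesis
    unfolding var by (intro exI[of _ "\<integral>v. c v \<partial>count_space ?L"]) (simp add: divide_inverse mult.assoc[symmetric])
qed

end

section \<open>Comparison of the displaced process with the sum over cells\<close>

lemma mem_lattice_ball: "v \<in> lattice_ball r \<longleftrightarrow> v \<in> lattice \<and> norm v \<le> r"
  by (simp add: lattice_ball_def)

text \<open>The choice \<epsilon> = \<open>e r\<close> with \<open>e r * e r = h r + 1 / r\<close>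
  balances the error terms: their sum is at most \<open>e r * g r + e r * e r + e r\<close>. The
  summand \<open>1 / r\<close> keeps \<epsilon> positive where \<open>h\<close> vanishes.\<close>

lemma perturbed_limit:
  fixes f g h :: "real \<Rightarrow> real"
  assumes g: "(g \<longlongrightarrow> L) at_top" and h: "(h \<longlongrightarrow> 0) at_top" and h0: "\<And>r. 0 \<le> h r"
    and fg: "\<And>r \<epsilon>. \<epsilon> > 0 \<Longrightarrow> \<bar>f r - g r\<bar> \<le> \<epsilon> * g r + (1 + 1 / \<epsilon>) * h r"
  shows "(f \<longlongrightarrow> L) at_top"
proof -
  define e where "e r = sqrt (h r + 1 / r)" for r
  have "((\<lambda>r::real. 1 / r) \<longlongrightarrow> 0) at_top" by real_asymp
  from tendsto_add[OF h this] have s: "((\<lambda>r. h r + 1 / r) \<longlongrightarrow> 0) at_top" by simp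
  from tendsto_real_sqrt[OF this] have e: "(e \<longlongrightarrow> 0) at_top" by (simp add: e_def[abs_def])
  have "((\<lambda>r. e r * g r + ((h r + 1 / r) + e r)) \<longlongrightarrow> 0 * L + (0 + 0)) at_top"
    by (intro tendsto_add tendsto_mult e g s)
  then have lim: "((\<lambda>r. e r * g r + ((h r + 1 / r) + e r)) \<longlongrightarrow> 0) at_top" by simp
  have "\<forall>\<^sub>F r in at_top. norm (f r - g r) \<le> e r * g r + ((h r + 1 / r) + e r)"
    using eventually_gt_at_top[of 0]
  proof eventually_elim
    case (elim r)
    have pos: "h r + 1 / r > 0" using h0[of r] elim by (simp add: add_nonneg_pos)
    have er: "e r > 0" using pos by (simp add: e_def)
    have sq: "h r + 1 / r = e r * e r" using pos by (simp add: e_def)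
    have "(1 + 1 / e r) * h r \<le> (1 + 1 / e r) * (h r + 1 / r)"
      using er elim by (intro mult_left_mono) auto
    also have "\<dots> = (h r + 1 / r) + e r" unfolding sq using er by (simp add: field_simps)
    finally show ?case using fg[OF er, of r] by simp
  qed
  then have "((\<lambda>r. f r - g r) \<longlongrightarrow> 0) at_top" using lim by (rule Lim_null_comparison)
  from tendsto_add[OF this g] show ?thesis by simp
qed

locale displaced_process = correlated_process M \<Phi> \<rho> \<delta> C a + displacement Y
  for M :: "'w measure" and \<Phi> :: "'w \<Rightarrow> 'a::euclidean_space measure"
    and \<rho> :: "nat \<Rightarrow> (nat \<Rightarrow> 'a) \<Rightarrow> real" and \<delta> :: "real \<Rightarrow> real" and C :: "nat \<Rightarrow> real" and a :: real
    and Y :: "'a measure \<Rightarrow> 'a"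
begin

text \<open>Points are sorted by the cell they start from, not by the cell they end in, so that the
  attribution of points to cells is the same for all \<open>k\<close>.\<close>

definition arrivals :: "nat \<Rightarrow> real \<Rightarrow> 'a \<Rightarrow> 'a measure \<Rightarrow> ennreal" where
  "arrivals k r v \<phi> = (\<integral>\<^sup>+x. indicator (cell v) x * indicator (cball 0 r) (pos k \<phi> x) \<partial>\<phi>)"

text \<open>What cell \<open>v\<close> contributes to the displaced count beyond its contribution to
  the sum over \<open>lattice_ball r\<close>. For k = 0 it corrects the replacement of the ball by a
  union of cells.\<close>

definition boundary_term :: "nat \<Rightarrow> real \<Rightarrow> 'a \<Rightarrow> 'a measure \<Rightarrow> real" where
  "boundary_term k r v \<phi> = enn2real (arrivals k r v \<phi>) - (if v \<in> lattice_ball r then measure \<phi> (cell v) else 0)"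

text \<open>The margin is the cell bound \<open>DIM('a)\<close> of \<open>dist_cell\<close> plus the
  largest displacement \<open>k\<close>.\<close>

definition shell :: "nat \<Rightarrow> real \<Rightarrow> 'a set" where
  "shell k r = {v \<in> lattice. r - (DIM('a) + k) \<le> norm v \<and> norm v \<le> r + (DIM('a) + k)}"

lemma measurable_pos_fixed:
  assumes "\<phi> \<in> counting_measures"
  shows "pos k \<phi> \<in> borel_measurable borel"
  using measurable_pos[of "\<lambda>_. \<phi>" borel "\<lambda>x. x" k] assms by (simp add: space_counting_space)

lemma arrivals_integrand_measurable:
  assumes "\<phi> \<in> counting_measures"
  shows "(\<lambda>x. indicator (cell v) x * indicator (cball 0 r) (pos k \<phi> x) :: ennreal) \<in> borel_measurable borel"
proof -
  note [measurable] = measurable_pos_fixed[OF assms, of k]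
  have [measurable]: "cball (0::'a) r \<in> sets borel" by simp
  show ?thesis by measurable
qed

lemma arrivals_le:
  assumes \<phi>: "\<phi> \<in> counting_measures"
  shows "arrivals k r v \<phi> \<le> emeasure \<phi> (cell v)"
proof -
  have "arrivals k r v \<phi> \<le> (\<integral>\<^sup>+x. indicator (cell v) x \<partial>\<phi>)"
    unfolding arrivals_def by (rule nn_integral_mono) (auto simp: indicator_def)
  then show ?thesis using sets_counting[OF \<phi>] by simp
qed

lemma arrivals_finite: "\<phi> \<in> counting_measures \<Longrightarrow> arrivals k r v \<phi> < \<infinity>"
  using le_less_trans[OF arrivals_le counting_finite[of \<phi> "cell v"]] by simp

text \<open>The radius is that of a ball around \<open>v\<close> containing the cell, plus the range
  \<open>3 * real k + 1\<close> of \<open>pos_local\<close>. Both terms of the difference lie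
  between 0 and the number of points in the cell, whence the bound.\<close>

lemma boundary_term_local:
  "local_functional (cball v (DIM('a) + 3 * real k + 1)) (boundary_term k r v)"
  unfolding local_functional_def
proof (intro conjI ballI impI)
  let ?W = "cball v (DIM('a) + 3 * real k + 1)"
  have cW: "cell v \<subseteq> ?W" using dist_cell[of _ v] by fastforce
  have [measurable]: "cball (0::'a) r \<in> sets borel" by simp
  have "(\<lambda>\<phi>. arrivals k r v \<phi>) \<in> borel_measurable counting_space"
    unfolding arrivals_def
  proof (rule measurable_nn_integral_counting)
    have [measurable]: "(\<lambda>p. pos k (fst p) (snd p)) \<in> borel_measurable (counting_space \<Otimes>\<^sub>M borel)"
      by (rule measurable_pos) measurable
    show "(\<lambda>(\<phi>, x). indicator (cell v) x * indicator (cball 0 r) (pos k \<phi> x) :: ennreal)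
        \<in> borel_measurable (counting_space \<Otimes>\<^sub>M borel)"
      unfolding case_prod_beta by measurable
  qed simp
  moreover have "(\<lambda>\<phi>. measure \<phi> (cell v)) \<in> borel_measurable counting_space"
    using cell_functional[of v] by (simp add: local_functional_def)
  ultimately show "boundary_term k r v \<in> borel_measurable counting_space"
    unfolding boundary_term_def by measurable
  show "boundary_term k r v \<phi> = boundary_term k r v \<psi>"
    if \<phi>: "\<phi> \<in> counting_measures" "\<psi> \<in> counting_measures" and ag: "agree ?W \<phi> \<psi>" for \<phi> \<psi>
  proof -
    have "emeasure \<phi> {x} * (indicator (cell v) x * indicator (cball 0 r) (pos k \<phi> x))
        = emeasure \<psi> {x} * (indicator (cell v) x * indicator (cball 0 r) (pos k \<psi> x))" for x
    proof (cases "x \<in> cell v")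
      case True
      have "cball x (3 * real k + 1) \<subseteq> ?W"
      proof
        fix y assume "y \<in> cball x (3 * real k + 1)"
        then show "y \<in> ?W" using dist_triangle[of v y x] dist_cell[OF True] by simp
      qed
      then have "pos k \<phi> x = pos k \<psi> x" by (intro pos_local[OF \<phi>] agree_mono[OF ag])
      moreover have "emeasure \<phi> {x} = emeasure \<psi> {x}" using ag True cW by (auto simp: agree_def)
      ultimately show ?thesis by simp
    qed simp
    then have "arrivals k r v \<phi> = arrivals k r v \<psi>"
      unfolding arrivals_def nn_integral_counting[OF \<phi>(1) arrivals_integrand_measurable[OF \<phi>(1)]]
        nn_integral_counting[OF \<phi>(2) arrivals_integrand_measurable[OF \<phi>(2)]]
      by (intro nn_integral_cong) simp
    moreover have "emeasure \<phi> (cell v) = emeasure \<psi> (cell v)"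
      by (rule agree_emeasure[OF \<phi> _ agree_mono[OF ag cW]]) simp
    ultimately show ?thesis by (simp add: boundary_term_def measure_def)
  qed
  show "\<bar>boundary_term k r v \<phi>\<bar> \<le> measure \<phi> ?W" if \<phi>: "\<phi> \<in> counting_measures" for \<phi>
  proof -
    have "enn2real (arrivals k r v \<phi>) \<le> measure \<phi> (cell v)"
      unfolding measure_def using arrivals_le[OF \<phi>] counting_finite[OF \<phi>, of "cell v"]
      by (intro enn2real_mono) auto
    moreover have "measure \<phi> (cell v) \<le> measure \<phi> ?W"
      by (rule measure_counting_mono[OF \<phi> _ _ _ cW]) auto
    moreover have "0 \<le> enn2real (arrivals k r v \<phi>)" "0 \<le> measure \<phi> (cell v)" by simp_all
    ultimately show ?thesis
      unfolding boundary_term_def by (cases "v \<in> lattice_ball r"; simp only: if_True if_False; linarith)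
  qed
qed

text \<open>Points starting in such a cell are still in the ball after \<open>k\<close> steps, so
  the cell contributes all its points to both counts.\<close>

lemma boundary_term_outside_shell:
  fixes r :: real
  assumes \<phi>: "\<phi> \<in> counting_measures" and v: "v \<in> lattice" "norm v < r - (DIM('a) + k)"
  shows "boundary_term k r v \<phi> = 0"
proof -
  have "arrivals k r v \<phi> = (\<integral>\<^sup>+x. indicator (cell v) x \<partial>\<phi>)"
    unfolding arrivals_def
  proof (rule nn_integral_cong)
    fix x
    show "indicator (cell v) x * indicator (cball 0 r) (pos k \<phi> x) = (indicator (cell v) x :: ennreal)"
    proof (cases "x \<in> cell v")
      case True
      have "norm (pos k \<phi> x) \<le> norm v + dist v x + dist x (pos k \<phi> x)"
        using dist_triangle[of 0 "pos k \<phi> x" x] dist_triangle[of 0 x v] by simp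
      then have "norm (pos k \<phi> x) \<le> r"
        using dist_cell[OF True] dist_pos[OF \<phi>, of x k] v by simp
      then show ?thesis by simp
    qed simp
  qed
  moreover have "norm v \<le> r" using v(2) by simp
  ultimately show ?thesis
    using v(1) sets_counting[OF \<phi>] by (simp add: boundary_term_def mem_lattice_ball measure_def)
qed

text \<open>A point that is in the ball after \<open>k\<close> steps started in a cell whose corner
  has norm at most \<open>r + (DIM('a) + k)\<close>. Among these cells, those on the inner side of
  the shell have vanishing boundary term.\<close>

lemma displaced_count_decomposition:
  assumes \<phi>: "\<phi> \<in> counting_measures"
  shows "measure (iter k \<phi>) (cball 0 r)
    = (\<Sum>v\<in>lattice_ball r. measure \<phi> (cell v)) + (\<Sum>v\<in>shell k r. boundary_term k r v \<phi>)"
proof -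
  let ?B = "lattice_ball (r + (DIM('a) + k)) :: 'a set"
  have "emeasure (iter k \<phi>) (cball 0 r) = (\<integral>\<^sup>+x. indicator (cball 0 r) (pos k \<phi> x) \<partial>\<phi>)"
    by (rule emeasure_iter[OF \<phi>]) simp
  also have "\<dots> = (\<integral>\<^sup>+x. (\<Sum>v\<in>?B. indicator (cell v) x * indicator (cball 0 r) (pos k \<phi> x)) \<partial>\<phi>)"
  proof (rule nn_integral_cong)
    fix x
    show "indicator (cball 0 r) (pos k \<phi> x) = (\<Sum>v\<in>?B. indicator (cell v) x * indicator (cball 0 r) (pos k \<phi> x) :: ennreal)"
    proof (cases "pos k \<phi> x \<in> cball 0 r")
      case True
      have "norm (corner x) \<le> dist (corner x) x + (dist x (pos k \<phi> x) + norm (pos k \<phi> x))"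
        using dist_triangle[of "corner x" 0 x] dist_triangle[of x 0 "pos k \<phi> x"] by simp
      then have cB: "corner x \<in> ?B"
        using dist_cell[OF mem_cell_corner, of x] dist_pos[OF \<phi>, of x k] True
        by (simp add: mem_lattice_ball corner_lattice)
      have "(\<Sum>v\<in>?B. indicator (cell v) x :: ennreal) = (\<Sum>v\<in>{corner x}. indicator (cell v) x)"
        by (rule sum.mono_neutral_right) (use cB in \<open>auto simp: mem_lattice_ball mem_cell_iff indicator_def split: if_splits\<close>)
      then show ?thesis using True by (simp add: mem_cell_corner)
    qed simp
  qed
  also have "\<dots> = (\<Sum>v\<in>?B. arrivals k r v \<phi>)"
    unfolding arrivals_def
    using arrivals_integrand_measurable[OF \<phi>] sets_counting[OF \<phi>]
    by (intro nn_integral_sum) (simp cong: measurable_cong_sets)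
  finally have "measure (iter k \<phi>) (cball 0 r) = (\<Sum>v\<in>?B. enn2real (arrivals k r v \<phi>))"
    unfolding measure_def using arrivals_finite[OF \<phi>] by (simp add: enn2real_sum)
  also have "\<dots> = (\<Sum>v\<in>?B. boundary_term k r v \<phi>) + (\<Sum>v\<in>?B. if v \<in> lattice_ball r then measure \<phi> (cell v) else 0)"
    by (simp add: boundary_term_def sum.distrib[symmetric])
  also have "(\<Sum>v\<in>?B. if v \<in> lattice_ball r then measure \<phi> (cell v) else 0) = (\<Sum>v\<in>lattice_ball r. measure \<phi> (cell v))"
    by (rule sum.mono_neutral_cong_right) (auto simp: mem_lattice_ball)
  also have "(\<Sum>v\<in>?B. boundary_term k r v \<phi>) = (\<Sum>v\<in>shell k r. boundary_term k r v \<phi>)"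
  proof (rule sum.mono_neutral_right)
    show "\<forall>v\<in>?B - shell k r. boundary_term k r v \<phi> = 0"
    proof
      fix v assume v: "v \<in> ?B - shell k r"
      then have "v \<in> lattice" "norm v < r - (DIM('a) + k)" by (auto simp: mem_lattice_ball shell_def)
      then show "boundary_term k r v \<phi> = 0" by (rule boundary_term_outside_shell[OF \<phi>])
    qed
  qed (auto simp: shell_def mem_lattice_ball)
  finally show ?thesis by simp
qed

text \<open>The enlargement \<open>2 * real k\<close> comes from the locality of the iteration; the
  points themselves travel at most \<open>k\<close>.\<close>

lemma displaced_count_local:
  "local_functional (cball 0 (r + 2 * real k)) (\<lambda>\<phi>. measure (iter k \<phi>) (cball 0 r))"
  unfolding local_functional_def
proof (intro conjI ballI impI)
  have "(\<lambda>\<phi>. emeasure (iter k \<phi>) (cball 0 r)) \<in> borel_measurable counting_space"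
    by (rule measurable_emeasure_counting[OF measurable_iter]) auto
  then show "(\<lambda>\<phi>. measure (iter k \<phi>) (cball 0 r)) \<in> borel_measurable counting_space"
    unfolding measure_def by measurable
  show "measure (iter k \<phi>) (cball 0 r) = measure (iter k \<psi>) (cball 0 r)"
    if \<phi>: "\<phi> \<in> counting_measures" "\<psi> \<in> counting_measures" and "agree (cball 0 (r + 2 * real k)) \<phi> \<psi>" for \<phi> \<psi>
    using agree_emeasure[OF iter_counting[OF \<phi>(1)] iter_counting[OF \<phi>(2)] _ iter_local[OF that]]
    by (simp add: measure_def)
  show "\<bar>measure (iter k \<phi>) (cball 0 r)\<bar> \<le> measure \<phi> (cball 0 (r + 2 * real k))"
    if \<phi>: "\<phi> \<in> counting_measures" for \<phi>
  proof -
    have "emeasure (iter k \<phi>) (cball 0 r) = (\<integral>\<^sup>+x. indicator (cball 0 r) (pos k \<phi> x) \<partial>\<phi>)"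
      by (rule emeasure_iter[OF \<phi>]) simp
    also have "\<dots> \<le> (\<integral>\<^sup>+x. indicator (cball 0 (r + 2 * real k)) x \<partial>\<phi>)"
    proof (rule nn_integral_mono)
      fix x
      have "norm x \<le> dist x (pos k \<phi> x) + norm (pos k \<phi> x)"
        using dist_triangle[of x 0 "pos k \<phi> x"] by simp
      then show "indicator (cball 0 r) (pos k \<phi> x) \<le> (indicator (cball 0 (r + 2 * real k)) x :: ennreal)"
        using dist_pos[OF \<phi>, of x k] by (auto simp: indicator_def)
    qed
    also have "\<dots> = emeasure \<phi> (cball 0 (r + 2 * real k))" using sets_counting[OF \<phi>] by simp
    finally show ?thesis
      using counting_finite[OF \<phi>, of "cball 0 (r + 2 * real k)"] by (simp add: measure_def enn2real_mono)
  qed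
qed

lemma displaced_count_square_integrable:
  "integrable M (\<lambda>\<omega>. (measure (iter k (\<Phi> \<omega>)) (cball 0 r))\<^sup>2)"
  by (rule functional_integrable(2)[OF displaced_count_local]) auto

lemma finite_shell: "finite (shell k r)"
  by (rule finite_subset[of _ "lattice_ball (r + (DIM('a) + k))"]) (auto simp: shell_def mem_lattice_ball)

text \<open>The inner ball has its radius reduced by a further 1, because the shell contains its
  inner boundary sphere. Divided by the volume, the two counts have the same limit.\<close>

lemma card_shell_le:
  fixes r :: real
  shows
  "real (card (shell k r)) \<le> real (card (lattice_ball (r + (DIM('a) + k)) :: 'a set))
     - real (card (lattice_ball (r + (- (DIM('a) + real k) - 1)) :: 'a set))"
proof -
  let ?I = "lattice_ball (r + (DIM('a) + k)) :: 'a set" and ?J = "lattice_ball (r + (- (DIM('a) + real k) - 1)) :: 'a set"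
  have sub: "?J \<subseteq> ?I" by (auto simp: mem_lattice_ball)
  have "shell k r \<subseteq> ?I - ?J" by (auto simp: shell_def mem_lattice_ball)
  then have "card (shell k r) \<le> card (?I - ?J)" by (intro card_mono) auto
  also have "\<dots> = card ?I - card ?J" using sub by (intro card_Diff_subset) auto
  finally show ?thesis using card_mono[OF _ sub] by simp
qed

text \<open>\<open>L\<close> is fixed in advance, by a sum that does not involve \<open>k\<close>;
  this is what makes the limits for different \<open>k\<close> coincide.\<close>

theorem displaced_variance_limit:
  assumes L: "((\<lambda>r. variance (\<lambda>\<omega>. \<Sum>v\<in>lattice_ball r. measure (\<Phi> \<omega>) (cell v)) / measure lborel (cball (0::'a) r)) \<longlongrightarrow> L) at_top"
  shows "((\<lambda>r. variance (\<lambda>\<omega>. measure (iter k (\<Phi> \<omega>)) (cball 0 r)) / measure lborel (cball (0::'a) r)) \<longlongrightarrow> L) at_top"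
proof -
  let ?vol = "\<lambda>r. measure lborel (cball (0::'a) r)"
  let ?R = "DIM('a) + 3 * real k + 1"
  let ?S = "\<lambda>r \<omega>. \<Sum>v\<in>lattice_ball r. measure (\<Phi> \<omega>) (cell (v::'a))"
  let ?D = "\<lambda>r \<omega>. \<Sum>v\<in>shell k r. boundary_term k r v (\<Phi> \<omega>)"
  obtain K where K: "K \<ge> 0" "\<And>J Z. finite J \<Longrightarrow> J \<subseteq> lattice \<Longrightarrow> (\<And>v. v \<in> J \<Longrightarrow> local_functional (cball v ?R) (Z v)) \<Longrightarrow>
      variance (\<lambda>\<omega>. \<Sum>v\<in>J. Z v (\<Phi> \<omega>)) \<le> K * real (card J)"
    using variance_local_sum[of ?R] by auto
  \<comment> \<open>A majorant of the normalised variance of the boundary sum: both ratios tend to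
    1, so their difference vanishes in the limit.\<close>
  define h where "h r = K * (real (card (lattice_ball (r + (DIM('a) + k)) :: 'a set)) / ?vol r
     - real (card (lattice_ball (r + (- (DIM('a) + real k) - 1)) :: 'a set)) / ?vol r)" for r :: real
  have "(h \<longlongrightarrow> K * (1 - 1)) at_top"
    unfolding h_def by (intro tendsto_mult tendsto_diff tendsto_const lattice_ball_ratio)
  then have h: "(h \<longlongrightarrow> 0) at_top" by simp
  have hc: "K * real (card (shell k r)) / ?vol r \<le> h r" for r
    unfolding h_def diff_divide_distrib[symmetric] times_divide_eq_right
    using card_shell_le[of k r] K(1) by (intro divide_right_mono mult_left_mono) simp_all
  have h0: "0 \<le> h r" for r
    by (rule order_trans[OF _ hc[of r]]) (use K(1) in simp)
  have varD: "variance (?D r) / ?vol r \<le> h r" for r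
  proof -
    have "variance (?D r) \<le> K * real (card (shell k r))"
      by (rule K(2)[OF finite_shell]) (auto simp: shell_def boundary_term_local)
    then show ?thesis using hc[of r] by (meson divide_right_mono measure_nonneg order_trans)
  qed
  have S: "integrable M (?S r)" "integrable M (\<lambda>\<omega>. (?S r \<omega>)\<^sup>2)" for r
  proof -
    have i: "integrable M (\<lambda>\<omega>. measure (\<Phi> \<omega>) (cell v))" for v :: 'a
      by (rule functional_integrable(1)[OF cell_functional]) auto
    then show "integrable M (?S r)" by (intro Bochner_Integration.integrable_sum)
    show "integrable M (\<lambda>\<omega>. (?S r \<omega>)\<^sup>2)"
      by (rule variance_sum(1)[OF i]) (rule functional_product_integrable[OF cell_functional _ _ cell_functional]; simp)
  qed
  have D: "integrable M (?D r)" "integrable M (\<lambda>\<omega>. (?D r \<omega>)\<^sup>2)" for r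
  proof -
    have i: "integrable M (\<lambda>\<omega>. boundary_term k r v (\<Phi> \<omega>))" for v
      by (rule functional_integrable(1)[OF boundary_term_local]) auto
    then show "integrable M (?D r)" by (intro Bochner_Integration.integrable_sum)
    show "integrable M (\<lambda>\<omega>. (?D r \<omega>)\<^sup>2)"
      by (rule variance_sum(1)[OF i]) (rule functional_product_integrable[OF boundary_term_local _ _ boundary_term_local]; simp)
  qed
  have var: "variance (\<lambda>\<omega>. measure (iter k (\<Phi> \<omega>)) (cball 0 r)) = variance (\<lambda>\<omega>. ?S r \<omega> + ?D r \<omega>)" for r
  proof -
    have eq: "measure (iter k (\<Phi> \<omega>)) (cball 0 r) = ?S r \<omega> + ?D r \<omega>" if "\<omega> \<in> space M" for \<omega>
      by (rule displaced_count_decomposition[OF counting[OF that]])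
    have E: "expectation (\<lambda>\<omega>. measure (iter k (\<Phi> \<omega>)) (cball 0 r)) = expectation (\<lambda>\<omega>. ?S r \<omega> + ?D r \<omega>)"
      by (rule Bochner_Integration.integral_cong[OF refl eq])
    show ?thesis
      unfolding E by (rule Bochner_Integration.integral_cong[OF refl]) (simp only: eq)
  qed
  show ?thesis
  proof (rule perturbed_limit[OF L h h0])
    fix r \<epsilon> :: real assume \<epsilon>: "\<epsilon> > 0"
    have "\<bar>variance (\<lambda>\<omega>. ?S r \<omega> + ?D r \<omega>) - variance (?S r)\<bar> \<le> \<epsilon> * variance (?S r) + (1 + 1 / \<epsilon>) * variance (?D r)"
      by (rule variance_perturbation[OF S D \<epsilon>])
    then have "\<bar>variance (\<lambda>\<omega>. ?S r \<omega> + ?D r \<omega>) - variance (?S r)\<bar> / ?vol r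
        \<le> (\<epsilon> * variance (?S r) + (1 + 1 / \<epsilon>) * variance (?D r)) / ?vol r"
      by (rule divide_right_mono) simp
    also have "\<dots> = \<epsilon> * (variance (?S r) / ?vol r) + (1 + 1 / \<epsilon>) * (variance (?D r) / ?vol r)"
      by (simp only: add_divide_distrib times_divide_eq_right)
    also have "\<dots> \<le> \<epsilon> * (variance (?S r) / ?vol r) + (1 + 1 / \<epsilon>) * h r"
      using \<epsilon> by (intro add_left_mono mult_left_mono varD) auto
    finally show "\<bar>variance (\<lambda>\<omega>. measure (iter k (\<Phi> \<omega>)) (cball 0 r)) / ?vol r - variance (?S r) / ?vol r\<bar>
        \<le> \<epsilon> * (variance (?S r) / ?vol r) + (1 + 1 / \<epsilon>) * h r"
      unfolding var by (simp only: diff_divide_distrib[symmetric] abs_divide abs_of_nonneg[OF measure_nonneg])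
  qed
qed

theorem displaced_process_result:
  "(\<forall>k r. integrable M (\<lambda>\<omega>. (measure (iter k (\<Phi> \<omega>)) (cball 0 r))\<^sup>2)) \<and>
   (\<exists>L::real. \<forall>k. ((\<lambda>r. variance (\<lambda>\<omega>. measure (iter k (\<Phi> \<omega>)) (cball 0 r)) / measure lborel (cball (0::'a) r)) \<longlongrightarrow> L) at_top)"
  using lattice_variance_limit displaced_variance_limit displaced_count_square_integrable by blast

end

section \<open>Passage to a process that is simple everywhere\<close>

lemma null_measure_counting: "null_measure borel \<in> (counting_measures :: 'a::euclidean_space measure set)"
  by (auto simp: counting_measures_def intro: exI[of _ 0])

text \<open>There is exactly one tuple of length 0, and the product measure over no coordinates is a
  unit mass at it.\<close>

lemma correlation_function_0:
  fixes \<Phi> :: "'w \<Rightarrow> 'a::euclidean_space measure"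
  assumes "prob_space M"
  shows "correlation_function M \<Phi> 0 (\<lambda>_. 1)"
proof -
  interpret prob_space M by fact
  have "factorial_moment M \<Phi> 0 B = (\<integral>\<^sup>+x. ennreal 1 * indicator B x \<partial>PiM {..<0::nat} (\<lambda>_. lborel))"
    if B: "B \<in> sets (PiM {..<0::nat} (\<lambda>_. lborel :: 'a measure))" for B
  proof -
    have set: "{x \<in> {..<0::nat} \<rightarrow>\<^sub>E points (\<Phi> \<omega>). inj_on x {..<0} \<and> x \<in> B} = {\<lambda>_. undefined} \<inter> B" for \<omega>
      by auto
    have "factorial_moment M \<Phi> 0 B = emeasure (count_space UNIV) ({\<lambda>_. undefined} \<inter> B)"
      unfolding factorial_moment_def set by (simp add: emeasure_space_1)
    also have "\<dots> = indicator B (\<lambda>_. undefined)"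
      by (cases "(\<lambda>_. undefined) \<in> B") auto
    finally show ?thesis by (simp add: PiM_empty nn_integral_count_space_finite)
  qed
  then show ?thesis by (simp add: correlation_function_def)
qed

theorem proposition7p1:
  fixes M :: "'w measure"
    and \<Phi> :: "'w \<Rightarrow> 'a::euclidean_space measure"
    and Y :: "'a measure \<Rightarrow> 'a"
    and \<delta> :: "real \<Rightarrow> real"
    and C :: "nat \<Rightarrow> real"
  assumes "point_process M \<Phi>"
    and "AE \<omega> in M. simple_config (\<Phi> \<omega>)"
    and "stationary M \<Phi>"
    and "intensity M \<Phi> \<noteq> 0"
    and "exp_decay_of_correlations M \<Phi> \<delta> C"
    and "\<exists>a<1. C \<in> O(\<lambda>k. real k powr (a * real k))"
    and "Y \<in> borel_measurable counting_space"
    and "\<forall>\<phi>\<in>counting_measures. Y \<phi> \<in> cball 0 1"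
    and "\<forall>\<phi>\<in>counting_measures. Y \<phi> = Y (restr \<phi> (cball 0 1))"
  shows "(\<forall>k r. integrable M (\<lambda>\<omega>. (measure ((displace Y ^^ k) (\<Phi> \<omega>)) (cball 0 r))\<^sup>2)) \<and>
    (\<exists>L::real.
      ((\<lambda>r. prob_space.variance M (\<lambda>\<omega>. measure (\<Phi> \<omega>) (cball 0 r))
              / measure lborel (cball (0::'a) r)) \<longlongrightarrow> L) at_top \<and>
      (\<forall>k\<ge>1. ((\<lambda>r. prob_space.variance M (\<lambda>\<omega>. measure ((displace Y ^^ k) (\<Phi> \<omega>)) (cball 0 r))
              / measure lborel (cball (0::'a) r)) \<longlongrightarrow> L) at_top))"
proof -
  interpret prob_space M using assms(1) by (simp add: point_process_def)
  have \<Phi> [measurable]: "\<Phi> \<in> measurable M counting_space" using assms(1) by (simp add: point_process_def)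
  obtain N where N: "N \<in> null_sets M" "{\<omega> \<in> space M. \<not> simple_config (\<Phi> \<omega>)} \<subseteq> N"
    using assms(2) by (rule AE_E) auto
  \<comment> \<open>On the null set the process is replaced by the empty configuration, which is
    simple; laws, factorial moments and variances are unchanged.\<close>
  define \<Psi> where "\<Psi> \<omega> = (if \<omega> \<in> N then null_measure borel else \<Phi> \<omega>)" for \<omega>
  have \<Psi> [measurable]: "\<Psi> \<in> measurable M counting_space"
    unfolding \<Psi>_def using N(1) null_measure_counting
    by (intro measurable_If_set measurable_const) (auto simp: space_counting_space null_sets_def)
  have eq: "AE \<omega> in M. \<Psi> \<omega> = \<Phi> \<omega>"
    using AE_not_in[OF N(1)] by eventually_elim (simp add: \<Psi>_def)
  obtain a where a: "a < 1" "C \<in> O(\<lambda>k. real k powr (a * real k))" using assms(6) by blast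
  obtain \<rho> where \<rho>: "\<And>n. n \<ge> 1 \<Longrightarrow> correlation_function M \<Phi> n (\<rho> n)"
    and decay: "\<And>p q x. p \<ge> 1 \<Longrightarrow> q \<ge> 1 \<Longrightarrow> \<bar>\<rho> (p + q) (restrict x {..<p + q})
              - \<rho> p (restrict x {..<p}) * \<rho> q (\<lambda>i\<in>{..<q}. x (p + i))\<bar>
           \<le> C (p + q) * \<delta> (setdist (x ` {..<p}) (x ` {p..<p + q}))"
    and \<delta>: "decay_function \<delta>"
    using assms(5) unfolding exp_decay_of_correlations_def by blast
  \<comment> \<open>The decay inequality concerns indices from 1 on; at 0 the value required by
    \<open>rho_0\<close> is inserted.\<close>
  define \<rho>' where "\<rho>' n = (if n = 0 then \<lambda>_. 1 else \<rho> n)" for n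
  have fm: "factorial_moment M \<Psi> n B = factorial_moment M \<Phi> n B" for n B
    unfolding factorial_moment_def by (rule nn_integral_cong_AE) (use eq in eventually_elim, simp)
  have distr_eq: "distr M counting_space (\<lambda>\<omega>. translate (\<Psi> \<omega>) x) = distr M counting_space (\<lambda>\<omega>. translate (\<Phi> \<omega>) x)"
    "distr M counting_space \<Psi> = distr M counting_space \<Phi>" for x
    using eq by (auto intro!: distr_cong_AE)
  interpret displaced_process M \<Psi> \<rho>' \<delta> C a Y
  proof unfold_locales
    show "simple_config (\<Psi> \<omega>)" if "\<omega> \<in> space M" for \<omega>
      using that N(2) by (auto simp: \<Psi>_def simple_config_def)
    show "stationary M \<Psi>" using assms(3) by (simp add: stationary_def distr_eq)
    show "correlation_function M \<Psi> n (\<rho>' n)" for n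
      using \<rho>[of n] correlation_function_0[OF prob_space_axioms, of \<Psi>]
      by (cases "n = 0") (simp_all add: \<rho>'_def correlation_function_def fm)
  qed (use \<delta> a decay assms(7,8,9) in \<open>auto simp: \<rho>'_def\<close>)
  have m: "(\<lambda>\<omega>. measure ((displace Y ^^ k) (L \<omega>)) (cball 0 r)) \<in> borel_measurable M"
    if "L \<in> measurable M counting_space" for L k r
    unfolding measure_def using measurable_emeasure_counting[OF measurable_iter[OF that], of "cball 0 r"] by simp
  have ae: "AE \<omega> in M. measure ((displace Y ^^ k) (\<Psi> \<omega>)) (cball 0 r) = measure ((displace Y ^^ k) (\<Phi> \<omega>)) (cball 0 r)" for k r
    using eq by eventually_elim simp
  have int: "integrable M (\<lambda>\<omega>. (measure ((displace Y ^^ k) (\<Phi> \<omega>)) (cball 0 r))\<^sup>2)" for k r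
    using displaced_count_square_integrable[of k r]
    by (rule integrable_cong_AE[THEN iffD1, rotated -1])
       (use ae[of k r] m[OF \<Phi>, of k r] m[OF \<Psi>, of k r] in auto)
  have E: "expectation (\<lambda>\<omega>. measure ((displace Y ^^ k) (\<Psi> \<omega>)) (cball 0 r))
      = expectation (\<lambda>\<omega>. measure ((displace Y ^^ k) (\<Phi> \<omega>)) (cball 0 r))" for k r
    by (rule integral_cong_AE[OF m[OF \<Psi>] m[OF \<Phi>] ae])
  have var: "variance (\<lambda>\<omega>. measure ((displace Y ^^ k) (\<Psi> \<omega>)) (cball 0 r))
      = variance (\<lambda>\<omega>. measure ((displace Y ^^ k) (\<Phi> \<omega>)) (cball 0 r))" for k r
    unfolding E using ae[of k r] m[OF \<Psi>, of k r] m[OF \<Phi>, of k r] by (intro integral_cong_AE) auto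
  obtain L where L: "\<And>k. ((\<lambda>r. variance (\<lambda>\<omega>. measure ((displace Y ^^ k) (\<Phi> \<omega>)) (cball 0 r))
      / measure lborel (cball (0::'a) r)) \<longlongrightarrow> L) at_top"
    using displaced_process_result unfolding var by blast
  \<comment> \<open>The iterate for k = 0 is \<Phi> itself, which gives the limit for the original
    process.\<close>
  from L[of 0] L int show ?thesis by auto
qed

end
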